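(* For any two automata-diagrams $d$ and $d'$ of the same type, $$[\![d]\!]\subseteq[\![d']\!]\quad\text{if and only if}\quad d\leq_{KDA}d'.$$
   Context: SYNTAX. Fix an alphabet $\Sigma$. $\mathsf{Syn}$ is the strict symmetric monoidal category freely generated by two objects $\blacktriangleright$ and $\blacktriangleleft$ and the morphisms listed below. Objects are finite words in $\blacktriangleright,\blacktriangleleft$; $I$ is the empty word; $f;g$ means first $f$ then $g$; the monoidal product is $\oplus$; the symmetry is $\sigma_{X,Y}:XY\to YX$; $\mathrm{id}:=\mathrm{id}_{\blacktriangleright}$. Generators: black generators $\mathsf c:\blacktriangleright\to\blacktriangleright\blacktriangleright$ (copy), $\mathsf k:\blacktriangleright\to I$ (discard), $\mathsf m:\blacktriangleright\blacktriangleright\to\blacktriangleright$ (merge), $\mathsf n:I\to\blacktriangleright$; $\mathrm{cup}:I\to\blacktriangleleft\blacktriangleright$, $\mathrm{cap}:\blacktriangleleft\blacktriangleright\to I$; letters $\underline a:\blacktriangleright\to\blacktriangleright$ for $a\in\Sigma$; white generators $\mathsf M:\blacktriangleright\blacktriangleright\to\blacktriangleright$, $\mathsf N:I\to\blacktriangleright$, $\mathsf C:\blacktriangleright\to\blacktriangleright\blacktriangleright$, $\mathsf K:\blacktriangleright\to I$. A diagram is a morphism of $\mathsf{Syn}$. An automaton-diagram is a diagram built (using $;$, $\oplus$, identities, symmetries) only from $\mathsf c,\mathsf k,\mathsf m,\mathsf n,\underline a,\mathrm{cup},\mathrm{cap}$. SEMANTICS. Let $\mathcal L=2^{\Sigma^*}$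 be the set of languages over $\Sigma$. A diagram with $m$ wires on the left and $n$ on the right is interpreted as a subset of $\mathcal L^m\times\mathcal L^n$. All variables range over $\mathcal L$, and $\bullet$ is the unique element of $\mathcal L^0$: $[\![\mathsf c]\!]=\{(L,(K_1,K_2)): L\subseteq K_1,L\subseteq K_2\}$, $[\![\mathsf k]\!]=\{(L,\bullet)\}$, $[\![\mathsf m]\!]=\{((L_1,L_2),K):L_1\subseteq K,L_2\subseteq K\}$, $[\![\mathsf n]\!]=\{(\bullet,K)\}$, $[\![\mathrm{cup}]\!]=\{(\bullet,(L,K)):L\subseteq K\}$, $[\![\mathrm{cap}]\!]=\{((L,K),\bullet):K\subseteq L\}$, $[\![\underline a]\!]=\{(L,K):La\subseteq K\}$, $[\![\mathsf M]\!]=\{((L_1,L_2),K):L_1\cap L_2\subseteq K\}$, $[\![\mathsf N]\!]=\{(\bullet,\Sigma^* )\}$, $[\![\mathsf C]\!]=\{(L,(K_1,K_2)):L\subseteq K_1\cup K_2\}$, $[\![\mathsf K]\!]=\{(\varnothing,\bullet)\}$, $[\![\mathrm{id}_{\blacktriangleright}]\!]=\{(L,K):L\subseteq K\}$, $[\![\mathrm{id}_{\blacktriangleleft}]\!]=\{(L,K):K\subseteq L\}$. Composition $;$ is interpreted as relational composition, $\oplus$ as the product of relations, and symmetries as the swap composed with the identities (orders) of the wires. THEORY KDA. Put $s:=\mathrm{id}\oplus\sigma_{\blacktriangleright,\blacktriangleright}\oplus\mathrm{id}$. Axioms (for all $a\in\Sigma$; an equality stands for two inequalities): (A1) $(\mathrm{cup}\oplus\mathrm{id});(\mathrm{id}_{\blacktriangleleft}\oplus\sigma_{\blacktriangleright,\blacktriangleright});(\mathrm{cap}\oplus\mathrm{id})=\mathrm{id}$;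 (A2) $(\mathrm{cup}\oplus\mathrm{id}_{\blacktriangleleft});(\mathrm{id}_{\blacktriangleleft}\oplus\sigma_{\blacktriangleright,\blacktriangleleft});(\mathrm{id}_{\blacktriangleleft}\oplus\mathrm{cap})=\mathrm{id}_{\blacktriangleleft}$; (A3) $\mathrm{cup};\mathrm{cap}=\mathrm{id}_I$. (B1) $\mathsf c;(\mathsf c\oplus\mathrm{id})=\mathsf c;(\mathrm{id}\oplus\mathsf c)$; (B2) $\mathsf c;(\mathrm{id}\oplus\mathsf k)=\mathrm{id}$; (B3) $\mathsf c;\sigma_{\blacktriangleright,\blacktriangleright}=\mathsf c$; (B4) $(\mathsf m\oplus\mathrm{id});\mathsf m=(\mathrm{id}\oplus\mathsf m);\mathsf m$; (B5) $(\mathrm{id}\oplus\mathsf n);\mathsf m=\mathrm{id}$; (B6) $\sigma_{\blacktriangleright,\blacktriangleright};\mathsf m=\mathsf m$; (B7) $\mathsf m;\mathsf c=(\mathsf c\oplus\mathsf c);s;(\mathsf m\oplus\mathsf m)$; (B8) $\mathsf n;\mathsf c=\mathsf n\oplus\mathsf n$; (B9) $\mathsf m;\mathsf k=\mathsf k\oplus\mathsf k$; (B10) $\mathsf c;\mathsf m=\mathrm{id}$; (B11) $\mathsf n;\mathsf k=\mathrm{id}_I$; (B12) $(\mathrm{cup}\oplus\mathrm{id});(\mathrm{id}_{\blacktriangleleft}\oplus(\mathsf m;\mathsf c));(\mathrm{cap}\oplus\mathrm{id})=\mathrm{id}$. (C1)–(C3): as (B1)–(B3) with $\mathsf C,\mathsf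 K$ replacing $\mathsf c,\mathsf k$; (C4)–(C6): as (B4)–(B6) with $\mathsf M,\mathsf N$ replacing $\mathsf m,\mathsf n$. (D1) $\mathsf N;\mathsf c=\mathsf N\oplus\mathsf N$; (D2) $\mathsf M;\mathsf c=(\mathsf c\oplus\mathsf c);s;(\mathsf M\oplus\mathsf M)$; (D3) $\mathsf M;\mathsf k=\mathsf k\oplus\mathsf k$; (D4) $\mathsf n;\mathsf C=\mathsf n\oplus\mathsf n$; (D5) $\mathsf m;\mathsf C=(\mathsf C\oplus\mathsf C);s;(\mathsf m\oplus\mathsf m)$; (D6) $\mathsf m;\mathsf K=\mathsf K\oplus\mathsf K$. (E1) $s;(\mathsf m\oplus\mathsf m);\mathsf M\leq(\mathsf M\oplus\mathsf M);\mathsf m$; (E2) $(\mathsf n\oplus\mathsf n);\mathsf M\leq\mathsf n$; (E4) $\mathsf C;(\mathsf c\oplus\mathsf c);s\leq\mathsf c;(\mathsf C\oplus\mathsf C)$; (E5) $\mathsf C;(\mathsf k\oplus\mathsf k)\leq\mathsf k$; (E6) $\underline a;\mathsf c=\mathsf c;(\underline a\oplus\underline a)$; (E7) $\underline a;\mathsf k=\mathsf k$; (E8) $(\underline a\oplus\underline a);\mathsf M=\mathsf M;\underline a$; (E9) $\mathsf N=\mathsf N;\underline a$; (E10) $\mathsf m;\underline a=(\underline a\oplus\underline a);\mathsf m$; (E11) $\mathsf n;\underline a=\mathsf n$; (E12) $\mathsf C;(\underline a\oplus\underline a)=\underline a;\mathsf C$; (E13) $\mathsf K=\underline a;\mathsf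 K$. (F1) $\mathsf m;\mathsf c\leq\mathrm{id}\oplus\mathrm{id}$; (F2) $\mathrm{id}\leq\mathsf k;\mathsf n$; (F3) $\mathrm{id}\leq\mathsf c;\mathsf m$; (F4) $\mathsf n;\mathsf k\leq\mathrm{id}_I$; (F5) $\mathrm{id}\oplus\mathrm{id}\leq\mathsf M;\mathsf c$; (F6) $\mathsf k;\mathsf N\leq\mathrm{id}$; (F7) $\mathsf c;\mathsf M\leq\mathrm{id}$; (F8) $\mathrm{id}_I\leq\mathsf N;\mathsf k$; (F9) $\mathrm{id}\oplus\mathrm{id}\leq\mathsf m;\mathsf C$; (F10) $\mathsf K;\mathsf n\leq\mathrm{id}$; (F11) $\mathsf C;\mathsf m\leq\mathrm{id}$; (F12) $\mathrm{id}_I\leq\mathsf n;\mathsf K$. $\leq_{KDA}$ is the smallest family of preorders on the hom-sets of $\mathsf{Syn}$ containing the axioms and closed under $;$ and $\oplus$. *)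

theory Defs
  imports Main
begin

section \<open>The free strict symmetric monoidal category\<close>

datatype wire = Fwd ("\<triangleright>") | Bwd ("\<triangleleft>")

type_synonym obj = "wire list"

datatype 'a gen =
    BCopy | BDiscard | BMerge | BUnit
  | Cup | Cap
  | Letter 'a
  | WMerge | WUnit | WCopy | WDiscard

primrec gen_src :: "'a gen \<Rightarrow> obj" where
  "gen_src BCopy = [\<triangleright>]"
| "gen_src BDiscard = [\<triangleright>]"
| "gen_src BMerge = [\<triangleright>, \<triangleright>]"
| "gen_src BUnit = []"
| "gen_src Cup = []"
| "gen_src Cap = [\<triangleleft>, \<triangleright>]"
| "gen_src (Letter a) = [\<triangleright>]"
| "gen_src WMerge = [\<triangleright>, \<triangleright>]"
| "gen_src WUnit = []"
| "gen_src WCopy = [\<triangleright>]"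
| "gen_src WDiscard = [\<triangleright>]"

primrec gen_tgt :: "'a gen \<Rightarrow> obj" where
  "gen_tgt BCopy = [\<triangleright>, \<triangleright>]"
| "gen_tgt BDiscard = []"
| "gen_tgt BMerge = [\<triangleright>]"
| "gen_tgt BUnit = [\<triangleright>]"
| "gen_tgt Cup = [\<triangleleft>, \<triangleright>]"
| "gen_tgt Cap = []"
| "gen_tgt (Letter a) = [\<triangleright>]"
| "gen_tgt WMerge = [\<triangleright>]"
| "gen_tgt WUnit = [\<triangleright>]"
| "gen_tgt WCopy = [\<triangleright>, \<triangleright>]"
| "gen_tgt WDiscard = []"

datatype 'a trm =
    TGen "'a gen"
  | TId obj
  | TSym obj obj
  | TSeq "'a trm" "'a trm"
  | TPar "'a trm" "'a trm"

primrec tsrc :: "'a trm \<Rightarrow> obj" where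
  "tsrc (TGen g) = gen_src g"
| "tsrc (TId X) = X"
| "tsrc (TSym X Y) = X @ Y"
| "tsrc (TSeq f g) = tsrc f"
| "tsrc (TPar f g) = tsrc f @ tsrc g"

primrec ttgt :: "'a trm \<Rightarrow> obj" where
  "ttgt (TGen g) = gen_tgt g"
| "ttgt (TId X) = X"
| "ttgt (TSym X Y) = Y @ X"
| "ttgt (TSeq f g) = ttgt g"
| "ttgt (TPar f g) = ttgt f @ ttgt g"

primrec well_typed :: "'a trm \<Rightarrow> bool" where
  "well_typed (TGen g) \<longleftrightarrow> True"
| "well_typed (TId X) \<longleftrightarrow> True"
| "well_typed (TSym X Y) \<longleftrightarrow> True"
| "well_typed (TSeq f g) \<longleftrightarrow> well_typed f \<and> well_typed g \<and> ttgt f = tsrc g"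
| "well_typed (TPar f g) \<longleftrightarrow> well_typed f \<and> well_typed g"

text \<open>
  The congruence on well-typed terms generated by the laws of strict symmetric monoidal
  categories. The second hexagon and the coherence of the symmetry with the empty word are
  omitted, since they follow from the laws listed.
\<close>

inductive smc_eq :: "'a trm \<Rightarrow> 'a trm \<Rightarrow> bool" where
  refl: "well_typed f \<Longrightarrow> smc_eq f f"
| sym: "smc_eq f g \<Longrightarrow> smc_eq g f"
| trans: "smc_eq f g \<Longrightarrow> smc_eq g h \<Longrightarrow> smc_eq f h"
| cong_seq: "smc_eq f f' \<Longrightarrow> smc_eq g g' \<Longrightarrow> ttgt f = tsrc g \<Longrightarrow> smc_eq (TSeq f g) (TSeq f' g')"
| cong_par: "smc_eq f f' \<Longrightarrow> smc_eq g g' \<Longrightarrow> smc_eq (TPar f g) (TPar f' g')"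
| id_left: "well_typed f \<Longrightarrow> smc_eq (TSeq (TId (tsrc f)) f) f"
| id_right: "well_typed f \<Longrightarrow> smc_eq (TSeq f (TId (ttgt f))) f"
| seq_assoc: "well_typed (TSeq (TSeq f g) h) \<Longrightarrow>
    smc_eq (TSeq (TSeq f g) h) (TSeq f (TSeq g h))"
| par_id: "smc_eq (TPar (TId X) (TId Y)) (TId (X @ Y))"
| par_unit_left: "well_typed f \<Longrightarrow> smc_eq (TPar (TId []) f) f"
| par_unit_right: "well_typed f \<Longrightarrow> smc_eq (TPar f (TId [])) f"
| par_assoc: "well_typed (TPar (TPar f g) h) \<Longrightarrow>
    smc_eq (TPar (TPar f g) h) (TPar f (TPar g h))"
| interchange: "well_typed (TSeq f g) \<Longrightarrow> well_typed (TSeq f' g') \<Longrightarrow>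
    smc_eq (TPar (TSeq f g) (TSeq f' g')) (TSeq (TPar f f') (TPar g g'))"
| sym_natural: "well_typed f \<Longrightarrow> well_typed g \<Longrightarrow>
    smc_eq (TSeq (TPar f g) (TSym (ttgt f) (ttgt g))) (TSeq (TSym (tsrc f) (tsrc g)) (TPar g f))"
| sym_involutive: "smc_eq (TSeq (TSym X Y) (TSym Y X)) (TId (X @ Y))"
| hexagon: "smc_eq (TSym X (Y @ Z)) (TSeq (TPar (TSym X Y) (TId Z)) (TPar (TId Y) (TSym X Z)))"

lemma smc_eq_typing:
  "smc_eq f g \<Longrightarrow> well_typed f \<and> well_typed g \<and> tsrc f = tsrc g \<and> ttgt f = ttgt g"
  by (induction rule: smc_eq.induct) auto

text \<open>Diagrams, i.e. morphisms of Syn: the well-typed terms modulo the congruence.\<close>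

quotient_type 'a diagram = "'a trm" / partial: smc_eq
proof (rule part_equivpI)
  show "\<exists>x :: 'a trm. smc_eq x x"
    by (rule exI[of _ "TId []"]) (simp add: smc_eq.refl)
  show "symp (smc_eq :: 'a trm \<Rightarrow> 'a trm \<Rightarrow> bool)"
    by (auto intro: sympI smc_eq.sym)
  show "transp (smc_eq :: 'a trm \<Rightarrow> 'a trm \<Rightarrow> bool)"
    by (auto intro: transpI smc_eq.trans)
qed

lift_definition src :: "'a diagram \<Rightarrow> obj" is tsrc
  by (simp add: smc_eq_typing)

lift_definition tgt :: "'a diagram \<Rightarrow> obj" is ttgt
  by (simp add: smc_eq_typing)

lift_definition gen :: "'a gen \<Rightarrow> 'a diagram" is TGen
  by (simp add: smc_eq.refl)

lift_definition idn :: "obj \<Rightarrow> 'a diagram" is TId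
  by (simp add: smc_eq.refl)

lift_definition symm :: "obj \<Rightarrow> obj \<Rightarrow> 'a diagram" ("\<sigma>") is TSym
  by (simp add: smc_eq.refl)

text \<open>Composition is only meaningful when the types match; the other branch is a junk value.\<close>

lift_definition seq :: "'a diagram \<Rightarrow> 'a diagram \<Rightarrow> 'a diagram" (infixl ";;" 55)
  is "\<lambda>f g. if ttgt f = tsrc g then TSeq f g else TId []"
  by (auto simp: smc_eq_typing intro: smc_eq.refl smc_eq.cong_seq)

lift_definition par :: "'a diagram \<Rightarrow> 'a diagram \<Rightarrow> 'a diagram" (infixr "\<oplus>" 65) is TPar
  by (rule smc_eq.cong_par)

abbreviation id\<^sub>r :: "'a diagram" where "id\<^sub>r \<equiv> idn [\<triangleright>]"
abbreviation id\<^sub>l :: "'a diagram" where "id\<^sub>l \<equiv> idn [\<triangleleft>]"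
abbreviation id\<^sub>I :: "'a diagram" where "id\<^sub>I \<equiv> idn []"
abbreviation \<sigma>\<^sub>r\<^sub>r :: "'a diagram" where "\<sigma>\<^sub>r\<^sub>r \<equiv> \<sigma> [\<triangleright>] [\<triangleright>]"
abbreviation \<sigma>\<^sub>r\<^sub>l :: "'a diagram" where "\<sigma>\<^sub>r\<^sub>l \<equiv> \<sigma> [\<triangleright>] [\<triangleleft>]"

abbreviation bcopy :: "'a diagram" ("\<^bold>c") where "\<^bold>c \<equiv> gen BCopy"
abbreviation bdiscard :: "'a diagram" ("\<^bold>k") where "\<^bold>k \<equiv> gen BDiscard"
abbreviation bmerge :: "'a diagram" ("\<^bold>m") where "\<^bold>m \<equiv> gen BMerge"
abbreviation bunit :: "'a diagram" ("\<^bold>n") where "\<^bold>n \<equiv> gen BUnit"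
abbreviation cup :: "'a diagram" where "cup \<equiv> gen Cup"
abbreviation cap :: "'a diagram" where "cap \<equiv> gen Cap"
abbreviation letter :: "'a \<Rightarrow> 'a diagram" where "letter a \<equiv> gen (Letter a)"
abbreviation wmerge :: "'a diagram" ("\<^bold>M") where "\<^bold>M \<equiv> gen WMerge"
abbreviation wunit :: "'a diagram" ("\<^bold>N") where "\<^bold>N \<equiv> gen WUnit"
abbreviation wcopy :: "'a diagram" ("\<^bold>C") where "\<^bold>C \<equiv> gen WCopy"
abbreviation wdiscard :: "'a diagram" ("\<^bold>K") where "\<^bold>K \<equiv> gen WDiscard"

definition automaton_gens :: "'a gen set" where
  "automaton_gens = {BCopy, BDiscard, BMerge, BUnit, Cup, Cap} \<union> range Letter"

inductive automaton_diagram :: "'a diagram \<Rightarrow> bool" where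
  gen: "g \<in> automaton_gens \<Longrightarrow> automaton_diagram (gen g)"
| idn: "automaton_diagram (idn X)"
| symm: "automaton_diagram (\<sigma> X Y)"
| seq: "automaton_diagram f \<Longrightarrow> automaton_diagram g \<Longrightarrow> tgt f = src g \<Longrightarrow> automaton_diagram (f ;; g)"
| par: "automaton_diagram f \<Longrightarrow> automaton_diagram g \<Longrightarrow> automaton_diagram (f \<oplus> g)"


section \<open>Semantics\<close>

text \<open>An element of the \<open>n\<close>-th power of the set of languages is a list of \<open>n\<close> languages.\<close>

type_synonym 'a lang = "'a list set"
type_synonym 'a lrel = "('a lang list \<times> 'a lang list) set"

definition rel_par :: "'a lrel \<Rightarrow> 'a lrel \<Rightarrow> 'a lrel" where
  "rel_par R S = {(xs @ ys, us @ vs) | xs ys us vs. (xs, us) \<in> R \<and> (ys, vs) \<in> S}"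

primrec wire_ord :: "wire \<Rightarrow> 'a lrel" where
  "wire_ord \<triangleright> = {([L], [K]) | L K. L \<subseteq> K}"
| "wire_ord \<triangleleft> = {([L], [K]) | L K. K \<subseteq> L}"

primrec obj_ord :: "obj \<Rightarrow> 'a lrel" where
  "obj_ord [] = {([], [])}"
| "obj_ord (w # X) = rel_par (wire_ord w) (obj_ord X)"

primrec gen_sem :: "'a gen \<Rightarrow> 'a lrel" where
  "gen_sem BCopy = {([L], [K1, K2]) | L K1 K2. L \<subseteq> K1 \<and> L \<subseteq> K2}"
| "gen_sem BDiscard = {([L], []) | L. True}"
| "gen_sem BMerge = {([L1, L2], [K]) | L1 L2 K. L1 \<subseteq> K \<and> L2 \<subseteq> K}"
| "gen_sem BUnit = {([], [K]) | K. True}"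
| "gen_sem Cup = {([], [L, K]) | L K. L \<subseteq> K}"
| "gen_sem Cap = {([L, K], []) | L K. K \<subseteq> L}"
| "gen_sem (Letter a) = {([L], [K]) | L K. (\<lambda>w. w @ [a]) ` L \<subseteq> K}"
| "gen_sem WMerge = {([L1, L2], [K]) | L1 L2 K. L1 \<inter> L2 \<subseteq> K}"
| "gen_sem WUnit = {([], [UNIV])}"
| "gen_sem WCopy = {([L], [K1, K2]) | L K1 K2. L \<subseteq> K1 \<union> K2}"
| "gen_sem WDiscard = {([{}], [])}"

primrec trm_sem :: "'a trm \<Rightarrow> 'a lrel" where
  "trm_sem (TGen g) = gen_sem g"
| "trm_sem (TId X) = obj_ord X"
| "trm_sem (TSym X Y) =
    {(xs @ ys, vs @ us) | xs ys us vs. (xs, us) \<in> obj_ord X \<and> (ys, vs) \<in> obj_ord Y}"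
| "trm_sem (TSeq f g) = trm_sem f O trm_sem g"
| "trm_sem (TPar f g) = rel_par (trm_sem f) (trm_sem g)"

lemma rel_parI: "(xs, us) \<in> R \<Longrightarrow> (ys, vs) \<in> S \<Longrightarrow> (xs @ ys, us @ vs) \<in> rel_par R S"
  by (auto simp: rel_par_def)

lemma rel_parE:
  assumes "(ps, qs) \<in> rel_par R S"
  obtains xs ys us vs where "ps = xs @ ys" "qs = us @ vs" "(xs, us) \<in> R" "(ys, vs) \<in> S"
  using assms by (auto simp: rel_par_def)

lemma rel_par_unit [simp]: "rel_par {([], [])} R = R" "rel_par R {([], [])} = R"
  by (auto simp: rel_par_def)

lemma rel_par_assoc: "rel_par (rel_par R S) T = rel_par R (rel_par S T)"
  by (auto simp: rel_par_def) (metis append.assoc)+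

definition has_arity :: "'a lrel \<Rightarrow> nat \<Rightarrow> nat \<Rightarrow> bool" where
  "has_arity R m n \<longleftrightarrow> (\<forall>(xs, ys) \<in> R. length xs = m \<and> length ys = n)"

lemma has_arityD: "has_arity R m n \<Longrightarrow> (xs, ys) \<in> R \<Longrightarrow> length xs = m \<and> length ys = n"
  by (auto simp: has_arity_def)

lemma has_arity_par:
  "has_arity R m n \<Longrightarrow> has_arity S m' n' \<Longrightarrow> has_arity (rel_par R S) (m + m') (n + n')"
  by (fastforce simp: has_arity_def rel_par_def)

lemma has_arity_seq: "has_arity R m n \<Longrightarrow> has_arity S n' k \<Longrightarrow> has_arity (R O S) m k"
  by (fastforce simp: has_arity_def)

lemma rel_par_O:
  assumes "has_arity R m n" "has_arity S n k"
  shows "rel_par (R O S) (R' O S') = rel_par R R' O rel_par S S'"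
proof (intro set_eqI iffI; clarify)
  fix p q assume "(p, q) \<in> rel_par (R O S) (R' O S')"
  then show "(p, q) \<in> rel_par R R' O rel_par S S'"
    by (elim rel_parE) (auto intro!: relcompI rel_parI)
next
  fix p q r assume a: "(p, q) \<in> rel_par R R'" "(q, r) \<in> rel_par S S'"
  from a(1) obtain xs ys us vs where
    1: "p = xs @ ys" "q = us @ vs" "(xs, us) \<in> R" "(ys, vs) \<in> R'" by (rule rel_parE)
  from a(2) obtain us' vs' as bs where
    2: "q = us' @ vs'" "r = as @ bs" "(us', as) \<in> S" "(vs', bs) \<in> S'" by (rule rel_parE)
  have "length us = length us'"
    using 1(3) 2(3) assms by (auto dest: has_arityD)
  with 1 2 have "us' = us" "vs' = vs" by auto
  with 1 2 show "(p, r) \<in> rel_par (R O S) (R' O S')" by (auto intro!: rel_parI)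
qed

lemma has_arity_obj_ord: "has_arity (obj_ord X) (length X) (length X)"
proof (induction X)
  case (Cons w X)
  have "has_arity (wire_ord w) 1 1" by (cases w) (auto simp: has_arity_def)
  from has_arity_par[OF this Cons] show ?case by simp
qed (simp add: has_arity_def)

lemma obj_ord_append: "obj_ord (X @ Y) = rel_par (obj_ord X) (obj_ord Y)"
  by (induction X) (simp_all add: rel_par_assoc)

lemma obj_ord_idem: "obj_ord X O obj_ord X = obj_ord X"
proof (induction X)
  case (Cons w X)
  have 1: "has_arity (wire_ord w) 1 1" and 2: "wire_ord w O wire_ord w = wire_ord w"
    by (cases w; auto simp: has_arity_def)+
  show ?case
    unfolding obj_ord.simps rel_par_O[OF 1 1, symmetric] 2 Cons ..
qed auto

lemma obj_ord_trans: "(xs, ys) \<in> obj_ord X \<Longrightarrow> (ys, zs) \<in> obj_ord X \<Longrightarrow> (xs, zs) \<in> obj_ord X"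
  using relcompI[of xs ys "obj_ord X" zs "obj_ord X"] by (simp only: obj_ord_idem)

lemma obj_ord_refl: "length xs = length X \<Longrightarrow> (xs, xs) \<in> obj_ord X"
proof (induction xs X rule: list_induct2)
  case (Cons x xs w X)
  have "([x], [x]) \<in> wire_ord w" by (cases w) auto
  from rel_parI[OF this Cons.IH] show ?case by simp
qed simp

definition rel_swap :: "nat \<Rightarrow> nat \<Rightarrow> 'a lrel" where
  "rel_swap m n = {(xs @ ys, ys @ xs) | xs ys. length xs = m \<and> length ys = n}"

lemma rel_swap_par:
  assumes "has_arity R m n" "has_arity S m' n'"
  shows "rel_par R S O rel_swap n n' = rel_swap m m' O rel_par S R"
proof (intro set_eqI iffI; clarify)
  fix p q r assume a: "(p, q) \<in> rel_par R S" "(q, r) \<in> rel_swap n n'"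
  from a(1) obtain xs ys us vs where
    1: "p = xs @ ys" "q = us @ vs" "(xs, us) \<in> R" "(ys, vs) \<in> S" by (rule rel_parE)
  have l: "length xs = m" "length us = n" "length ys = m'" "length vs = n'"
    using 1 assms by (auto dest: has_arityD)
  with 1 a(2) have "r = vs @ us" by (auto simp: rel_swap_def)
  with 1 l show "(p, r) \<in> rel_swap m m' O rel_par S R"
    by (auto intro!: relcompI[of _ "ys @ xs"] rel_parI simp: rel_swap_def)
next
  fix p q r assume a: "(p, q) \<in> rel_swap m m'" "(q, r) \<in> rel_par S R"
  from a(2) obtain xs ys us vs where
    1: "q = ys @ xs" "r = vs @ us" "(xs, us) \<in> R" "(ys, vs) \<in> S" by (blast elim: rel_parE)
  have l: "length xs = m" "length us = n" "length ys = m'" "length vs = n'"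
    using 1 assms by (auto dest: has_arityD)
  with 1 a(1) have "p = xs @ ys" by (auto simp: rel_swap_def)
  with 1 l show "(p, r) \<in> rel_par R S O rel_swap n n'"
    by (auto intro!: relcompI[of _ "us @ vs"] rel_parI simp: rel_swap_def)
qed

lemma trm_sem_TSym:
  "trm_sem (TSym X Y) = rel_par (obj_ord X) (obj_ord Y) O rel_swap (length X) (length Y)"
proof (intro set_eqI iffI; clarify)
  fix p q assume "(p, q) \<in> trm_sem (TSym X Y)"
  then obtain xs ys us vs where
    1: "p = xs @ ys" "q = vs @ us" "(xs, us) \<in> obj_ord X" "(ys, vs) \<in> obj_ord Y" by auto
  then have "length us = length X" "length vs = length Y"
    using has_arityD[OF has_arity_obj_ord] by blast+
  with 1 show "(p, q) \<in> rel_par (obj_ord X) (obj_ord Y) O rel_swap (length X) (length Y)"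
    by (auto intro!: relcompI[of _ "us @ vs"] rel_parI simp: rel_swap_def)
next
  fix p q r
  assume a: "(p, q) \<in> rel_par (obj_ord X) (obj_ord Y)" "(q, r) \<in> rel_swap (length X) (length Y)"
  from a(1) obtain xs ys us vs where
    1: "p = xs @ ys" "q = us @ vs" "(xs, us) \<in> obj_ord X" "(ys, vs) \<in> obj_ord Y" by (rule rel_parE)
  then have "length us = length X" "length vs = length Y"
    using has_arityD[OF has_arity_obj_ord] by blast+
  with 1 a(2) have "r = vs @ us" by (auto simp: rel_swap_def)
  with 1 show "(p, r) \<in> trm_sem (TSym X Y)" by auto
qed

lemma has_arity_swap: "has_arity (rel_swap m n) (m + n) (n + m)"
  by (auto simp: has_arity_def rel_swap_def)

lemma has_arity_trm_sem:
  "well_typed f \<Longrightarrow> has_arity (trm_sem f) (length (tsrc f)) (length (ttgt f))"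
proof (induction f)
  case (TGen g)
  show ?case by (cases g) (auto simp: has_arity_def)
next
  case (TSym X Y)
  show ?case
    using has_arity_seq[OF has_arity_par[OF has_arity_obj_ord has_arity_obj_ord] has_arity_swap,
        of X Y "length X" "length Y"]
    by (simp only: trm_sem_TSym tsrc.simps ttgt.simps length_append)
qed (auto intro: has_arity_obj_ord has_arity_par has_arity_seq)

lemma gen_sem_ord:
  "obj_ord (gen_src g) O gen_sem g = gen_sem g" "gen_sem g O obj_ord (gen_tgt g) = gen_sem g"
proof -
  have [simp]: "rel_par {([L], [K]) | L K. P L K} {([L], [K]) | L K. Q L K} =
      {([L1, L2], [K1, K2]) | L1 L2 K1 K2. P L1 K1 \<and> Q L2 K2}" for P Q :: "'a lang \<Rightarrow> 'a lang \<Rightarrow> bool"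
  proof (intro set_eqI iffI)
    fix p assume "p \<in> {([L1, L2], [K1, K2]) | L1 L2 K1 K2. P L1 K1 \<and> Q L2 K2}"
    then obtain L1 L2 K1 K2 where "p = ([L1] @ [L2], [K1] @ [K2])" "P L1 K1" "Q L2 K2" by auto
    then show "p \<in> rel_par {([L], [K]) | L K. P L K} {([L], [K]) | L K. Q L K}"
      by (simp only:) (rule rel_parI; simp)
  qed (auto simp: rel_par_def)
  have ar: "has_arity (gen_sem g) (length (gen_src g)) (length (gen_tgt g))"
    by (cases g) (auto simp: has_arity_def)
  have "obj_ord (gen_src g) O gen_sem g \<subseteq> gen_sem g"
    by (cases g; auto; blast)
  moreover have "gen_sem g \<subseteq> obj_ord (gen_src g) O gen_sem g"
    using has_arityD[OF ar] by (auto intro: obj_ord_refl)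
  ultimately show "obj_ord (gen_src g) O gen_sem g = gen_sem g" ..
  have "gen_sem g O obj_ord (gen_tgt g) \<subseteq> gen_sem g"
    by (cases g; auto; blast)
  moreover have "gen_sem g \<subseteq> gen_sem g O obj_ord (gen_tgt g)"
    using has_arityD[OF ar] by (auto intro: obj_ord_refl)
  ultimately show "gen_sem g O obj_ord (gen_tgt g) = gen_sem g" ..
qed

lemma trm_sem_ord:
  "well_typed f \<Longrightarrow> obj_ord (tsrc f) O trm_sem f = trm_sem f \<and> trm_sem f O obj_ord (ttgt f) = trm_sem f"
proof (induction f)
  case (TGen g)
  show ?case by (simp add: gen_sem_ord)
next
  case (TId X)
  show ?case by (simp add: obj_ord_idem)
next
  case (TSym X Y)
  note swap = rel_swap_par[OF has_arity_obj_ord[of X] has_arity_obj_ord[of Y]]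
  have "obj_ord (X @ Y) O trm_sem (TSym X Y) = trm_sem (TSym X Y)"
    unfolding trm_sem_TSym obj_ord_append[symmetric] O_assoc[symmetric] obj_ord_idem ..
  moreover have "trm_sem (TSym X Y) O obj_ord (Y @ X) = trm_sem (TSym X Y)"
    unfolding trm_sem_TSym swap
    unfolding obj_ord_append[symmetric] O_assoc obj_ord_idem ..
  ultimately show ?case by simp
next
  case (TSeq f g)
  then have "obj_ord (tsrc f) O trm_sem f = trm_sem f" "trm_sem g O obj_ord (ttgt g) = trm_sem g"
    by auto
  then show ?case by (simp only: tsrc.simps ttgt.simps trm_sem.simps O_assoc)
      (simp only: O_assoc[symmetric])
next
  case (TPar f g)
  then have "well_typed f" by simp
  note ar = has_arity_trm_sem[OF this]
  show ?case
    using TPar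
    by (simp add: obj_ord_append flip: rel_par_O[OF has_arity_obj_ord ar]
        rel_par_O[OF ar has_arity_obj_ord])
qed

lemma trm_sem_smc_eq:
  fixes f g :: "'a trm"
  shows "smc_eq f g \<Longrightarrow> trm_sem f = trm_sem g"
proof (induction rule: smc_eq.induct)
  case (id_left f)
  then show ?case by (simp add: trm_sem_ord)
next
  case (id_right f)
  then show ?case by (simp add: trm_sem_ord)
next
  case (interchange f g f' g')
  then have "has_arity (trm_sem f) (length (tsrc f)) (length (tsrc g))"
    "has_arity (trm_sem g) (length (tsrc g)) (length (ttgt g))"
    using has_arity_trm_sem[of f] has_arity_trm_sem[of g] by auto
  then show ?case by (simp add: rel_par_O)
next
  case (sym_natural f g)
  note wt = sym_natural
  note swap = rel_swap_par[OF has_arity_trm_sem[OF wt(1)] has_arity_trm_sem[OF wt(2)]]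
  note o1 = trm_sem_ord[of "TPar f g"]
  have "rel_par (trm_sem f) (trm_sem g) O obj_ord (ttgt f @ ttgt g) = rel_par (trm_sem f) (trm_sem g)"
    "obj_ord (tsrc f @ tsrc g) O rel_par (trm_sem f) (trm_sem g) = rel_par (trm_sem f) (trm_sem g)"
    using o1 wt by simp_all
  then show ?case
    unfolding trm_sem.simps(4,5) trm_sem_TSym obj_ord_append[symmetric]
    by (metis O_assoc swap)
next
  case (sym_involutive X Y)
  note swap = rel_swap_par[OF has_arity_obj_ord[of X, where 'a = 'a] has_arity_obj_ord[of Y, where 'a = 'a]]
  have "rel_par (obj_ord X :: 'a lrel) (obj_ord Y) O (rel_swap (length X) (length Y) O
      rel_swap (length Y) (length X)) = rel_par (obj_ord X) (obj_ord Y)" (is "?R O ?T = _")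
  proof -
    have t: "?T = {(ps, ps) | ps. length ps = length X + length Y}"
      unfolding rel_swap_def
      by (auto simp: relcomp_unfold)
        (metis append_take_drop_id length_take length_drop min.absorb2 le_add1 add_diff_cancel_left')
    have "has_arity ?R (length X + length Y) (length X + length Y)"
      by (intro has_arity_par has_arity_obj_ord)
    then show ?thesis unfolding t by (fastforce simp: has_arity_def)
  qed
  then have "?R O ?R O ?T = (obj_ord (X @ Y) :: 'a lrel)"
    unfolding obj_ord_append[symmetric] O_assoc[symmetric] obj_ord_idem .
  moreover have "(?R O rel_swap (length X) (length Y)) O
      rel_par (obj_ord Y :: 'a lrel) (obj_ord X) O rel_swap (length Y) (length X) = ?R O ?R O ?T"
    (is "(_ O ?s) O ?R' O ?s' = _")
  proof -
    have "(?R O ?s) O ?R' O ?s' = ?R O (?s O ?R') O ?s'" by (simp only: O_assoc)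
    also have "\<dots> = ?R O (?R O ?s) O ?s'" by (simp only: swap)
    also have "\<dots> = ?R O ?R O ?T" by (simp only: O_assoc)
    finally show ?thesis .
  qed
  ultimately show ?case
    unfolding trm_sem.simps(2,4) trm_sem_TSym by (simp only:)
next
  case (hexagon X Y Z)
  show ?case
  proof (intro set_eqI iffI; clarify)
    fix p q assume "(p, q) \<in> trm_sem (TSym X (Y @ Z))"
    then obtain xs us ys vs zs ws where *: "p = xs @ ys @ zs" "q = vs @ ws @ us"
      "(xs, us) \<in> obj_ord X" "(ys, vs) \<in> obj_ord Y" "(zs, ws) \<in> obj_ord Z"
      by (auto simp: obj_ord_append elim!: rel_parE)
    then have "(xs, xs) \<in> obj_ord X" "(ys, ys) \<in> obj_ord Y" "(zs, zs) \<in> obj_ord Z"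
      using has_arityD[OF has_arity_obj_ord] by (blast intro: obj_ord_refl)+
    with * have "((xs @ ys) @ zs, (ys @ xs) @ zs) \<in> trm_sem (TPar (TSym X Y) (TId Z))"
      "(ys @ xs @ zs, vs @ ws @ us) \<in> trm_sem (TPar (TId Y) (TSym X Z))"
      unfolding trm_sem.simps by (blast intro: rel_parI)+
    then show "(p, q) \<in> trm_sem (TSeq (TPar (TSym X Y) (TId Z)) (TPar (TId Y) (TSym X Z)))"
      using * by auto
  next
    fix p q
    assume "(p, q) \<in> trm_sem (TSeq (TPar (TSym X Y) (TId Z)) (TPar (TId Y) (TSym X Z)))"
    then obtain r where 1: "(p, r) \<in> rel_par (trm_sem (TSym X Y)) (obj_ord Z)"
      and 2: "(r, q) \<in> rel_par (obj_ord Y) (trm_sem (TSym X Z))" by auto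
    from 1 obtain xs ys zs xs' ys' zs' where 3: "p = xs @ ys @ zs" "r = ys' @ xs' @ zs'"
      "(xs, xs') \<in> obj_ord X" "(ys, ys') \<in> obj_ord Y" "(zs, zs') \<in> obj_ord Z"
      by (auto elim!: rel_parE)
    from 2 obtain xs'' ys'' zs'' us vs ws where 4: "r = ys'' @ xs'' @ zs''" "q = vs @ ws @ us"
      "(xs'', us) \<in> obj_ord X" "(ys'', vs) \<in> obj_ord Y" "(zs'', ws) \<in> obj_ord Z"
      by (auto elim!: rel_parE)
    have "length ys' = length ys''" "length xs' = length xs''"
      using has_arityD[OF has_arity_obj_ord] 3(3,4) 4(3,4) by metis+
    with 3(2) 4(1) have "ys'' = ys'" "xs'' = xs'" "zs'' = zs'" by auto
    with 3 4 have "(xs, us) \<in> obj_ord X" "(ys, vs) \<in> obj_ord Y" "(zs, ws) \<in> obj_ord Z"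
      using obj_ord_trans by blast+
    then have "(xs @ ys @ zs, (vs @ ws) @ us) \<in> trm_sem (TSym X (Y @ Z))"
      unfolding trm_sem.simps obj_ord_append by (blast intro: rel_parI)
    with 3 4 show "(p, q) \<in> trm_sem (TSym X (Y @ Z))" by simp
  qed
qed (auto simp: rel_par_assoc obj_ord_append O_assoc)

lift_definition sem :: "'a diagram \<Rightarrow> 'a lrel" ("\<lbrakk>_\<rbrakk>") is trm_sem
  by (rule trm_sem_smc_eq)


section \<open>The theory KDA\<close>

definition sw :: "'a diagram" ("\<^bold>s") where
  "\<^bold>s = id\<^sub>r \<oplus> \<sigma>\<^sub>r\<^sub>r \<oplus> id\<^sub>r"

inductive kda_eq_axiom :: "'a diagram \<Rightarrow> 'a diagram \<Rightarrow> bool" where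
  A1: "kda_eq_axiom ((cup \<oplus> id\<^sub>r) ;; (id\<^sub>l \<oplus> \<sigma>\<^sub>r\<^sub>r) ;; (cap \<oplus> id\<^sub>r)) id\<^sub>r"
| A2: "kda_eq_axiom ((cup \<oplus> id\<^sub>l) ;; (id\<^sub>l \<oplus> \<sigma>\<^sub>r\<^sub>l) ;; (id\<^sub>l \<oplus> cap)) id\<^sub>l"
| A3: "kda_eq_axiom (cup ;; cap) id\<^sub>I"
| B1: "kda_eq_axiom (\<^bold>c ;; (\<^bold>c \<oplus> id\<^sub>r)) (\<^bold>c ;; (id\<^sub>r \<oplus> \<^bold>c))"
| B2: "kda_eq_axiom (\<^bold>c ;; (id\<^sub>r \<oplus> \<^bold>k)) id\<^sub>r"
| B3: "kda_eq_axiom (\<^bold>c ;; \<sigma>\<^sub>r\<^sub>r) \<^bold>c"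
| B4: "kda_eq_axiom ((\<^bold>m \<oplus> id\<^sub>r) ;; \<^bold>m) ((id\<^sub>r \<oplus> \<^bold>m) ;; \<^bold>m)"
| B5: "kda_eq_axiom ((id\<^sub>r \<oplus> \<^bold>n) ;; \<^bold>m) id\<^sub>r"
| B6: "kda_eq_axiom (\<sigma>\<^sub>r\<^sub>r ;; \<^bold>m) \<^bold>m"
| B7: "kda_eq_axiom (\<^bold>m ;; \<^bold>c) ((\<^bold>c \<oplus> \<^bold>c) ;; \<^bold>s ;; (\<^bold>m \<oplus> \<^bold>m))"
| B8: "kda_eq_axiom (\<^bold>n ;; \<^bold>c) (\<^bold>n \<oplus> \<^bold>n)"
| B9: "kda_eq_axiom (\<^bold>m ;; \<^bold>k) (\<^bold>k \<oplus> \<^bold>k)"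
| B10: "kda_eq_axiom (\<^bold>c ;; \<^bold>m) id\<^sub>r"
| B11: "kda_eq_axiom (\<^bold>n ;; \<^bold>k) id\<^sub>I"
| B12: "kda_eq_axiom ((cup \<oplus> id\<^sub>r) ;; (id\<^sub>l \<oplus> (\<^bold>m ;; \<^bold>c)) ;; (cap \<oplus> id\<^sub>r)) id\<^sub>r"
| C1: "kda_eq_axiom (\<^bold>C ;; (\<^bold>C \<oplus> id\<^sub>r)) (\<^bold>C ;; (id\<^sub>r \<oplus> \<^bold>C))"
| C2: "kda_eq_axiom (\<^bold>C ;; (id\<^sub>r \<oplus> \<^bold>K)) id\<^sub>r"
| C3: "kda_eq_axiom (\<^bold>C ;; \<sigma>\<^sub>r\<^sub>r) \<^bold>C"
| C4: "kda_eq_axiom ((\<^bold>M \<oplus> id\<^sub>r) ;; \<^bold>M) ((id\<^sub>r \<oplus> \<^bold>M) ;; \<^bold>M)"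
| C5: "kda_eq_axiom ((id\<^sub>r \<oplus> \<^bold>N) ;; \<^bold>M) id\<^sub>r"
| C6: "kda_eq_axiom (\<sigma>\<^sub>r\<^sub>r ;; \<^bold>M) \<^bold>M"
| D1: "kda_eq_axiom (\<^bold>N ;; \<^bold>c) (\<^bold>N \<oplus> \<^bold>N)"
| D2: "kda_eq_axiom (\<^bold>M ;; \<^bold>c) ((\<^bold>c \<oplus> \<^bold>c) ;; \<^bold>s ;; (\<^bold>M \<oplus> \<^bold>M))"
| D3: "kda_eq_axiom (\<^bold>M ;; \<^bold>k) (\<^bold>k \<oplus> \<^bold>k)"
| D4: "kda_eq_axiom (\<^bold>n ;; \<^bold>C) (\<^bold>n \<oplus> \<^bold>n)"
| D5: "kda_eq_axiom (\<^bold>m ;; \<^bold>C) ((\<^bold>C \<oplus> \<^bold>C) ;; \<^bold>s ;; (\<^bold>m \<oplus> \<^bold>m))"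
| D6: "kda_eq_axiom (\<^bold>m ;; \<^bold>K) (\<^bold>K \<oplus> \<^bold>K)"
| E6: "kda_eq_axiom (letter a ;; \<^bold>c) (\<^bold>c ;; (letter a \<oplus> letter a))"
| E7: "kda_eq_axiom (letter a ;; \<^bold>k) \<^bold>k"
| E8: "kda_eq_axiom ((letter a \<oplus> letter a) ;; \<^bold>M) (\<^bold>M ;; letter a)"
| E9: "kda_eq_axiom \<^bold>N (\<^bold>N ;; letter a)"
| E10: "kda_eq_axiom (\<^bold>m ;; letter a) ((letter a \<oplus> letter a) ;; \<^bold>m)"
| E11: "kda_eq_axiom (\<^bold>n ;; letter a) \<^bold>n"
| E12: "kda_eq_axiom (\<^bold>C ;; (letter a \<oplus> letter a)) (letter a ;; \<^bold>C)"
| E13: "kda_eq_axiom \<^bold>K (letter a ;; \<^bold>K)"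

inductive kda_le_axiom :: "'a diagram \<Rightarrow> 'a diagram \<Rightarrow> bool" where
  E1: "kda_le_axiom (\<^bold>s ;; (\<^bold>m \<oplus> \<^bold>m) ;; \<^bold>M) ((\<^bold>M \<oplus> \<^bold>M) ;; \<^bold>m)"
| E2: "kda_le_axiom ((\<^bold>n \<oplus> \<^bold>n) ;; \<^bold>M) \<^bold>n"
| E4: "kda_le_axiom (\<^bold>C ;; (\<^bold>c \<oplus> \<^bold>c) ;; \<^bold>s) (\<^bold>c ;; (\<^bold>C \<oplus> \<^bold>C))"
| E5: "kda_le_axiom (\<^bold>C ;; (\<^bold>k \<oplus> \<^bold>k)) \<^bold>k"
| F1: "kda_le_axiom (\<^bold>m ;; \<^bold>c) (id\<^sub>r \<oplus> id\<^sub>r)"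
| F2: "kda_le_axiom id\<^sub>r (\<^bold>k ;; \<^bold>n)"
| F3: "kda_le_axiom id\<^sub>r (\<^bold>c ;; \<^bold>m)"
| F4: "kda_le_axiom (\<^bold>n ;; \<^bold>k) id\<^sub>I"
| F5: "kda_le_axiom (id\<^sub>r \<oplus> id\<^sub>r) (\<^bold>M ;; \<^bold>c)"
| F6: "kda_le_axiom (\<^bold>k ;; \<^bold>N) id\<^sub>r"
| F7: "kda_le_axiom (\<^bold>c ;; \<^bold>M) id\<^sub>r"
| F8: "kda_le_axiom id\<^sub>I (\<^bold>N ;; \<^bold>k)"
| F9: "kda_le_axiom (id\<^sub>r \<oplus> id\<^sub>r) (\<^bold>m ;; \<^bold>C)"
| F10: "kda_le_axiom (\<^bold>K ;; \<^bold>n) id\<^sub>r"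
| F11: "kda_le_axiom (\<^bold>C ;; \<^bold>m) id\<^sub>r"
| F12: "kda_le_axiom id\<^sub>I (\<^bold>n ;; \<^bold>K)"

inductive kda_le :: "'a diagram \<Rightarrow> 'a diagram \<Rightarrow> bool" (infix "\<le>\<^sub>K\<^sub>D\<^sub>A" 50) where
  ax_le: "kda_le_axiom f g \<Longrightarrow> f \<le>\<^sub>K\<^sub>D\<^sub>A g"
| ax_eq: "kda_eq_axiom f g \<Longrightarrow> f \<le>\<^sub>K\<^sub>D\<^sub>A g"
| ax_eq_converse: "kda_eq_axiom f g \<Longrightarrow> g \<le>\<^sub>K\<^sub>D\<^sub>A f"
| refl: "f \<le>\<^sub>K\<^sub>D\<^sub>A f"
| trans: "f \<le>\<^sub>K\<^sub>D\<^sub>A g \<Longrightarrow> g \<le>\<^sub>K\<^sub>D\<^sub>A h \<Longrightarrow> f \<le>\<^sub>K\<^sub>D\<^sub>A h"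
| seq: "f \<le>\<^sub>K\<^sub>D\<^sub>A f' \<Longrightarrow> g \<le>\<^sub>K\<^sub>D\<^sub>A g' \<Longrightarrow> tgt f = src g \<Longrightarrow> f ;; g \<le>\<^sub>K\<^sub>D\<^sub>A f' ;; g'"
| par: "f \<le>\<^sub>K\<^sub>D\<^sub>A f' \<Longrightarrow> g \<le>\<^sub>K\<^sub>D\<^sub>A g' \<Longrightarrow> f \<oplus> g \<le>\<^sub>K\<^sub>D\<^sub>A f' \<oplus> g'"

lemma src_simps [simp]:
  "src (gen x) = gen_src x" "src (idn X) = X" "src (\<sigma> X Y) = X @ Y"
  "tgt f = src g \<Longrightarrow> src (f ;; g) = src f" "src (f \<oplus> g) = src f @ src g"
  by (transfer; simp)+

lemma tgt_simps [simp]: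
  "tgt (gen x) = gen_tgt x" "tgt (idn X) = X" "tgt (\<sigma> X Y) = Y @ X"
  "tgt f = src g \<Longrightarrow> tgt (f ;; g) = tgt g" "tgt (f \<oplus> g) = tgt f @ tgt g"
  by (transfer; simp)+

lemma kda_eq_axiom_typing: "kda_eq_axiom f g \<Longrightarrow> src f = src g \<and> tgt f = tgt g"
  by (induction rule: kda_eq_axiom.induct) (simp_all add: sw_def)

lemma kda_le_axiom_typing: "kda_le_axiom f g \<Longrightarrow> src f = src g \<and> tgt f = tgt g"
  by (induction rule: kda_le_axiom.induct) (simp_all add: sw_def)

text \<open>The relation only relates parallel diagrams, so it is a family of preorders on hom-sets.\<close>

lemma kda_le_typing: "f \<le>\<^sub>K\<^sub>D\<^sub>A g \<Longrightarrow> src f = src g \<and> tgt f = tgt g"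
  by (induction rule: kda_le.induct)
    (simp_all add: kda_eq_axiom_typing kda_le_axiom_typing)

lemma sem_arity: "(xs, ys) \<in> \<lbrakk>d\<rbrakk> \<Longrightarrow> length xs = length (src d) \<and> length ys = length (tgt d)"
  by transfer (metis has_arityD has_arity_trm_sem smc_eq_typing)

lemma sem_simps:
  "\<lbrakk>gen x\<rbrakk> = gen_sem x" "\<lbrakk>idn X\<rbrakk> = obj_ord X"
  "\<lbrakk>\<sigma> X Y\<rbrakk> = {(xs @ ys, vs @ us) | xs ys us vs. (xs, us) \<in> obj_ord X \<and> (ys, vs) \<in> obj_ord Y}"
  "tgt f = src g \<Longrightarrow> \<lbrakk>f ;; g\<rbrakk> = \<lbrakk>f\<rbrakk> O \<lbrakk>g\<rbrakk>" "\<lbrakk>f \<oplus> g\<rbrakk> = rel_par \<lbrakk>f\<rbrakk> \<lbrakk>g\<rbrakk>"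
  by (transfer; simp)+

end

theory Submission
  imports Defs
begin

text \<open>
  Soundness cannot be proved in the language semantics, where the inequality \<open>N;a \<le> N\<close> contained in
  (E9) fails. On languages over \<open>'a option\<close>, however, appending a letter extends to a bijection of
  words. This gives a second model, in which all axioms hold and whose restriction to automaton
  diagrams is the language semantics.

  For completeness, bend the outputs of a diagram to the left. The result is, up to a structural
  isomorphism, a finite automaton (the trace of a layer of letters followed by a boolean matrix),
  also bent. An inclusion of relations between two such automata is an inclusion of their languages:
  apply it to the least solution of one of them. It is realised in KDA by a simulation, which sends a
  state of the second automaton to a union of intersections of states of the first. These operations
  have right adjoints, so the simulation can be slid lax-naturally through the trace.
\<close>

section \<open>Diagrams modulo KDA equivalence\<close>

text \<open>An inclusion between languages of nondeterministic automata is in general not witnessed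
  by a relation between their states; the second automaton has to be compared with the subset
  construction of the first. This is why white generators are needed although automaton diagrams
  contain none: an intersection of state variables represents a state of the determinised automaton.
  Such intersections occur in the simulation only, never in the normal forms. A larger relation
  imposes fewer constraints, so inclusion of relations reverses inclusion of languages. Two
  obstacles shape the rest. Wires run in both directions, so two diagrams of the same type may be
  sorted into automaton form by different permutations of wires; but a permutation of
  \<open>L n @ R p\<close> cannot mix the orientations, hence splits and is absorbed into a matrix.
  Moreover, the language semantics is not invariant under KDA equivalence, while normal forms are
  reached only up to it. Hence \<open>lang_sem\<close>, which is read off the sound model at
  embedded languages and is compositional for \<open>stable\<close> elements.\<close>

lemma smc_eq_wt: "smc_eq f f \<longleftrightarrow> well_typed f"
  using smc_eq.refl smc_eq_typing by blast

lemma diagram_seq_assoc: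
  "tgt f = src g \<Longrightarrow> tgt g = src h \<Longrightarrow> (f ;; g) ;; h = f ;; (g ;; h)"
  by transfer (auto simp: smc_eq_wt intro: smc_eq.seq_assoc)

lemma diagram_id_left: "src f = X \<Longrightarrow> idn X ;; f = f"
  by transfer (auto simp: smc_eq_wt intro: smc_eq.id_left)

lemma diagram_id_right: "tgt f = X \<Longrightarrow> f ;; idn X = f"
  by transfer (auto simp: smc_eq_wt intro: smc_eq.id_right)

lemma diagram_par_id: "idn X \<oplus> idn Y = idn (X @ Y)"
  by transfer (rule smc_eq.par_id)

lemma diagram_par_unit: "idn [] \<oplus> f = f" "f \<oplus> idn [] = f"
  by (transfer, auto simp: smc_eq_wt intro: smc_eq.par_unit_left smc_eq.par_unit_right)+

lemma diagram_par_assoc: "(f \<oplus> g) \<oplus> h = f \<oplus> (g \<oplus> h)"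
  by transfer (auto simp: smc_eq_wt intro: smc_eq.par_assoc)

lemma diagram_interchange:
  "tgt f = src g \<Longrightarrow> tgt f' = src g' \<Longrightarrow> (f ;; g) \<oplus> (f' ;; g') = (f \<oplus> f') ;; (g \<oplus> g')"
  by transfer (auto simp: smc_eq_wt intro: smc_eq.interchange)

lemma diagram_sym_natural:
  "(f \<oplus> g) ;; \<sigma> (tgt f) (tgt g) = \<sigma> (src f) (src g) ;; (g \<oplus> f)"
  by transfer (auto simp: smc_eq_wt intro: smc_eq.sym_natural)

lemma diagram_sym_involutive: "\<sigma> X Y ;; \<sigma> Y X = idn (X @ Y)"
  by transfer (auto intro: smc_eq.sym_involutive)

lemma diagram_hexagon: "\<sigma> X (Y @ Z) = (\<sigma> X Y \<oplus> idn Z) ;; (idn Y \<oplus> \<sigma> X Z)"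
  by transfer (auto intro: smc_eq.hexagon)

definition kda_eq :: "'a diagram \<Rightarrow> 'a diagram \<Rightarrow> bool" where
  "kda_eq f g \<longleftrightarrow> f \<le>\<^sub>K\<^sub>D\<^sub>A g \<and> g \<le>\<^sub>K\<^sub>D\<^sub>A f"

lemma kda_eq_typing: "kda_eq f g \<Longrightarrow> src f = src g \<and> tgt f = tgt g"
  by (simp add: kda_eq_def kda_le_typing)

\<comment> \<open>Over this quotient the KDA order is antisymmetric: provable equivalences become
  equations for rewriting, and universal properties determine elements uniquely.\<close>
quotient_type 'a kd = "'a diagram" / kda_eq
  by (intro equivpI reflpI sympI transpI) (auto simp: kda_eq_def intro: kda_le.refl kda_le.trans)

lift_definition dom :: "'a kd \<Rightarrow> obj" is src by (simp add: kda_eq_typing)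
lift_definition cod :: "'a kd \<Rightarrow> obj" is tgt by (simp add: kda_eq_typing)
lift_definition ge :: "'a gen \<Rightarrow> 'a kd" is gen .
lift_definition one :: "obj \<Rightarrow> 'a kd" is idn .
lift_definition sy :: "obj \<Rightarrow> obj \<Rightarrow> 'a kd" is \<sigma> .

lemma seq_junk: "tgt f \<noteq> src g \<Longrightarrow> f ;; g = idn []"
  by transfer (auto simp: smc_eq_wt)

text \<open>If the types do not match, both composites are the same junk value
  \<open>idn []\<close>. The form without a typing hypothesis is what lifting \<open>;;\<close> to a
  total operation on the quotient needs.\<close>

lemma kda_le_seq:
  assumes "f \<le>\<^sub>K\<^sub>D\<^sub>A f'" "g \<le>\<^sub>K\<^sub>D\<^sub>A g'"
  shows "f ;; g \<le>\<^sub>K\<^sub>D\<^sub>A f' ;; g'"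
  using kda_le_typing[OF assms(1)] kda_le_typing[OF assms(2)] assms
  by (cases "tgt f = src g") (auto simp: seq_junk intro: kda_le.seq kda_le.refl)

lift_definition sq :: "'a kd \<Rightarrow> 'a kd \<Rightarrow> 'a kd" (infixl ">>" 60) is seq
  by (simp add: kda_eq_def kda_le_seq)

lift_definition pr :: "'a kd \<Rightarrow> 'a kd \<Rightarrow> 'a kd" (infixr "||" 65) is par
  by (auto simp: kda_eq_def intro: kda_le.par)

instantiation kd :: (type) order
begin
lift_definition less_eq_kd :: "'a kd \<Rightarrow> 'a kd \<Rightarrow> bool" is kda_le
  unfolding kda_eq_def by (blast intro: kda_le.trans)
definition less_kd :: "'a kd \<Rightarrow> 'a kd \<Rightarrow> bool" where "less_kd f g \<longleftrightarrow> f \<le> g \<and> \<not> g \<le> f"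
instance
proof
  fix f g h :: "'a kd"
  show "f < g \<longleftrightarrow> f \<le> g \<and> \<not> g \<le> f" by (rule less_kd_def)
  show "f \<le> f" by transfer (rule kda_le.refl)
  show "f \<le> g \<Longrightarrow> g \<le> h \<Longrightarrow> f \<le> h" by transfer (rule kda_le.trans)
  show "f \<le> g \<Longrightarrow> g \<le> f \<Longrightarrow> f = g" by transfer (simp add: kda_eq_def)
qed
end

lemma dom_simps [simp]: "dom (ge x) = gen_src x" "dom (one X) = X" "dom (sy X Y) = X @ Y"
  "cod f = dom g \<Longrightarrow> dom (f >> g) = dom f" "dom (f || g) = dom f @ dom g"
  by (transfer; simp)+

lemma cod_simps [simp]: "cod (ge x) = gen_tgt x" "cod (one X) = X" "cod (sy X Y) = Y @ X"
  "cod f = dom g \<Longrightarrow> cod (f >> g) = cod g" "cod (f || g) = cod f @ cod g"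
  by (transfer; simp)+

lemma kd_eqI: "f = g \<Longrightarrow> kda_eq f g" by (simp add: kda_eq_def kda_le.refl)

lemma sq_assoc: "cod f = dom g \<Longrightarrow> cod g = dom h \<Longrightarrow> (f >> g) >> h = f >> (g >> h)"
  by transfer (intro kd_eqI diagram_seq_assoc)
lemma one_sq [simp]: "dom f = X \<Longrightarrow> one X >> f = f"
  by transfer (intro kd_eqI diagram_id_left)
lemma sq_one [simp]: "cod f = X \<Longrightarrow> f >> one X = f"
  by transfer (intro kd_eqI diagram_id_right)
lemma pr_one [simp]: "one X || one Y = one (X @ Y)"
  by transfer (intro kd_eqI diagram_par_id)
lemma pr_unit [simp]: "one [] || f = f" "f || one [] = f"
  by (transfer, intro kd_eqI diagram_par_unit)+
lemma pr_assoc [simp]: "(f || g) || h = f || (g || h)"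
  by transfer (intro kd_eqI diagram_par_assoc)
lemma interchange:
  "cod f = dom g \<Longrightarrow> cod f' = dom g' \<Longrightarrow> (f || f') >> (g || g') = (f >> g) || (f' >> g')"
  by transfer (intro kd_eqI diagram_interchange[symmetric])
lemma sy_natural:
  "dom f = A \<Longrightarrow> dom g = B \<Longrightarrow> cod f = C \<Longrightarrow> cod g = D \<Longrightarrow> (f || g) >> sy C D = sy A B >> (g || f)"
  by transfer (use diagram_sym_natural in \<open>auto intro: kd_eqI\<close>)
lemma sy_sy [simp]: "sy X Y >> sy Y X = one (X @ Y)"
  by transfer (intro kd_eqI diagram_sym_involutive)
lemma hexagon: "sy X (Y @ Z) = (sy X Y || one Z) >> (one Y || sy X Z)"
  by transfer (intro kd_eqI diagram_hexagon)

lemma sq_mono: "f \<le> f' \<Longrightarrow> g \<le> g' \<Longrightarrow> f >> g \<le> f' >> g'"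
  by transfer (rule kda_le_seq)
lemma pr_mono: "f \<le> f' \<Longrightarrow> g \<le> g' \<Longrightarrow> f || g \<le> f' || g'"
  by transfer (rule kda_le.par)
abbreviation "cc \<equiv> ge BCopy"
abbreviation "kk \<equiv> ge BDiscard"
abbreviation "mm \<equiv> ge BMerge"
abbreviation "nn \<equiv> ge BUnit"
abbreviation "MM \<equiv> ge WMerge"
abbreviation "NN \<equiv> ge WUnit"
abbreviation "WC \<equiv> ge WCopy"
abbreviation "WK \<equiv> ge WDiscard"
abbreviation "cu \<equiv> ge Cup"
abbreviation "ca \<equiv> ge Cap"
abbreviation "ltr a \<equiv> ge (Letter a)"
abbreviation "i1 \<equiv> one [\<triangleright>]"
abbreviation "l1 \<equiv> one [\<triangleleft>]"
abbreviation "s1 \<equiv> sy [\<triangleright>] [\<triangleright>]"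
abbreviation "ss \<equiv> i1 || s1 || i1"

section \<open>The axioms as equations and inequalities in the quotient\<close>

lemma ax_eqI: "kda_eq_axiom f g \<Longrightarrow> kda_eq f g"
  by (simp add: kda_eq_def kda_le.ax_eq kda_le.ax_eq_converse)

lemma
  shows A1: "((cu || i1) >> (l1 || s1)) >> (ca || i1) = i1"
  and A2: "((cu || l1) >> (l1 || sy [\<triangleright>] [\<triangleleft>])) >> (l1 || ca) = l1"
  and B1: "cc >> (cc || i1) = cc >> (i1 || cc)"
  and B2: "cc >> (i1 || kk) = i1"
  and B3: "cc >> s1 = cc"
  and B7: "mm >> cc = ((cc || cc) >> ss) >> (mm || mm)"
  and B8: "nn >> cc = nn || nn"
  and B9: "mm >> kk = kk || kk"
  and B10: "cc >> mm = i1"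
  and B11: "nn >> kk = one []"
  and B12: "((cu || i1) >> (l1 || (mm >> cc))) >> (ca || i1) = i1"
  and D1: "NN >> cc = NN || NN"
  and D2: "MM >> cc = ((cc || cc) >> ss) >> (MM || MM)"
  and D3: "MM >> kk = kk || kk"
  and E6: "ltr a >> cc = cc >> (ltr a || ltr a)"
  and E7: "ltr a >> kk = kk"
  and E10: "mm >> ltr a = (ltr a || ltr a) >> mm"
  and E11: "nn >> ltr a = nn"
  by (transfer, intro ax_eqI, rule kda_eq_axiom.intros[unfolded sw_def])+

lemma
  shows F1: "mm >> cc \<le> i1 || i1"
  and F2: "i1 \<le> kk >> nn"
  and F3: "i1 \<le> cc >> mm"
  and F4: "nn >> kk \<le> one []"
  and F5: "i1 || i1 \<le> MM >> cc"
  and F6: "kk >> NN \<le> i1"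
  and F7: "cc >> MM \<le> i1"
  and F8: "one [] \<le> NN >> kk"
  and F9: "i1 || i1 \<le> mm >> WC"
  and F10: "WK >> nn \<le> i1"
  and F11: "WC >> mm \<le> i1"
  and F12: "one [] \<le> nn >> WK"
  by (transfer, rule kda_le.ax_le, rule kda_le_axiom.intros)+

section \<open>Duals, cups and caps\<close>

lemma interchange_seq:
  "cod f = dom g \<Longrightarrow> cod f' = dom g' \<Longrightarrow> dom h = cod g @ cod g' \<Longrightarrow>
   (f || f') >> ((g || g') >> h) = ((f >> g) || (f' >> g')) >> h"
  by (simp add: sq_assoc[symmetric] interchange)

lemma pr_one_par [simp]: "one X || one Y || f = one (X @ Y) || f"
  by (simp flip: pr_assoc)

lemma pr_sq_one: "cod f = dom g \<Longrightarrow> (f >> g) || one X = (f || one X) >> (g || one X)"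
  by (simp add: interchange)

lemma one_pr_sq: "cod f = dom g \<Longrightarrow> one X || (f >> g) = (one X || f) >> (one X || g)"
  by (simp add: interchange)

lemma one_pr_sq_one: "cod f = dom g \<Longrightarrow>
    one X || (f >> g) || one Y = (one X || f || one Y) >> (one X || g || one Y)"
  by (simp add: interchange)

lemmas pr_split = pr_sq_one one_pr_sq one_pr_sq_one

text \<open>The hexagon at two empty words makes \<open>sy X []\<close> idempotent, and an
  idempotent isomorphism is an identity.\<close>

lemma sy_nil_right [simp]: "sy X [] = (one X :: 'a kd)"
proof -
  have "one X = (sy X [] >> sy X []) >> (sy [] X :: 'a kd)"
    using hexagon[of X "[]" "[]", where 'a = 'a] by simp
  also have "\<dots> = sy X []"
    by (simp add: sq_assoc)
  finally show ?thesis ..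
qed

lemma sy_nil_left [simp]: "sy [] X = one X"
  using sy_sy[of X "[]"] by simp

lemma sy_sy_seq [simp]: "dom f = X @ Y \<Longrightarrow> sy X Y >> (sy Y X >> f) = f"
  by (simp add: sq_assoc[symmetric])

lemma inverse_unique:
  assumes "f >> g = one X" "g >> h = one Y" "cod f = dom g" "cod g = dom h"
  shows "f = h"
proof -
  have "cod g = X" "dom g = Y"
    using cod_simps(4)[OF assms(3)] dom_simps(4)[OF assms(4)] assms(1,2) by simp_all
  then have "f = f >> (g >> h)" using assms(2,3) by simp
  also have "\<dots> = (f >> g) >> h" using assms(3,4) by (simp add: sq_assoc)
  also have "\<dots> = h" using assms(1,4) \<open>cod g = X\<close> by simp
  finally show ?thesis .
qed

text \<open>Both sides are inverse to \<open>sy Z (X @ Y)\<close>, to which the first hexagon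
  applies.\<close>

lemma hexagon': "sy (X @ Y) Z = (one X || sy Y Z) >> (sy X Z || one Y)"
proof (rule inverse_unique[symmetric])
  show "((one X || sy Y Z) >> (sy X Z || one Y)) >> sy Z (X @ Y) = one (X @ Y @ Z)"
    by (simp add: hexagon sq_assoc interchange_seq interchange)
qed simp_all

text \<open>A crossing of two pairs of bundles consists of four crossings, and that of
  \<open>A\<close> with \<open>D\<close> is cancelled by the appended \<open>sy D A\<close>. Needed
  for copying a crossing (\<open>cmap_s1\<close>) and for unwinding crossed caps
  (\<open>ev_dual\<close>).\<close>

lemma sy_four:
  "sy (A @ B) (C @ D) >> (one C || sy D A || one B) = (one A || sy B C || one D) >> (sy A C || sy B D :: 'a kd)"
proof -
  have "sy (A @ B) (C @ D) = (one A || sy B C || one D) >> ((sy A C || one (B @ D)) >>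
     ((one (C @ A) || sy B D) >> (one C || sy A D || one B :: 'a kd)))"
  proof -
    have "(one (A @ C) || sy B D) >> ((sy A C || one (D @ B)) >> h) =
        (sy A C || one (B @ D)) >> ((one (C @ A) || sy B D) >> h)"
      if "dom h = C @ A @ D @ B" for h :: "'a kd"
      using that by (simp add: interchange_seq)
    then show ?thesis
      by (simp add: hexagon'[of A B] hexagon[of _ C D] pr_split sq_assoc)
  qed
  then have *: "sy (A @ B) (C @ D) >> g = (one A || sy B C || one D) >> ((sy A C || one (B @ D)) >>
     ((one (C @ A) || sy B D) >> (one C || sy A D || one B))) >> g" for g :: "'a kd"
    by simp
  show ?thesis
    by (simp only: *) (simp add: sq_assoc interchange)
qed

text \<open>Naturality of the symmetry at an effect: on the output side the crossing is with the
  empty word and vanishes.\<close>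

lemma effect_slide: "dom f = W \<Longrightarrow> cod f = [] \<Longrightarrow> f || one U = sy W U >> (one U || f)"
  using sy_natural[of f W "one U" U "[]" U] by simp

lemma effect_slide': "dom f = W \<Longrightarrow> cod f = [] \<Longrightarrow> one U || f = sy U W >> (f || one U)"
  using sy_natural[of "one U" U f W U "[]"] by simp

lemma state_slide: "cod f = W \<Longrightarrow> dom f = [] \<Longrightarrow> (f || one U) >> sy W U = one U || f"
  using sy_natural[of f "[]" "one U" U W U] by simp

lemma state_slide': "cod f = W \<Longrightarrow> dom f = [] \<Longrightarrow> (one U || f) >> sy U W = f || one U"
  using sy_natural[of "one U" U f "[]" U W] by simp

section \<open>Duals of words, with nested caps and cups\<close>

primrec flip :: "wire \<Rightarrow> wire" where "flip \<triangleright> = \<triangleleft>" | "flip \<triangleleft> = \<triangleright>"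

lemma flip_flip [simp]: "flip (flip w) = w" by (cases w) auto

text \<open>The reversal lets the caps between \<open>dual X\<close> and \<open>X\<close> nest
  without crossing each other.\<close>

definition dual :: "obj \<Rightarrow> obj" where "dual X = rev (map flip X)"

lemma dual_simps [simp]: "dual [] = []" "dual (X @ Y) = dual Y @ dual X" "dual (dual X) = X"
  "dual (w # X) = dual X @ [flip w]" "dual (replicate n w) = replicate n (flip w)"
  by (simp_all add: dual_def rev_map o_def)

text \<open>The generators bend only \<open>[\<triangleleft>, \<triangleright>]\<close>; the other
  orientation is obtained by adding a crossing.\<close>

primrec ev1 :: "wire \<Rightarrow> 'a kd" where "ev1 \<triangleright> = ca" | "ev1 \<triangleleft> = sy [\<triangleright>] [\<triangleleft>] >> ca"
primrec co1 :: "wire \<Rightarrow> 'a kd" where "co1 \<triangleright> = cu" | "co1 \<triangleleft> = cu >> sy [\<triangleleft>] [\<triangleright>]"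

primrec ev :: "obj \<Rightarrow> 'a kd" where
  "ev [] = one []" | "ev (w # X) = (one (dual X) || ev1 w || one X) >> ev X"
primrec co :: "obj \<Rightarrow> 'a kd" where
  "co [] = one []" | "co (w # X) = co X >> (one (dual X) || co1 w || one X)"

lemma ev1_typing [simp]: "dom (ev1 w) = [flip w, w]" "cod (ev1 w) = []"
  by (cases w; simp)+
lemma co1_typing [simp]: "cod (co1 w) = [flip w, w]" "dom (co1 w) = []"
  by (cases w; simp)+
lemma ev_typing [simp]: "dom (ev X :: 'a kd) = dual X @ X \<and> cod (ev X :: 'a kd) = []"
  by (induction X) simp_all
lemma co_typing [simp]: "cod (co X :: 'a kd) = dual X @ X \<and> dom (co X :: 'a kd) = []"
  by (induction X) simp_all

lemma ev_append: "ev (X @ Y) = (one (dual Y) || ev X || one Y) >> ev Y"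
proof (induction X)
  case (Cons w X)
  then show ?case
    by (simp add: sq_assoc pr_split)
qed simp

lemma co_append: "co (X @ Y) = co Y >> (one (dual Y) || co X || one Y)"
  by (induction X) (simp_all add: sq_assoc pr_split)

text \<open>A1 and A2 have a crossing between cup and cap. Sliding one of the bends along the
  symmetry turns them into the zigzag equations of a compact closed category.\<close>

lemma snake1: "(one [w] || co1 w) >> (ev1 (flip w) || one [w]) = one [w]"
proof (cases w)
  case Fwd
  have "one [\<triangleright>] || cu = (cu || i1) >> sy [\<triangleleft>,\<triangleright>] [\<triangleright>]"
    by (rule state_slide[symmetric]) simp_all
  also have "sy [\<triangleleft>,\<triangleright>] [\<triangleright>] = (l1 || s1) >> (sy [\<triangleleft>] [\<triangleright>] || i1)"
    using hexagon'[of "[\<triangleleft>]" "[\<triangleright>]" "[\<triangleright>]"] by simp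
  finally have *: "i1 || cu = (cu || i1) >> ((l1 || s1) >> (sy [\<triangleleft>] [\<triangleright>] || i1))" .
  have "(i1 || cu) >> ((sy [\<triangleright>] [\<triangleleft>] >> ca) || i1) =
     (cu || i1) >> ((l1 || s1) >> ((sy [\<triangleleft>] [\<triangleright>] >> (sy [\<triangleright>] [\<triangleleft>] >> ca)) || i1))"
    by (simp only: *) (simp add: sq_assoc interchange)
  also have "\<dots> = i1"
    using A1 by (simp add: sq_assoc)
  finally show ?thesis using Fwd by simp
next
  case Bwd
  have 1: "one [\<triangleleft>] || cu = (cu || l1) >> sy [\<triangleleft>,\<triangleright>] [\<triangleleft>]"
    by (rule state_slide[symmetric]) simp_all
  have 2: "l1 || ca = sy [\<triangleleft>] [\<triangleleft>,\<triangleright>] >> (ca || l1)"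
    by (rule effect_slide') simp_all
  have 3: "sy [\<triangleleft>,\<triangleright>] [\<triangleleft>] = (l1 || sy [\<triangleright>] [\<triangleleft>]) >> (sy [\<triangleleft>] [\<triangleleft>] || i1)"
    using hexagon'[of "[\<triangleleft>]" "[\<triangleright>]" "[\<triangleleft>]"] by simp
  have 4: "sy [\<triangleleft>] [\<triangleleft>,\<triangleright>] = (sy [\<triangleleft>] [\<triangleleft>] || i1) >> (l1 || sy [\<triangleleft>] [\<triangleright>])"
    using hexagon[of "[\<triangleleft>]" "[\<triangleleft>]" "[\<triangleright>]"] by simp
  have "(l1 || (cu >> sy [\<triangleleft>] [\<triangleright>])) >> (ca || l1) = ((l1 || cu) >> (l1 || sy [\<triangleleft>] [\<triangleright>])) >> (ca || l1)"
    by (simp add: interchange)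
  also have "\<dots> = (cu || l1) >> ((l1 || sy [\<triangleright>] [\<triangleleft>]) >> ((sy [\<triangleleft>] [\<triangleleft>] || i1) >> ((l1 || sy [\<triangleleft>] [\<triangleright>]) >> (ca || l1))))"
    by (simp add: 1 3 sq_assoc)
  also have "\<dots> = l1"
    using A2 by (simp add: 2 4 sq_assoc)
  finally show ?thesis using Bwd by simp
qed

lemma snake2: "(co1 w || one [flip w]) >> (one [flip w] || ev1 (flip w)) = one [flip w]"
proof (cases w)
  case Fwd
  then show ?thesis using A2 by (simp add: sq_assoc interchange)
next
  case Bwd
  have 1: "ca || i1 = sy [\<triangleleft>,\<triangleright>] [\<triangleright>] >> (i1 || ca)"
    by (rule effect_slide) simp_all
  have 3: "sy [\<triangleleft>,\<triangleright>] [\<triangleright>] = (l1 || s1) >> (sy [\<triangleleft>] [\<triangleright>] || i1)"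
    using hexagon'[of "[\<triangleleft>]" "[\<triangleright>]" "[\<triangleright>]"] by simp
  have "(cu || i1) >> ((sy [\<triangleleft>] [\<triangleright>] || i1) >> (i1 || ca)) =
     (cu || i1) >> (((l1 || s1) >> (l1 || s1)) >> ((sy [\<triangleleft>] [\<triangleright>] || i1) >> (i1 || ca)))"
    by (simp add: interchange)
  also have "\<dots> = (cu || i1) >> ((l1 || s1) >> (ca || i1))"
    by (simp add: 1 3 sq_assoc del: sy_sy)
  also have "\<dots> = i1" using A1 by (simp add: sq_assoc)
  finally show ?thesis using Bwd by (simp add: pr_split sq_assoc)
qed

section \<open>Traces and structural isomorphisms\<close>

lemma sy_whisker_cancel:
  "dom h = A @ X @ Y \<Longrightarrow> (one A || sy X Y) >> ((one A || sy Y X) >> h) = h"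
  by (simp add: interchange flip: sq_assoc)

lemma exchange_mid:
  assumes "dom f = A" "cod f = B" "dom g = C" "cod g = D"
  shows "(one U || f || one (V @ C @ W)) >> (one (U @ B @ V) || g || one W) =
      one U || f || one V || g || one W"
    and "(one (U @ A @ V) || g || one W) >> (one U || f || one (V @ D @ W)) =
      one U || f || one V || g || one W"
  using interchange[of "one U || f || one V" "one (U @ B @ V)" "one (C @ W)" "g || one W"]
    interchange[of "one (U @ A @ V)" "one U || f || one V" "g || one W" "one (D @ W)"] assms
  by simp_all

lemma exchange:
  assumes "dom f = A" "cod f = B" "dom g = C" "cod g = D"
  shows "(one U || f || one (V @ C @ W)) >> (one (U @ B @ V) || g || one W) =
      (one (U @ A @ V) || g || one W) >> (one U || f || one (V @ D @ W))"
  by (simp only: exchange_mid[OF assms])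

lemma snake_left: "(one X || co X) >> (ev (dual X) || one X) = (one X :: 'a kd)"
proof (induction X)
  case (Cons w Y)
  have "(one (w # Y) || co (w # Y)) >> (ev (dual (w # Y)) || one (w # Y)) =
     (one (w # Y) || co Y) >> ((one ([w] @ Y @ dual Y) || co1 w || one Y) >>
      (one [w] || ev (dual Y) || one ([] @ [flip w, w] @ Y))) >> (ev1 (flip w) || one (w # Y) :: 'a kd)"
    by (simp add: ev_append sq_assoc pr_split)
  \<comment> \<open>The cup of \<open>w\<close> and the caps of \<open>Y\<close> act on disjoint
    wires. Exchanging them separates the zigzag of \<open>Y\<close> from that of
    \<open>w\<close>.\<close>
  also have "\<dots> = (one (w # Y) || co Y) >> ((one [w] || ev (dual Y) || one Y) >>
      (one [w] || co1 w || one Y)) >> (ev1 (flip w) || one (w # Y))"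
    using exchange[of "ev (dual Y) :: 'a kd" "Y @ dual Y" "[]" "co1 w" "[]" "[flip w, w]" "[w]" "[]" Y]
    by simp
  also have "\<dots> = (one [w] || ((one Y || co Y) >> (ev (dual Y) || one Y))) >>
     (((one [w] || co1 w) >> (ev1 (flip w) || one [w])) || one Y)"
    by (simp add: sq_assoc pr_split)
  finally show ?case by (simp add: Cons snake1)
qed simp

lemma snake_right: "(co X || one (dual X)) >> (one (dual X) || ev (dual X)) = (one (dual X) :: 'a kd)"
proof (induction X)
  case (Cons w Y)
  have "(co (w # Y) || one (dual (w # Y))) >> (one (dual (w # Y)) || ev (dual (w # Y))) =
     (co Y || one (dual Y @ [flip w])) >> ((one (dual Y) || co1 w || one (Y @ dual Y @ [flip w])) >>
      (one (dual Y @ [flip w, w]) || ev (dual Y) || one [flip w])) >>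
        (one (dual Y @ [flip w]) || ev1 (flip w) :: 'a kd)"
    by (simp add: ev_append sq_assoc pr_split)
  also have "\<dots> = (co Y || one (dual Y @ [flip w])) >> ((one (dual Y) || ev (dual Y) || one [flip w]) >>
      (one (dual Y) || co1 w || one [flip w])) >> (one (dual Y @ [flip w]) || ev1 (flip w))"
    using exchange[of "co1 w :: 'a kd" "[]" "[flip w, w]" "ev (dual Y)" "Y @ dual Y" "[]" "dual Y" "[]" "[flip w]"]
    by simp
  also have "\<dots> = (((co Y || one (dual Y)) >> (one (dual Y) || ev (dual Y))) || one [flip w]) >>
     (one (dual Y) || ((co1 w || one [flip w]) >> (one [flip w] || ev1 (flip w))))"
    by (simp add: sq_assoc pr_split)
  finally show ?case by (simp add: Cons snake2)
qed simp

text \<open>The full crossing of \<open>Y\<close> with \<open>A @ B\<close> disappears at the effect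
  by naturality; cancelling its half on \<open>B\<close> leaves the stated exchange of the half on
  one side for the half on the other.\<close>

lemma effect_past:
  assumes "dom f = A @ B" "cod f = []"
  shows "(one A || sy Y B) >> (f || one Y) = (sy A Y || one B) >> (one Y || f)"
proof -
  have "f || one Y = sy (A @ B) Y >> (one Y || f)"
    by (rule effect_slide) (simp_all add: assms)
  then have "(one A || sy Y B) >> (f || one Y) =
     ((one A || sy Y B) >> (one A || sy B Y)) >> ((sy A Y || one B) >> (one Y || f))"
    by (simp add: hexagon' sq_assoc assms del: sy_sy)
  then show ?thesis by (simp add: interchange assms)
qed

lemma ev1_flip: "ev1 (flip w) = sy [w] [flip w] >> ev1 w"
  by (cases w) (simp_all add: sq_assoc[symmetric])

text \<open>The two ways of capping a word with its dual differ by a crossing only, so a bend may be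
  drawn on either side. In the induction \<open>sy_four\<close> separates the pair of
  \<open>w\<close> from the wires of \<open>Y\<close>.\<close>

lemma ev_dual: "ev (dual X) = (sy X (dual X) >> ev X :: 'a kd)"
proof (induction X)
  case (Cons w Y)
  let ?e = "ev1 (flip w) :: 'a kd" and ?f = "flip w" and ?Z = "dual Y"
  have *: "sy [w] ?Z || sy Y [?f] = (sy [w] ?Z || one (Y @ [?f])) >> (one (?Z @ [w]) || sy Y [?f] :: 'a kd)"
    by (simp add: interchange)
  have "sy (w # Y) (dual (w # Y)) >> ev (w # Y) =
     sy ([w] @ Y) (?Z @ [?f]) >> ((one ?Z || (sy [?f] [w] >> ?e) || one Y) >> (ev Y :: 'a kd))"
    using ev1_flip[of "flip w", where 'a = 'a] by simp
  also have "\<dots> = (sy ([w] @ Y) (?Z @ [?f]) >> (one ?Z || sy [?f] [w] || one Y)) >> ((one ?Z || ?e || one Y) >> ev Y)"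
    by (simp add: sq_assoc pr_split)
  also have "\<dots> = ((one [w] || sy Y ?Z || one [?f]) >> (sy [w] ?Z || sy Y [?f])) >> ((one ?Z || ?e || one Y) >> ev Y)"
    by (simp only: sy_four)
  also have "\<dots> = (one [w] || sy Y ?Z || one [?f]) >> ((sy [w] ?Z || one (Y @ [?f])) >>
      ((one ?Z || ((one [w] || sy Y [?f]) >> (?e || one Y))) >> ev Y))"
    by (simp add: * sq_assoc pr_split)
  also have "(one [w] || sy Y [?f]) >> (?e || one Y) = (sy [w] Y || one [?f]) >> (one Y || ?e)"
    by (rule effect_past) simp_all
  also have "(sy [w] ?Z || one (Y @ [?f])) >>
      ((one ?Z || ((sy [w] Y || one [?f]) >> (one Y || ?e))) >> ev Y) =
      (sy [w] (?Z @ Y) || one [?f]) >> ((one (?Z @ Y) || ?e) >> ev Y)"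
    by (simp add: hexagon sq_assoc pr_split)
  also have "\<dots> = (sy [w] (?Z @ Y) || one [?f]) >> ((ev Y || one [w, ?f]) >> ?e)"
    using exchange[of "ev Y :: 'a kd" "?Z @ Y" "[]" ?e "[w, ?f]" "[]" "[]" "[]" "[]"] by simp
  also have "\<dots> = ((one [w] || ev Y) || one [?f]) >> ?e"
    using arg_cong[OF effect_slide'[of "ev Y :: 'a kd" "?Z @ Y" "[w]"], of "\<lambda>f. f || one [?f]"]
    by (simp add: sq_assoc pr_split)
  finally show ?case
    by (simp add: ev_append sq_assoc pr_split Cons)
qed simp

text \<open>The transpose of \<open>h\<close>, with both ends bent around. It is what
  \<open>h\<close> becomes on the returning wires of a feedback loop.\<close>

definition mate :: "'a kd \<Rightarrow> 'a kd" where
  "mate h = (co (dom h) || one (dual (cod h))) >> (one (dual (dom h)) || h || one (dual (cod h))) >>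
     (one (dual (dom h)) || ev (dual (cod h)))"

lemma mate_typing [simp]: "dom (mate h) = dual (cod h)" "cod (mate h) = dual (dom h)"
  by (simp_all add: mate_def)

lemma co_mate:
  fixes h :: "'a kd"
  assumes "dom h = X" "cod h = Y"
  shows "co X >> (one (dual X) || h) = co Y >> (mate h || one Y)"
proof -
  have "co Y >> (mate h || one Y) = ((one [] || co Y) >> (co X || one (dual Y @ Y))) >>
     ((one (dual X) || h || one (dual Y @ Y)) >> (one (dual X) || ev (dual Y) || one Y))"
    by (simp add: mate_def assms sq_assoc pr_split)
  also have "(one [] || co Y) >> (co X || one (dual Y @ Y) :: 'a kd) = co X >> (one (dual X @ X) || co Y)"
    using exchange[of "co X :: 'a kd" "[]" "dual X @ X" "co Y" "[]" "dual Y @ Y" "[]" "[]" "[]"] by simp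
  also have "co X >> (one (dual X @ X) || co Y) >>
     ((one (dual X) || h || one (dual Y @ Y)) >> (one (dual X) || ev (dual Y) || one Y)) =
     co X >> ((one (dual X) || one X || co Y) >> (one (dual X) || h || one (dual Y @ Y))) >>
       (one (dual X) || ev (dual Y) || one Y)"
    by (simp add: assms sq_assoc)
  also have "(one (dual X) || one X || co Y) >> (one (dual X) || h || one (dual Y @ Y)) =
     (one (dual X) || h) >> (one (dual X @ Y) || co Y)"
    using exchange[of h X Y "co Y" "[]" "dual Y @ Y" "dual X" "[]" "[]"] assms by simp
  also have "co X >> ((one (dual X) || h) >> (one (dual X @ Y) || co Y)) >> (one (dual X) || ev (dual Y) || one Y) =
     co X >> ((one (dual X) || h) >> (one (dual X) || ((one Y || co Y) >> (ev (dual Y) || one Y))))"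
    by (simp add: assms sq_assoc pr_split)
  finally show ?thesis
    by (simp add: snake_left assms)
qed

text \<open>\<open>mate\<close> closes \<open>h\<close> with caps to its right, whereas here the
  caps lie to its left. Converting by \<open>ev_dual\<close> introduces crossings, which leave a
  twisted loop on \<open>X\<close> to be straightened.\<close>

lemma ev_mate:
  fixes h :: "'a kd"
  assumes "dom h = X" "cod h = Y"
  shows "(one (dual Y) || h) >> ev Y = (mate h || one X) >> ev X"
proof -
  \<comment> \<open>Yanking for an arbitrary word: the crossing of \<open>X\<close> with itself,
    closed into a loop, is the identity.\<close>
  have *: "(co X || one X) >> ((one (dual X) || sy X X) >> (ev X || one X)) = (one X :: 'a kd)"
  proof -
    have "(one (dual X) || sy X X) >> (ev X || one X) = (sy (dual X) X || one X) >> (one X || (ev X :: 'a kd))"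
      by (rule effect_past) simp_all
    moreover have "co X || one X = (one X || (co X :: 'a kd)) >> sy X (dual X @ X)"
      by (rule state_slide'[symmetric]) simp_all
    moreover have "sy X (dual X @ X) = (sy X (dual X) || one X) >> (one (dual X) || (sy X X :: 'a kd))"
      by (rule hexagon)
    ultimately have "(co X || one X) >> ((one (dual X) || sy X X) >> (ev X || one X)) =
       (one X || co X) >> ((sy X (dual X) || one X) >> ((one (dual X) || (sy X X >> sy X X)) >>
         (ev X || one X :: 'a kd)))"
      by (simp add: sq_assoc pr_split del: sy_sy)
    then show ?thesis
      using snake_left[of X, where 'a = 'a] by (simp add: ev_dual pr_split sq_assoc)
  qed
  let ?p = "(one (dual Y) || h) >> ev Y"
  have "mate h = (co X || one (dual Y)) >> (one (dual X) || (((h || one (dual Y)) >> sy Y (dual Y)) >> ev Y))"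
    by (simp add: mate_def assms ev_dual pr_split sq_assoc)
  also have "(h || one (dual Y)) >> sy Y (dual Y) = sy X (dual Y) >> (one (dual Y) || h)"
    by (rule sy_natural) (simp_all add: assms)
  also have "co X || one (dual Y) = (one (dual Y) || co X) >> sy (dual Y) (dual X @ X)"
    by (rule state_slide'[symmetric]) simp_all
  also have "sy (dual Y) (dual X @ X) = (sy (dual Y) (dual X) || one X) >> (one (dual X) || (sy (dual Y) X :: 'a kd))"
    by (rule hexagon)
  also have "(one (dual Y) || co X) >> ((sy (dual Y) (dual X) || one X) >> (one (dual X) || sy (dual Y) X)) >>
     (one (dual X) || ((sy X (dual Y) >> (one (dual Y) || h)) >> ev Y)) =
     (one (dual Y) || co X) >> ((sy (dual Y) (dual X) || one X) >> (one (dual X) || ?p))"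
    by (simp add: assms pr_split sq_assoc sy_whisker_cancel)
  also have "(sy (dual Y) (dual X) || one X) >> (one (dual X) || ?p) =
    (one (dual Y) || sy (dual X) X) >> (?p || one (dual X))"
    by (rule effect_past[symmetric]) (simp_all add: assms)
  finally have "(mate h || one X) >> ev X = (one (dual Y) || co X || one X) >>
    ((one (dual Y) || sy (dual X) X || one X) >>
     ((?p || one (dual X @ X)) >> ev X))"
    by (simp only:) (simp add: assms pr_split sq_assoc)
  also have "(?p || one (dual X @ X)) >> ev X = (one (dual Y @ X) || ev X) >> ?p"
    using exchange[of ?p "dual Y @ X" "[]" "ev X" "dual X @ X" "[]" "[]" "[]" "[]"] by (simp add: assms)
  also have "(one (dual Y) || co X || one X) >> ((one (dual Y) || sy (dual X) X || one X) >>
     ((one (dual Y @ X) || ev X) >> ?p)) = (one (dual Y) || ((co X || one X) >> ((sy (dual X) X || one X) >>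
       (one X || ev X)))) >> ?p"
    by (simp add: assms pr_split sq_assoc)
  also have "(sy (dual X) X || one X) >> (one X || ev X) = (one (dual X) || sy X X) >> (ev X || (one X :: 'a kd))"
    by (rule effect_past[symmetric]) simp_all
  finally show ?thesis
    by (simp add: * assms)
qed

text \<open>The canonical trace of a compact closed category, with feedback on the leading wires
  \<open>X\<close>.\<close>

definition tr :: "obj \<Rightarrow> obj \<Rightarrow> obj \<Rightarrow> 'a kd \<Rightarrow> 'a kd" where
  "tr X A B F = (co X || one A) >> (one (dual X) || F) >> (ev X || one B)"

lemma tr_typing [simp]:
  assumes "dom F = X @ A" "cod F = X @ B"
  shows "dom (tr X A B F) = A" "cod (tr X A B F) = B"
  by (simp_all add: tr_def assms)

lemma tr_nil [simp]: "dom F = A \<Longrightarrow> cod F = B \<Longrightarrow> tr [] A B F = F"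
  by (simp add: tr_def)

lemma tr_mono: "F \<le> G \<Longrightarrow> tr X A B F \<le> tr X A B G"
  unfolding tr_def by (intro sq_mono pr_mono order_refl)

lemma tr_post:
  assumes "dom F = X @ A" "cod F = X @ B" "dom g = B" "cod g = C"
  shows "tr X A B F >> g = tr X A C (F >> (one X || g))"
proof -
  have "(ev X || one B) >> g = (one (dual X @ X) || g) >> (ev X || one C)"
    using exchange[of "ev X" "dual X @ X" "[]" g B C "[]" "[]" "[]"] assms by simp
  then show ?thesis
    by (simp add: tr_def assms sq_assoc pr_split)
qed

lemma tr_pre:
  assumes "dom F = X @ A" "cod F = X @ B" "dom g = C" "cod g = A"
  shows "g >> tr X A B F = tr X C B ((one X || g) >> F)"
proof -
  have "g >> (co X || one A) = (co X || one C) >> (one (dual X @ X) || g)"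
    using exchange[of "co X" "[]" "dual X @ X" g C A "[]" "[]" "[]"] assms by simp
  then show ?thesis
    by (simp add: tr_def assms pr_split flip: sq_assoc)
qed

lemma tr_par:
  assumes "dom F = X @ A" "cod F = X @ B"
  shows "tr X A B F || one C = tr X (A @ C) (B @ C) (F || one C)"
  by (simp add: tr_def assms pr_split)

text \<open>The block \<open>X\<close> is traced first because its cups and caps are nested inside
  those of \<open>Y\<close>.\<close>

lemma tr_append:
  assumes "dom F = X @ Y @ A" "cod F = X @ Y @ B"
  shows "tr (X @ Y) A B F = tr Y A B (tr X (Y @ A) (Y @ B) F)"
  by (simp add: tr_def co_append ev_append assms pr_split sq_assoc)

text \<open>\<open>h\<close> travels around the loop: \<open>co_mate\<close> turns it into its mate
  on the returning wires, and \<open>ev_mate\<close> turns it back at the other end.\<close>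

lemma tr_slide:
  assumes "dom h = X" "cod h = Y" "dom G = Y @ A" "cod G = X @ B"
  shows "tr X A B ((h || one A) >> G) = tr Y A B (G >> (h || one B))"
proof -
  have "tr X A B ((h || one A) >> G) =
     ((co X >> (one (dual X) || h)) || one A) >> ((one (dual X) || G) >> (ev X || one B))"
    by (simp add: tr_def assms pr_split sq_assoc)
  also have "\<dots> = (co Y || one A) >> ((mate h || one (Y @ A)) >> (one (dual X) || G)) >> (ev X || one B)"
    by (simp add: co_mate assms pr_split sq_assoc)
  also have "(mate h || one (Y @ A)) >> (one (dual X) || G) = (one (dual Y) || G) >> (mate h || one (X @ B))"
    by (simp add: interchange assms)
  also have "(co Y || one A) >> ((one (dual Y) || G) >> (mate h || one (X @ B))) >> (ev X || one B) =
     (co Y || one A) >> ((one (dual Y) || G) >> (((mate h || one X) >> ev X) || one B))"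
    by (simp add: assms pr_split sq_assoc)
  also have "(mate h || one X) >> ev X = (one (dual Y) || h) >> ev Y"
    by (simp add: ev_mate assms)
  finally show ?thesis
    by (simp add: tr_def assms pr_split sq_assoc)
qed

lemma tr_yank: "tr [\<triangleright>] [\<triangleright>] [\<triangleright>] s1 = i1"
  using A1 by (simp add: tr_def)

section \<open>Structural isomorphisms, that is, permutations of wires\<close>

inductive struct :: "'a kd \<Rightarrow> bool" where
  one: "struct (one X)"
| sy: "struct (sy X Y)"
| sq: "struct f \<Longrightarrow> struct g \<Longrightarrow> cod f = dom g \<Longrightarrow> struct (f >> g)"
| pr: "struct f \<Longrightarrow> struct g \<Longrightarrow> struct (f || g)"

lemma struct_inverse:
  "struct f \<Longrightarrow> \<exists>g. struct g \<and> cod g = dom f \<and> dom g = cod f \<and> f >> g = one (dom f) \<and> g >> f = one (cod f)"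
proof (induction rule: struct.induct)
  case (one X)
  then show ?case by (intro exI[of _ "one X"]) (simp add: struct.one)
next
  case (sy X Y)
  then show ?case by (intro exI[of _ "sy Y X"]) (simp add: struct.sy)
next
  case (sq f g)
  then obtain f' g' where f': "struct f'" "cod f' = dom f" "dom f' = cod f" "f >> f' = one (dom f)" "f' >> f =
    one (cod f)"
    and g': "struct g'" "cod g' = dom g" "dom g' = cod g" "g >> g' = one (dom g)" "g' >> g = one (cod g)" by auto
  have "(f >> g) >> (g' >> f') = f >> ((g >> g') >> f')" "(g' >> f') >> (f >> g) = g' >> ((f' >> f) >> g)"
    using sq(3) f'(2,3) g'(2,3) by (simp_all add: sq_assoc)
  then show ?case
    using sq(3) f' g' by (intro exI[of _ "g' >> f'"]) (auto intro: struct.sq)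
next
  case (pr f g)
  then obtain f' g' where f': "struct f'" "cod f' = dom f" "dom f' = cod f" "f >> f' = one (dom f)" "f' >> f =
    one (cod f)"
    and g': "struct g'" "cod g' = dom g" "dom g' = cod g" "g >> g' = one (dom g)" "g' >> g = one (cod g)" by auto
  then show ?case
    by (intro exI[of _ "f' || g'"]) (auto intro: struct.pr simp: interchange)
qed

text \<open>Follows a single wire through a permutation: once \<open>w\<close> is pulled to the
  front, the remaining wires undergo a permutation \<open>g\<close>. Peeling off wires in this way
  takes the place of a coherence theorem.\<close>

lemma struct_factor:
  fixes f :: "'a kd"
  assumes "struct f" "dom f = U @ [w] @ V"
  shows "\<exists>U' V' g. cod f = U' @ [w] @ V' \<and> struct g \<and> dom g = U @ V \<and> cod g = U' @ V' \<and>
     (sy [w] U || one V) >> f = (one [w] || g) >> (sy [w] U' || one V')"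
  using assms
proof (induction arbitrary: U V rule: struct.induct)
  case (one X)
  then show ?case
    by (intro exI[of _ U] exI[of _ V] exI[of _ "one (U @ V)"]) (auto intro: struct.one)
next
  case (sq f g)
  from sq.prems sq.hyps obtain U1 V1 f' where 1: "cod f = U1 @ [w] @ V1" "struct f'" "dom f' = U @ V"
    "cod f' = U1 @ V1" "(sy [w] U || one V) >> f = (one [w] || f') >> (sy [w] U1 || one V1)"
    using sq.IH(1)[of U V] by auto
  from sq.hyps 1(1) obtain U2 V2 g' where 2: "cod g = U2 @ [w] @ V2" "struct g'" "dom g' = U1 @ V1"
    "cod g' = U2 @ V2" "(sy [w] U1 || one V1) >> g = (one [w] || g') >> (sy [w] U2 || one V2)"
    using sq.IH(2)[of U1 V1] by auto
  have d: "dom f = U @ [w] @ V" "dom g = U1 @ [w] @ V1" using sq.prems sq.hyps 1(1) by auto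
  have "(sy [w] U || one V) >> (f >> g) = ((sy [w] U || one V) >> f) >> g"
    using d 1(1) by (simp add: sq_assoc)
  also have "\<dots> = (one [w] || f') >> ((sy [w] U1 || one V1) >> g)"
    using d 1(1,3,4) by (simp only: 1(5)) (simp add: sq_assoc)
  also have "\<dots> = (one [w] || (f' >> g')) >> (sy [w] U2 || one V2)"
    using 1(3,4) 2(3,4) by (simp only: 2(5)) (simp add: sq_assoc pr_split)
  finally show ?case
    using 1 2 sq.hyps by (intro exI[of _ U2] exI[of _ V2] exI[of _ "f' >> g'"]) (auto intro: struct.sq)
next
  case (pr f g)
  from pr.prems have "dom f @ dom g = U @ [w] @ V" by simp
  then consider V0 where "dom f = U @ [w] @ V0" "V = V0 @ dom g"
    | U0 where "dom g = U0 @ [w] @ V" "U = dom f @ U0"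
    by (auto simp: append_eq_append_conv2 append_eq_Cons_conv Cons_eq_append_conv)
  then show ?case
  proof cases
    case 1
    from pr.IH(1)[OF 1(1)] obtain U1 V1 f' where f': "cod f = U1 @ [w] @ V1" "struct f'" "dom f' = U @ V0"
      "cod f' = U1 @ V1" "(sy [w] U || one V0) >> f = (one [w] || f') >> (sy [w] U1 || one V1)" by auto
    have "(sy [w] U || one V) >> (f || g) = ((sy [w] U || one V0) >> f) || g"
      using 1 interchange[of "sy [w] U || one V0" f "one (dom g)" g] by simp
    also have "\<dots> = ((one [w] || f') || g) >> (sy [w] U1 || one (V1 @ cod g))"
      using f'(3,4) interchange[of "one [w] || f'" "sy [w] U1 || one V1" g "one (cod g)"]
      by (simp only: f'(5)) simp
    finally show ?thesis
      using f' 1 pr.hyps by (intro exI[of _ U1] exI[of _ "V1 @ cod g"] exI[of _ "f' || g"]) (auto intro: struct.pr)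
  next
    case 2
    from pr.IH(2)[OF 2(1)] obtain U1 V1 g' where g': "cod g = U1 @ [w] @ V1" "struct g'" "dom g' = U0 @ V"
      "cod g' = U1 @ V1" "(sy [w] U0 || one V) >> g = (one [w] || g') >> (sy [w] U1 || one V1)" by auto
    have "(sy [w] U || one V) >> (f || g) = (sy [w] (dom f) || one (U0 @ V)) >> (f || ((sy [w] U0 || one V) >> g))"
      using 2 interchange[of "one (dom f)" f "sy [w] U0 || one V" g]
      by (simp add: hexagon pr_split sq_assoc)
    also have "\<dots> = (sy [w] (dom f) || one (U0 @ V)) >> (((f || one [w]) || g') >> (one (cod f) || sy [w] U1 || one V1))"
      using g'(3,4) interchange[of f "one (cod f)" "one [w] || g'" "sy [w] U1 || one V1"]
      by (simp only: g'(5)) simp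
    also have "\<dots> = ((sy [w] (dom f) >> (f || one [w])) || g') >> (one (cod f) || sy [w] U1 || one V1)"
      using g'(3,4) interchange[of "sy [w] (dom f)" "f || one [w]" "one (U0 @ V)" g'] by (simp flip: sq_assoc)
    also have "sy [w] (dom f) >> (f || one [w]) = (one [w] || f) >> sy [w] (cod f)"
      by (rule sy_natural[symmetric]) simp_all
    also have "(((one [w] || f) >> sy [w] (cod f)) || g') >> (one (cod f) || sy [w] U1 || one V1) =
        (one [w] || f || g') >> (sy [w] (cod f @ U1) || one V1)"
    proof -
      have "((one [w] || f) >> sy [w] (cod f)) || g' = (one [w] || f || g') >> (sy [w] (cod f) || one (U1 @ V1))"
        using g'(3,4) interchange[of "one [w] || f" "sy [w] (cod f)" g' "one (U1 @ V1)"] by simp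
      then show ?thesis
        using g'(3,4) by (simp only:) (simp add: hexagon pr_split sq_assoc)
    qed
    finally show ?thesis
      using g' 2 pr.hyps by (intro exI[of _ "cod f @ U1"] exI[of _ V1] exI[of _ "f || g'"]) (auto intro: struct.pr)
  qed
next
  case (sy X Y)
  then have "X @ Y = U @ [w] @ V" by simp
  then consider V0 where "X = U @ [w] @ V0" "V = V0 @ Y"
    | U0 where "Y = U0 @ [w] @ V" "U = X @ U0"
    by (auto simp: append_eq_append_conv2 append_eq_Cons_conv Cons_eq_append_conv)
  then show ?case
  proof cases
    case 1
    have "((sy [w] U || one V0) || one Y) >> sy (U @ [w] @ V0) Y =
      sy ([w] @ U @ V0) Y >> (one Y || sy [w] U || (one V0 :: 'a kd))"
      by (rule sy_natural) simp_all
    also have "\<dots> = (one [w] || sy (U @ V0) Y) >> (sy [w] (Y @ U) || one V0)"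
      by (simp only: hexagon'[of "[w]"]) (simp add: hexagon[of _ Y U] pr_split sq_assoc)
    finally show ?thesis
      using 1 by (intro exI[of _ "Y @ U"] exI[of _ V0] exI[of _ "sy (U @ V0) Y"]) (auto intro: struct.sy)
  next
    case 2
    have "(one X || (sy [w] U0 || one V)) >> sy X (U0 @ [w] @ V) =
      sy X ([w] @ U0 @ V) >> ((sy [w] U0 || one V) || (one X :: 'a kd))"
      by (rule sy_natural) simp_all
    then have *: "(sy [w] U || one V) >> sy X (U0 @ [w] @ V) =
      (sy [w] X || one (U0 @ V)) >> (sy X ([w] @ U0 @ V) >> (sy [w] U0 || (one (V @ X) :: 'a kd)))"
      using 2 by (simp add: hexagon[of _ X U0] pr_split sq_assoc)
    also have "\<dots> = ((sy [w] X >> sy X [w]) || one (U0 @ V)) >> ((one [w] || sy X (U0 @ V)) >>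
      (sy [w] U0 || one (V @ X)))"
      by (simp only: hexagon[of X "[w]"]) (simp add: pr_split sq_assoc del: sy_sy)
    finally show ?thesis
      using 2 by (intro exI[of _ U0] exI[of _ "V @ X"] exI[of _ "sy X (U0 @ V)"]) (auto intro: struct.sy)
  qed
qed

abbreviation "R n \<equiv> replicate n \<triangleright>"
abbreviation "L n \<equiv> replicate n \<triangleleft>"

lemma LR_split:
  assumes "L n @ R p = U @ [\<triangleleft>] @ V"
  shows "\<exists>i j. n = Suc (i + j) \<and> U = L i \<and> V = L j @ R p"
proof -
  have "length U < n"
  proof (rule ccontr)
    assume "\<not> length U < n"
    then have "(L n @ R p) ! length U = \<triangleright>"
      using arg_cong[OF assms, of length] by (simp add: nth_append)
    then show False using assms by simp
  qed
  then obtain j where "n = Suc (length U + j)" using less_iff_Suc_add by auto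
  then have n: "L n = L (length U) @ [\<triangleleft>] @ L j"
    by (simp add: replicate_add replicate_app_Cons_same)
  then have "L (length U) @ [\<triangleleft>] @ L j @ R p = U @ [\<triangleleft>] @ V" using assms by simp
  then show ?thesis
    using \<open>n = _\<close> by (intro exI[of _ "length U"] exI[of _ j]) (auto dest: append_eq_append_conv[THEN iffD1, rotated])
qed

text \<open>A permutation preserves the orientation of each wire. Peeling off the backward wires one
  by one, each lands inside the block \<open>L n\<close>, so the permutation never mixes the two
  blocks.\<close>

lemma struct_LR:
  fixes f :: "'a kd"
  assumes "struct f" "dom f = L n @ R p" "cod f = L n @ R p"
  shows "\<exists>g h. struct g \<and> struct h \<and> dom g = L n \<and> cod g = L n \<and> dom h = R p \<and> cod h = R p \<and> f = g || h"
  using assms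
proof (induction n arbitrary: f)
  case 0
  then show ?case
    by (intro exI[of _ "one []"] exI[of _ f]) (auto intro: struct.one)
next
  case (Suc n)
  from struct_factor[OF Suc.prems(1), of "[]" "\<triangleleft>" "L n @ R p"] Suc.prems
  obtain U V g where g: "L (Suc n) @ R p = U @ [\<triangleleft>] @ V" "struct g" "dom g = L n @ R p" "cod g = U @ V"
    "f = (one [\<triangleleft>] || g) >> (sy [\<triangleleft>] U || one V)" by auto
  from LR_split[OF g(1)] obtain i j where ij: "n = i + j" "U = L i" "V = L j @ R p" by auto
  from Suc.IH[OF g(2,3)] g(4) obtain a b where ab: "struct a" "struct b" "dom a = L n" "cod a = L n"
    "dom b = R p" "cod b = R p" "g = a || b" by (auto simp: ij replicate_add)
  have "f = (one [\<triangleleft>] || a || b) >> ((sy [\<triangleleft>] (L i) || one (L j)) || one (R p))"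
    using g(5) ab(7) ij by simp
  also have "\<dots> = ((one [\<triangleleft>] || a) >> (sy [\<triangleleft>] (L i) || one (L j))) || b"
    using ab ij interchange[of "one [\<triangleleft>] || a" "sy [\<triangleleft>] (L i) || one (L j)" b "one (R p)"] by (simp add: replicate_add)
  finally show ?case
    using ab ij
    by (intro exI[of _ "(one [\<triangleleft>] || a) >> (sy [\<triangleleft>] (L i) || one (L j))"] exI[of _ b])
      (auto intro!: struct.intros simp: replicate_add replicate_app_Cons_same)
qed

text \<open>Moves a permutation through caps to the opposite legs. The induction exhibits the
  transpose as \<open>struct\<close> again, so that on forward wires it can later be read as a
  boolean matrix.\<close>

lemma struct_transpose:
  fixes f :: "'a kd"
  assumes "struct f"
  shows "\<exists>g. struct g \<and> dom g = dual (cod f) \<and> cod g = dual (dom f) \<and>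
    (f || one (dual (cod f))) >> ev (dual (cod f)) = (one (dom f) || g) >> ev (dual (dom f))"
  using assms
proof induction
  case (one X)
  then show ?case by (intro exI[of _ "one (dual X)"]) (auto intro: struct.one)
next
  case (sq f g)
  then obtain f' g' where f': "struct f'" "dom f' = dual (cod f)" "cod f' = dual (dom f)"
    "(f || one (dual (cod f))) >> ev (dual (cod f)) = (one (dom f) || f') >> ev (dual (dom f))"
    and g': "struct g'" "dom g' = dual (cod g)" "cod g' = dual (dom g)"
    "(g || one (dual (cod g))) >> ev (dual (cod g)) = (one (dom g) || g') >> ev (dual (dom g))" by blast
  have "((f >> g) || one (dual (cod g))) >> ev (dual (cod g)) =
     (f || one (dual (cod g))) >> ((g || one (dual (cod g))) >> ev (dual (cod g)))"
    using sq.hyps by (simp add: pr_split sq_assoc)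
  also have "\<dots> = ((f || one (dual (cod g))) >> (one (dom g) || g')) >> ev (dual (dom g))"
    using sq.hyps g'(2,3) by (simp add: g'(4) sq_assoc)
  also have "\<dots> = ((one (dom f) || g') >> (f || one (dual (cod f)))) >> ev (dual (cod f))"
    using sq.hyps g'(2,3) by (simp add: interchange)
  also have "\<dots> = (one (dom f) || (g' >> f')) >> ev (dual (dom f))"
    using sq.hyps g'(2,3) f' by (simp add: sq_assoc pr_split)
  finally show ?case
    using sq.hyps f' g' by (intro exI[of _ "g' >> f'"]) (auto intro: struct.sq)
next
  case (pr f g)
  then obtain f' g' where f': "struct f'" "dom f' = dual (cod f)" "cod f' = dual (dom f)"
    "(f || one (dual (cod f))) >> ev (dual (cod f)) = (one (dom f) || f') >> ev (dual (dom f))"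
    and g': "struct g'" "dom g' = dual (cod g)" "cod g' = dual (dom g)"
    "(g || one (dual (cod g))) >> ev (dual (cod g)) = (one (dom g) || g') >> ev (dual (dom g))" by blast
  let ?A = "dom f" and ?B = "cod f" and ?C = "dom g" and ?D = "cod g"
  have "((f || g) || one (dual (?B @ ?D))) >> ev (dual (?B @ ?D)) =
     (f || ((g || one (dual ?D)) >> ev (dual ?D)) || one (dual ?B)) >> ev (dual ?B)"
    using interchange[of f "one ?B" "g || one (dual ?D @ dual ?B)" "ev (dual ?D) || one (dual ?B)"]
    by (simp add: ev_append pr_split flip: sq_assoc)
  also have "\<dots> = (f || ((one ?C || g') >> ev (dual ?C)) || one (dual ?B)) >> ev (dual ?B)"
    by (simp only: g'(4))
  also have "f || ((one ?C || g') >> ev (dual ?C)) || one (dual ?B) =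
     (one ?A || ((one ?C || g') >> ev (dual ?C)) || one (dual ?B)) >> (f || one (dual ?B))"
    using g'(2,3) interchange[of "one ?A" f "((one ?C || g') >> ev (dual ?C)) || one (dual ?B)" "one (dual ?B)"] by simp
  also have "\<dots> >> ev (dual ?B) = (one ?A || ((one ?C || g') >> ev (dual ?C)) || one (dual ?B)) >>
    ((one ?A || f') >> ev (dual ?A))"
    using g'(2,3) by (simp add: sq_assoc f'(4))
  also have "\<dots> = (one (?A @ ?C) || g' || f') >> ev (dual (?A @ ?C))"
  proof -
    have "(one ?A || ev (dual ?C) || one (dual ?B)) >> (one ?A || f') =
       (one (?A @ ?C @ dual ?C) || f') >> (one ?A || ev (dual ?C) || one (dual ?A))"
      using f'(2,3) exchange[of "ev (dual ?C) :: 'a kd" "?C @ dual ?C" "[]" f' "dual ?B" "dual ?A" ?A "[]" "[]"] by simp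
    moreover have "(one (?A @ ?C) || g' || one (dual ?B)) >> (one (?A @ ?C @ dual ?C) || f') =
      one (?A @ ?C) || g' || f'"
      using f'(2,3) g'(2,3) interchange[of "one (?A @ ?C) || g'" "one (?A @ ?C @ dual ?C)" "one (dual ?B)" f'] by simp
    ultimately show ?thesis
      using f'(2,3) g'(2,3) by (simp add: ev_append pr_split sq_assoc) (simp flip: sq_assoc)
  qed
  finally show ?case
    using f' g' by (intro exI[of _ "g' || f'"]) (auto intro: struct.pr)
next
  case (sy X Y)
  have "(sy X Y || one (dual X @ dual Y)) >> ev (dual X @ dual Y) =
    (((sy X Y || one (dual X)) >> (one Y || ev (dual X))) || one (dual Y)) >> (ev (dual Y) :: 'a kd)"
    by (simp add: ev_append pr_split sq_assoc)
  also have "(sy X Y || one (dual X)) >> (one Y || ev (dual X)) =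
    (one X || sy Y (dual X)) >> (ev (dual X) || (one Y :: 'a kd))"
    by (rule effect_past[symmetric]) simp_all
  also have "(((one X || sy Y (dual X)) >> (ev (dual X) || one Y)) || one (dual Y)) >> ev (dual Y) =
    (one X || sy Y (dual X) || one (dual Y)) >> ((ev (dual X) || one (Y @ dual Y)) >> (ev (dual Y) :: 'a kd))"
    by (simp add: pr_split sq_assoc)
  also have "(ev (dual X) || one (Y @ dual Y)) >> (ev (dual Y) :: 'a kd) =
    (one (X @ dual X) || ev (dual Y)) >> ev (dual X)"
    using exchange[of "ev (dual X) :: 'a kd" "X @ dual X" "[]" "ev (dual Y)" "Y @ dual Y" "[]" "[]" "[]" "[]"] by simp
  also have "(one X || sy Y (dual X) || one (dual Y)) >> ((one (X @ dual X) || ev (dual Y)) >> ev (dual X)) =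
    (one X || ((sy Y (dual X) || one (dual Y)) >> (one (dual X) || ev (dual Y)))) >> (ev (dual X) :: 'a kd)"
    by (simp add: pr_split sq_assoc)
  also have "(sy Y (dual X) || one (dual Y)) >> (one (dual X) || ev (dual Y)) =
     (one Y || sy (dual X) (dual Y)) >> (ev (dual Y) || (one (dual X) :: 'a kd))"
    by (rule effect_past[symmetric]) simp_all
  finally show ?case
    by (intro exI[of _ "sy (dual X) (dual Y)"]) (simp add: ev_append struct.sy pr_split sq_assoc)
qed

section \<open>Maps that can be copied and discarded\<close>

primrec disc :: "nat \<Rightarrow> 'a kd" where "disc 0 = one []" | "disc (Suc n) = kk || disc n"
text \<open>The crossing regroups the outputs into two complete copies of the bundle.\<close>

primrec copy :: "nat \<Rightarrow> 'a kd" where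
  "copy 0 = one []" | "copy (Suc n) = (cc || copy n) >> (i1 || sy [\<triangleright>] (R n) || one (R n))"

lemma disc_typing [simp]: "dom (disc n :: 'a kd) = R n \<and> cod (disc n :: 'a kd) = []"
  by (induction n) simp_all
lemma copy_typing [simp]: "dom (copy n :: 'a kd) = R n \<and> cod (copy n :: 'a kd) = R n @ R n"
  by (induction n) (simp_all add: replicate_app_Cons_same)

lemma disc_add: "disc (m + n) = disc m || disc n"
  by (induction m) simp_all

lemma copy_add: "copy (m + n) = (copy m || copy n) >> (one (R m) || sy (R m) (R n) || one (R n) :: 'a kd)"
proof (induction m)
  case (Suc m)
  let ?M = "R m" and ?N = "R n" and ?o = "[\<triangleright>]"
  have "copy (Suc m + n) = (cc || ((copy m || copy n) >> (one ?M || sy ?M ?N || one ?N))) >>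
     ((one ?o || sy ?o ?M || one (?N @ ?M @ ?N)) >> (one (?o @ ?M) || sy ?o ?N || (one (?M @ ?N) :: 'a kd)))"
    by (simp add: Suc replicate_add hexagon[of _ ?M ?N] pr_split sq_assoc)
  also have "cc || ((copy m || copy n) >> (one ?M || sy ?M ?N || one ?N)) =
     (cc || copy m || copy n) >> (one (?o @ ?o @ ?M) || sy ?M ?N || (one ?N :: 'a kd))"
    using interchange[of cc "one (?o @ ?o)" "copy m || copy n :: 'a kd" "one ?M || sy ?M ?N || one ?N"] by simp
  also have "(cc || copy m || copy n) >> (one (?o @ ?o @ ?M) || sy ?M ?N || one ?N) >>
     ((one ?o || sy ?o ?M || one (?N @ ?M @ ?N)) >> (one (?o @ ?M) || sy ?o ?N || one (?M @ ?N))) =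
     (cc || copy m || copy n) >> (((one (?o @ ?o @ ?M) || sy ?M ?N || one ?N) >>
     (one ?o || sy ?o ?M || one (?N @ ?M @ ?N))) >> (one (?o @ ?M) || sy ?o ?N || (one (?M @ ?N) :: 'a kd)))"
    by (simp add: sq_assoc)
  also have "(one (?o @ ?o @ ?M) || sy ?M ?N || one ?N) >> (one ?o || sy ?o ?M || one (?N @ ?M @ ?N)) =
     (one ?o || sy ?o ?M || one (?M @ ?N @ ?N)) >> (one (?o @ ?M @ ?o) || sy ?M ?N || (one ?N :: 'a kd))"
    using exchange[of "sy ?o ?M :: 'a kd" "?o @ ?M" "?M @ ?o" "sy ?M ?N" "?M @ ?N" "?N @ ?M" ?o "[]" ?N] by simp
  also have "(cc || copy m || copy n) >> (((one ?o || sy ?o ?M || one (?M @ ?N @ ?N)) >>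
      (one (?o @ ?M @ ?o) || sy ?M ?N || one ?N)) >> (one (?o @ ?M) || sy ?o ?N || one (?M @ ?N))) =
     ((cc || copy m) || copy n) >> (((one ?o || sy ?o ?M || one ?M) || one (?N @ ?N)) >>
     ((one (?o @ ?M @ ?o) || sy ?M ?N || one ?N) >> (one (?o @ ?M) || sy ?o ?N || (one (?M @ ?N) :: 'a kd))))"
    by (simp add: sq_assoc)
  also have "\<dots> = (copy (Suc m) || copy n) >> (one (R (Suc m)) || sy (R (Suc m)) ?N || one ?N)"
    using interchange[of "cc || copy m :: 'a kd" "one ?o || sy ?o ?M || one ?M" "copy n" "one (?N @ ?N)"]
      hexagon'[of ?o ?M ?N, where 'a = 'a]
    by (simp add: pr_split sq_assoc flip: sq_assoc[of "cc || copy m || copy n"])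
  finally show ?case .
qed simp

lemma copy_disc_right: "copy n >> (one (R n) || disc n) = (one (R n) :: 'a kd)"
proof (induction n)
  case (Suc n)
  have "copy (Suc n) >> (one (R (Suc n)) || disc (Suc n)) =
    (cc || copy n) >> (i1 || (sy [\<triangleright>] (R n) >> (one (R n) || kk)) || (disc n :: 'a kd))"
    using interchange[of "sy [\<triangleright>] (R n)" "one (R n) || kk :: 'a kd" "one (R n)" "disc n"]
      interchange[of i1 i1 "sy [\<triangleright>] (R n) || one (R n)" "(one (R n) || kk) || disc n :: 'a kd"]
    by (simp add: sq_assoc replicate_app_Cons_same)
  also have "sy [\<triangleright>] (R n) >> (one (R n) || kk) = kk || (one (R n) :: 'a kd)"
    by (rule effect_slide[symmetric]) simp_all
  also have "(cc || copy n) >> (i1 || (kk || one (R n)) || disc n) =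
     (cc >> (i1 || kk)) || (copy n >> (one (R n) || (disc n :: 'a kd)))"
    using interchange[of "cc :: 'a kd" "i1 || kk" "copy n" "one (R n) || disc n"] by simp
  finally show ?case by (simp add: Suc B2)
qed simp

lemma B2': "cc >> (kk || i1) = (i1 :: 'a kd)"
proof -
  have "cc >> (kk || i1) = (cc >> s1) >> (kk || i1 :: 'a kd)" by (simp add: B3)
  also have "\<dots> = cc >> (i1 || kk)"
    using effect_slide'[of "kk :: 'a kd" "[\<triangleright>]" "[\<triangleright>]"] by (simp add: sq_assoc)
  finally show ?thesis by (simp add: B2)
qed

lemma copy_disc_left: "copy n >> (disc n || one (R n)) = (one (R n) :: 'a kd)"
proof (induction n)
  case (Suc n)
  have "copy (Suc n) >> (disc (Suc n) || one (R (Suc n))) =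
    (cc || copy n) >> ((kk || (sy [\<triangleright>] (R n) >> (disc n || i1)) || (one (R n) :: 'a kd)))"
    using interchange[of i1 "kk :: 'a kd" "sy [\<triangleright>] (R n) || one (R n)" "disc n || one (R (Suc n))"]
    interchange[of "sy [\<triangleright>] (R n)" "disc n || i1 :: 'a kd" "one (R n)" "one (R n)"]
    by (simp add: sq_assoc replicate_app_Cons_same)
  also have "sy [\<triangleright>] (R n) >> (disc n || i1) = i1 || (disc n :: 'a kd)"
    by (rule effect_slide'[symmetric]) simp_all
  also have "(cc || copy n) >> (kk || (i1 || disc n) || one (R n)) =
     (cc >> (kk || i1)) || (copy n >> (disc n || (one (R n) :: 'a kd)))"
    using interchange[of "cc :: 'a kd" "kk || i1" "copy n" "disc n || one (R n)"] by simp
  finally show ?case by (simp add: Suc B2')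
qed simp

text \<open>The comonoid homomorphisms for copy and discard. They are determined by their components
  (\<open>pairing\<close>), so they can be compared componentwise (\<open>cmap_leI\<close>).\<close>

definition cmap :: "nat \<Rightarrow> nat \<Rightarrow> 'a kd \<Rightarrow> bool" where
  "cmap p q f \<longleftrightarrow> dom f = R p \<and> cod f = R q \<and> f >> copy q = copy p >> (f || f) \<and> f >> disc q = disc p"

lemma cmapD: "cmap p q f \<Longrightarrow> dom f = R p" "cmap p q f \<Longrightarrow> cod f = R q"
  "cmap p q f \<Longrightarrow> f >> disc q = disc p"
  by (simp_all add: cmap_def)
lemma cmap_copy: "cmap p q f \<Longrightarrow> f >> copy q = copy p >> (f || f)"
  by (simp add: cmap_def)

lemma cmap_one: "cmap n n (one (R n))"
  by (simp add: cmap_def)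

lemma cmap_sq:
  assumes "cmap p q f" "cmap q r g"
  shows "cmap p r (f >> g)"
proof -
  note [simp] = cmapD[OF assms(1)] cmapD[OF assms(2)]
  have "(f >> g) >> copy r = (f >> copy q) >> (g || g)"
    by (simp add: sq_assoc cmap_copy[OF assms(2)])
  also have "\<dots> = copy p >> ((f >> g) || (f >> g))"
    by (simp only: cmap_copy[OF assms(1)]) (simp add: sq_assoc interchange)
  finally show ?thesis by (simp add: cmap_def sq_assoc)
qed

lemma cmap_pr:
  fixes f :: "'a kd"
  assumes "cmap p q f" "cmap p' q' g"
  shows "cmap (p + p') (q + q') (f || g)"
proof -
  note [simp] = cmapD[OF assms(1)] cmapD[OF assms(2)]
  have "(f || g) >> copy (q + q') = ((f >> copy q) || (g >> copy q')) >> (one (R q) || sy (R q) (R q') || one (R q'))"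
    by (simp add: copy_add interchange_seq)
  also have "\<dots> = (copy p || copy p') >> ((f || (f || g) || g) >> (one (R q) || sy (R q) (R q') || one (R q')))"
  proof -
    have "(copy p >> (f || f)) || (copy p' >> (g || g)) = (copy p || copy p') >> (f || (f || g) || g)"
      using interchange[of "copy p" "f || f" "copy p'" "g || g"] by simp
    then show ?thesis
      by (simp only: cmap_copy[OF assms(1)] cmap_copy[OF assms(2)]) (simp add: sq_assoc)
  qed
  also have "(f || (f || g) || g) >> (one (R q) || sy (R q) (R q') || one (R q')) =
      f || ((f || g) >> sy (R q) (R q')) || g"
    using interchange[of "f || g" "sy (R q) (R q')" g "one (R q')"]
      interchange[of f "one (R q)" "f || g || g" "sy (R q) (R q') || one (R q')"] by simp
  also have "(f || g) >> sy (R q) (R q') = sy (R p) (R p') >> (g || f)"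
    by (intro sy_natural) simp_all
  also have "f || (sy (R p) (R p') >> (g || f)) || g =
    (one (R p) || sy (R p) (R p') || one (R p')) >> (f || g || f || g)"
    using interchange[of "sy (R p) (R p')" "g || f" "one (R p')" g]
      interchange[of "one (R p)" f "sy (R p) (R p') || one (R p')" "g || f || g"] by simp
  finally have "(f || g) >> copy (q + q') = copy (p + p') >> ((f || g) || (f || g))"
    by (simp add: copy_add sq_assoc replicate_add)
  moreover have "(f || g) >> disc (q + q') = disc (p + p')"
    by (simp add: disc_add interchange)
  ultimately show ?thesis
    by (simp add: cmap_def replicate_add)
qed

lemma cmap_s1: "cmap 2 2 s1"
proof -
  have "s1 >> ((cc || cc) >> ss) = ((cc || cc) >> sy ([\<triangleright>] @ [\<triangleright>]) ([\<triangleright>] @ [\<triangleright>])) >> (ss :: 'a kd)"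
    using sy_natural[of "cc :: 'a kd" "[\<triangleright>]" cc "[\<triangleright>]" "[\<triangleright>,\<triangleright>]" "[\<triangleright>,\<triangleright>]"] by (simp flip: sq_assoc)
  also have "\<dots> = (cc || cc) >> (sy ([\<triangleright>] @ [\<triangleright>]) ([\<triangleright>] @ [\<triangleright>]) >> ss)"
    by (simp add: sq_assoc)
  also have "\<dots> = ((cc || cc) >> ss) >> (s1 || s1)"
    by (simp only: sy_four) (simp add: sq_assoc)
  finally have "s1 >> ((cc || cc) >> ss) = ((cc || cc) >> ss) >> (s1 || s1 :: 'a kd)" .
  moreover have "s1 >> (kk || kk) = kk || (kk :: 'a kd)"
    using sy_natural[of "kk :: 'a kd" "[\<triangleright>]" kk "[\<triangleright>]" "[]" "[]"] by simp
  ultimately show ?thesis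
    by (simp add: cmap_def numeral_2_eq_2)
qed

lemma cmap_sy: "cmap (p + q) (p + q) (sy (R p) (R q) :: 'a kd)"
proof -
  have 1: "cmap (Suc p) (Suc p) (sy [\<triangleright>] (R p) :: 'a kd)" for p
  proof (induction p)
    case 0
    then show ?case using cmap_one[of 1] by simp
  next
    case (Suc p)
    have "sy [\<triangleright>] (R (Suc p)) = (s1 || one (R p)) >> (i1 || sy [\<triangleright>] (R p) :: 'a kd)"
      using hexagon[of "[\<triangleright>]" "[\<triangleright>]" "R p"] by simp
    moreover have "cmap (Suc (Suc p)) (Suc (Suc p)) (s1 || one (R p) :: 'a kd)"
      using cmap_pr[OF cmap_s1 cmap_one[of p]] by simp
    moreover have "cmap (Suc (Suc p)) (Suc (Suc p)) (i1 || sy [\<triangleright>] (R p) :: 'a kd)"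
      using cmap_pr[OF cmap_one[of 1] Suc] by simp
    ultimately show ?case
      by (simp only: cmap_sq)
  qed
  show ?thesis
  proof (induction p)
    case 0
    then show ?case using cmap_one[of q] by simp
  next
    case (Suc p)
    have "sy (R (Suc p)) (R q) = (i1 || sy (R p) (R q)) >> (sy [\<triangleright>] (R q) || one (R p) :: 'a kd)"
      using hexagon'[of "[\<triangleright>]" "R p" "R q"] by simp
    moreover have "cmap (Suc p + q) (Suc p + q) (i1 || sy (R p) (R q) :: 'a kd)"
      using cmap_pr[OF cmap_one[of 1] Suc] by simp
    moreover have "cmap (Suc p + q) (Suc p + q) (sy [\<triangleright>] (R q) || one (R p) :: 'a kd)"
      using cmap_pr[OF 1[of q] cmap_one[of p]] by (simp add: add.commute)
    ultimately show ?case
      by (simp only: cmap_sq)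
  qed
qed

text \<open>By coassociativity the two middle ones of four copies can be taken as the outputs of a
  single \<open>cc\<close>, which absorbs their crossing by B3.\<close>

lemma cc_ss: "(cc >> (cc || cc)) >> ss = cc >> (cc || cc)"
proof -
  have *: "cc >> (cc || cc) = cc >> (i1 || (cc >> (cc || i1)))"
  proof -
    have "cc >> (cc || cc) = (cc >> (cc || i1)) >> (i1 || i1 || cc)"
      by (simp add: sq_assoc interchange)
    also have "\<dots> = cc >> (i1 || (cc >> (i1 || cc)))"
      unfolding B1 by (simp add: sq_assoc pr_split)
    finally show ?thesis by (simp only: B1)
  qed
  have "(cc >> (i1 || (cc >> (cc || i1)))) >> ss = cc >> (i1 || (cc >> ((cc >> s1) || i1)))"
    by (simp add: sq_assoc pr_split)
  then show ?thesis by (simp only: * B3)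
qed

lemma cc_kk: "cc >> (kk || kk) = kk"
proof -
  have "cc >> (kk || kk) = (cc >> (i1 || kk)) >> (kk :: 'a kd)"
    using interchange[of i1 "kk :: 'a kd" kk "one []"] by (simp add: sq_assoc)
  then show ?thesis by (simp add: B2)
qed

lemma cmap_cc: "cmap 1 2 cc"
  using cc_ss cc_kk by (simp add: cmap_def numeral_2_eq_2 sq_assoc)

lemma cmap_kk: "cmap 1 0 kk"
  by (simp add: cmap_def cc_kk)

lemma cmap_mm: "cmap 2 1 mm"
  by (simp add: cmap_def numeral_2_eq_2 B7 B9)
lemma cmap_nn: "cmap 0 1 nn"
  by (simp add: cmap_def B8 B11)
lemma cmap_MM: "cmap 2 1 MM"
  by (simp add: cmap_def numeral_2_eq_2 D2 D3)
text \<open>D1 lets \<open>NN\<close> be copied, but for discarding F8 gives only one inequality.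
  The other follows from \<open>NN\<close> \<le> \<open>nn\<close>, which is obtained by inserting
  the trivial scalar \<open>nn >> kk\<close> and using F2 and F6.\<close>

lemma cmap_NN: "cmap 0 1 NN"
proof -
  have "NN >> (i1 :: 'a kd) \<le> NN >> (kk >> nn)" by (intro sq_mono order_refl F2)
  also have "\<dots> = (nn >> kk) >> (NN >> (kk >> nn))" by (simp add: B11)
  also have "\<dots> = nn >> ((kk >> NN) >> (kk >> nn))" by (simp add: sq_assoc)
  also have "\<dots> \<le> nn >> (i1 >> (kk >> nn))" by (intro sq_mono order_refl F6)
  also have "\<dots> = (nn >> kk) >> nn" by (simp add: sq_assoc)
  finally have "NN \<le> (nn :: 'a kd)" by (simp add: B11)
  then have "NN >> kk \<le> nn >> (kk :: 'a kd)" by (intro sq_mono order_refl)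
  then have "NN >> kk \<le> (one [] :: 'a kd)" by (simp only: B11)
  then have "NN >> kk = (one [] :: 'a kd)" by (rule antisym) (rule F8)
  then show ?thesis by (simp add: cmap_def D1)
qed
lemma cmap_ltr: "cmap 1 1 (ltr a)"
  by (simp add: cmap_def E6 E7)

text \<open>Among comonoid homomorphisms the monoidal product is a cartesian product: push copying
  through \<open>f\<close> and apply the counit laws to the two copies of its output.\<close>

lemma pairing:
  assumes "cmap p (a + b) f"
  shows "f = copy p >> ((f >> (one (R a) || disc b)) || (f >> (disc a || one (R b))))"
proof -
  note [simp] = cmapD[OF assms]
  let ?m = "(one (R a) || disc b) || (disc a || one (R b)) :: 'a kd"
  have "copy (a + b) >> ?m = (copy a || copy b) >> ((one (R a) || sy (R a) (R b) || one (R b)) >> ?m)"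
    by (simp add: copy_add sq_assoc)
  also have "(one (R a) || sy (R a) (R b) || one (R b)) >> ?m =
      one (R a) || (sy (R a) (R b) >> (disc b || disc a)) || one (R b)"
    using interchange[of "one (R a)" "one (R a)" "sy (R a) (R b) || one (R b)"
      "(disc b || disc a) || one (R b) :: 'a kd"]
      interchange[of "sy (R a) (R b)" "disc b || disc a :: 'a kd" "one (R b)" "one (R b)"] by simp
  also have "sy (R a) (R b) >> (disc b || disc a) = disc a || (disc b :: 'a kd)"
    using sy_natural[of "disc a :: 'a kd" "R a" "disc b" "R b" "[]" "[]"] by simp
  also have "(copy a || copy b) >> (one (R a) || (disc a || disc b) || one (R b)) = (one (R (a + b)) :: 'a kd)"
    using interchange[of "copy a :: 'a kd" "one (R a) || disc a" "copy b" "disc b || one (R b)"]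
    by (simp add: copy_disc_left copy_disc_right replicate_add)
  finally have "f = f >> (copy (a + b) >> ?m)" by simp
  also have "\<dots> = (f >> copy (a + b)) >> ?m"
    by (simp add: sq_assoc replicate_add)
  also have "\<dots> = copy p >> ((f || f) >> ?m)"
    by (simp only: cmap_copy[OF assms]) (simp add: sq_assoc replicate_add)
  also have "(f || f) >> ?m = (f >> (one (R a) || disc b)) || (f >> (disc a || one (R b)))"
    using interchange[of f "one (R a) || disc b" f "disc a || one (R b)"] by (simp add: replicate_add)
  finally show ?thesis .
qed

definition proj :: "nat \<Rightarrow> nat \<Rightarrow> 'a kd" where
  "proj n j = disc j || i1 || disc (n - Suc j)"

lemma cmap_disc: "cmap n 0 (disc n)"
  by (induction n) (use cmap_one[of 0] cmap_pr[OF cmap_kk] in simp_all)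

lemma R_split: "j < n \<Longrightarrow> R j @ \<triangleright> # R (n - Suc j) = R n"
  by (auto dest!: less_imp_Suc_add simp: replicate_add replicate_app_Cons_same)

lemma proj_typing [simp]: "j < n \<Longrightarrow> dom (proj n j) = R n" "cod (proj n j) = [\<triangleright>]"
  by (simp_all add: proj_def R_split)

lemma cmap_proj: "j < n \<Longrightarrow> cmap n 1 (proj n j)"
proof -
  assume "j < n"
  then obtain k where n: "n = j + (1 + k)" by (auto dest!: less_imp_Suc_add)
  have "cmap (j + (1 + k)) (0 + (1 + 0)) (disc j || one (R 1) || disc k)"
    by (intro cmap_pr cmap_disc cmap_one)
  then show ?thesis unfolding n by (simp add: proj_def)
qed

lemma cmap_leI:
  fixes f :: "'a kd"
  assumes "cmap p n f" "cmap p n g" "\<And>j. j < n \<Longrightarrow> f >> proj n j \<le> g >> proj n j"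
  shows "f \<le> g"
  using assms
proof (induction n arbitrary: f g)
  case 0
  have "f >> disc 0 = g >> disc 0" by (simp only: cmapD(3)[OF 0(1)] cmapD(3)[OF 0(2)])
  then show ?case using cmapD(2)[OF 0(1)] cmapD(2)[OF 0(2)] by simp
next
  case (Suc n)
  have c: "cmap (Suc n) n (disc 1 || one (R n) :: 'a kd)"
    using cmap_pr[OF cmap_disc[of 1] cmap_one[of n]] by simp
  have p0: "one (R 1) || disc n = (proj (Suc n) 0 :: 'a kd)" by (simp add: proj_def)
  have pS: "(disc 1 || one (R n)) >> proj n j = (proj (Suc n) (Suc j) :: 'a kd)" if "j < n" for j
  proof -
    have "(kk || one (R n)) >> proj n j = (kk || (proj n j :: 'a kd))"
      using that interchange[of "kk :: 'a kd" "one []" "one (R n)" "proj n j"] by simp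
    then show ?thesis by (simp add: proj_def)
  qed
  have "f >> (disc 1 || one (R n)) \<le> g >> (disc 1 || one (R n))"
  proof (rule Suc.IH)
    fix j assume j: "j < n"
    have "(f >> (disc 1 || one (R n))) >> proj n j = f >> proj (Suc n) (Suc j)"
      if "cmap p (Suc n) f" for f :: "'a kd"
      using cmapD[OF that] j by (simp only: pS[symmetric]) (simp add: sq_assoc)
    then show "(f >> (disc 1 || one (R n))) >> proj n j \<le> (g >> (disc 1 || one (R n))) >> proj n j"
      using Suc(4)[of "Suc j"] Suc(2,3) j by simp
  qed (rule cmap_sq[OF Suc(2) c], rule cmap_sq[OF Suc(3) c])
  moreover have "f >> (one (R 1) || disc n) \<le> g >> (one (R 1) || disc n)"
    unfolding p0 by (rule Suc(4)) simp
  ultimately have le: "copy p >> ((f >> (one (R 1) || disc n)) || (f >> (disc 1 || one (R n)))) \<le>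
     copy p >> ((g >> (one (R 1) || disc n)) || (g >> (disc 1 || one (R n))))"
    by (intro sq_mono[OF order_refl pr_mono])
  have eq: "f = copy p >> ((f >> (one (R 1) || disc n)) || (f >> (disc 1 || one (R n))))"
    if "cmap p (Suc n) f" for f :: "'a kd"
    using that by (intro pairing) simp
  show ?case
    using eq[OF Suc(2)] eq[OF Suc(3)] le by argo
qed

lemma cmap_eqI:
  assumes "cmap p n f" "cmap p n g" "\<And>j. j < n \<Longrightarrow> f >> proj n j = g >> proj n j"
  shows "f = g"
proof (rule antisym)
  show "f \<le> g" by (rule cmap_leI[OF assms(1,2)]) (simp only: assms(3) order_refl)
  show "g \<le> f" by (rule cmap_leI[OF assms(2,1)]) (simp only: assms(3) order_refl)
qed

section \<open>Finite meets and joins, right adjoints\<close>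

lemma cmap_copy_self: "cmap n (n + n) (copy n :: 'a kd)"
proof (induction n)
  case 0
  then show ?case using cmap_one[of 0] by simp
next
  case (Suc n)
  have "cmap (Suc n) (Suc (Suc (n + n))) (cc || copy n :: 'a kd)"
    using cmap_pr[OF cmap_cc Suc] by simp
  moreover have "cmap (Suc (Suc (n + n))) (Suc (Suc (n + n))) (i1 || sy [\<triangleright>] (R n) || one (R n) :: 'a kd)"
    using cmap_pr[OF cmap_one[of 1] cmap_pr[OF cmap_sy[of 1 n] cmap_one[of n]]] by simp
  ultimately show ?case by (simp only: cmap_sq copy.simps add_Suc_right add_Suc)
qed

abbreviation "trm1 p \<equiv> cmap p (Suc 0)"

text \<open>In the KDA order, union \<open>jn\<close> is the meet and intersection \<open>mt\<close> is the join, since a term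
  \<open>x \<mapsto> t\<close> denotes the relation \<open>t \<subseteq> K\<close>.\<close>

definition jn :: "nat \<Rightarrow> 'a kd \<Rightarrow> 'a kd \<Rightarrow> 'a kd" where "jn p s t = copy p >> ((s || t) >> mm)"
definition bt :: "nat \<Rightarrow> 'a kd" where "bt p = disc p >> nn"
definition mt :: "nat \<Rightarrow> 'a kd \<Rightarrow> 'a kd \<Rightarrow> 'a kd" where "mt p s t = copy p >> ((s || t) >> MM)"
definition tp :: "nat \<Rightarrow> 'a kd" where "tp p = disc p >> NN"

lemma trm1_typing: "trm1 p s \<Longrightarrow> dom s = R p" "trm1 p s \<Longrightarrow> cod s = [\<triangleright>]"
  by (simp_all add: cmap_def)
lemma trm1_kk: "trm1 p s \<Longrightarrow> s >> kk = disc p"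
  by (simp add: cmap_def)
lemma trm1_cc: "trm1 p s \<Longrightarrow> s >> cc = copy p >> (s || s)"
  by (simp add: cmap_def)

lemma copy_fst:
  assumes "cmap p m t" "cmap p n F" "dom G = R m"
  shows "copy p >> ((t || F) >> (G || disc n)) = t >> G"
proof -
  note [simp] = cmapD[OF assms(1)] cmapD[OF assms(2)] assms(3)
  have "(t || F) >> (G || disc n) = (one (R p) || disc p) >> (t >> G)"
    using interchange[of "one (R p)" "t >> G" "disc p" "one []"] by (simp add: interchange)
  then have "copy p >> ((t || F) >> (G || disc n)) = (copy p >> (one (R p) || disc p)) >> (t >> G)"
    by (simp add: sq_assoc)
  then show ?thesis by (simp add: copy_disc_right)
qed

lemma copy_snd:
  assumes "cmap p m t" "cmap p n F" "dom G = R n"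
  shows "copy p >> ((t || F) >> (disc m || G)) = F >> G"
proof -
  note [simp] = cmapD[OF assms(1)] cmapD[OF assms(2)] assms(3)
  have "(t || F) >> (disc m || G) = (disc p || one (R p)) >> (F >> G)"
    using interchange[of "disc p" "one []" "one (R p)" "F >> G"] by (simp add: interchange)
  then have "copy p >> ((t || F) >> (disc m || G)) = (copy p >> (disc p || one (R p))) >> (F >> G)"
    by (simp add: sq_assoc)
  then show ?thesis by (simp add: copy_disc_left)
qed

lemma copy_proj1: "trm1 p s \<Longrightarrow> trm1 p t \<Longrightarrow> copy p >> ((s || t) >> (i1 || kk)) = s"
  using copy_fst[of p "Suc 0" s "Suc 0" t i1] by (simp add: trm1_typing)
lemma copy_proj2: "trm1 p s \<Longrightarrow> trm1 p t \<Longrightarrow> copy p >> ((s || t) >> (kk || i1)) = t"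
  using copy_snd[of p "Suc 0" s "Suc 0" t i1] by (simp add: trm1_typing)

lemma trm1_op:
  assumes "trm1 p s" "trm1 p t" "cmap 2 1 g" shows "trm1 p (copy p >> ((s || t) >> g))"
proof (rule cmap_sq[OF cmap_copy_self])
  have "cmap (p + p) 2 (s || t)" using cmap_pr[OF assms(1,2)] by (simp add: numeral_2_eq_2)
  from cmap_sq[OF this assms(3)] show "trm1 (p + p) ((s || t) >> g)" by simp
qed

lemma trm1_jn: "trm1 p s \<Longrightarrow> trm1 p t \<Longrightarrow> trm1 p (jn p s t)"
  unfolding jn_def by (rule trm1_op[OF _ _ cmap_mm])
lemma trm1_mt: "trm1 p s \<Longrightarrow> trm1 p t \<Longrightarrow> trm1 p (mt p s t)"
  unfolding mt_def by (rule trm1_op[OF _ _ cmap_MM])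
lemma trm1_bt: "trm1 p (bt p)"
  unfolding bt_def using cmap_sq[OF cmap_disc cmap_nn] by simp
lemma trm1_tp: "trm1 p (tp p)"
  unfolding tp_def using cmap_sq[OF cmap_disc cmap_NN] by simp
lemma trm1_ltr: "trm1 p s \<Longrightarrow> trm1 p (s >> ltr a)"
  using cmap_sq[of p "Suc 0" s "Suc 0" "ltr a"] cmap_ltr[of a] by simp

text \<open>Discard one of the outputs in F1. This is what makes \<open>jn\<close> a lower
  bound.\<close>

lemma mm_le: "mm \<le> i1 || kk" "mm \<le> kk || i1"
proof -
  have "mm = mm >> (cc >> (i1 || kk))" by (simp add: B2)
  also have "\<dots> = (mm >> cc) >> (i1 || kk)" by (simp add: sq_assoc)
  also have "\<dots> \<le> (i1 || i1) >> (i1 || kk)" by (intro sq_mono order_refl F1)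
  finally show "mm \<le> i1 || kk" by simp
next
  have "mm = mm >> (cc >> (kk || i1))" by (simp add: B2')
  also have "\<dots> = (mm >> cc) >> (kk || i1)" by (simp add: sq_assoc)
  also have "\<dots> \<le> (i1 || i1) >> (kk || i1)" by (intro sq_mono order_refl F1)
  finally show "mm \<le> kk || i1" by simp
qed

lemma MM_ge: "i1 || kk \<le> MM" "kk || i1 \<le> MM"
proof -
  have "(i1 || i1) >> (i1 || kk) \<le> (MM >> cc) >> (i1 || kk)" by (intro sq_mono order_refl F5)
  also have "\<dots> = MM >> (cc >> (i1 || kk))" by (simp add: sq_assoc)
  finally show "i1 || kk \<le> MM" by (simp add: B2)
next
  have "(i1 || i1) >> (kk || i1) \<le> (MM >> cc) >> (kk || i1)" by (intro sq_mono order_refl F5)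
  also have "\<dots> = MM >> (cc >> (kk || i1))" by (simp add: sq_assoc)
  finally show "kk || i1 \<le> MM" by (simp add: B2')
qed

lemma jn_le1:
  assumes "trm1 p s" "trm1 p t" shows "jn p s t \<le> s"
proof -
  have "jn p s t \<le> copy p >> ((s || t) >> (i1 || kk))"
    unfolding jn_def by (intro sq_mono[OF order_refl] mm_le)
  then show ?thesis by (simp only: copy_proj1[OF assms])
qed

lemma jn_le2:
  assumes "trm1 p s" "trm1 p t" shows "jn p s t \<le> t"
proof -
  have "jn p s t \<le> copy p >> ((s || t) >> (kk || i1))"
    unfolding jn_def by (intro sq_mono[OF order_refl] mm_le)
  then show ?thesis by (simp only: copy_proj2[OF assms])
qed

lemma mt_ge1:
  assumes "trm1 p s" "trm1 p t" shows "s \<le> mt p s t"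
proof -
  have "copy p >> ((s || t) >> (i1 || kk)) \<le> mt p s t"
    unfolding mt_def by (intro sq_mono[OF order_refl] MM_ge)
  then show ?thesis by (simp only: copy_proj1[OF assms])
qed

lemma mt_ge2:
  assumes "trm1 p s" "trm1 p t" shows "t \<le> mt p s t"
proof -
  have "copy p >> ((s || t) >> (kk || i1)) \<le> mt p s t"
    unfolding mt_def by (intro sq_mono[OF order_refl] MM_ge)
  then show ?thesis by (simp only: copy_proj2[OF assms])
qed

text \<open>B10 inserts \<open>cc >> mm\<close> behind \<open>u\<close>; as \<open>u\<close> is
  copyable, the copy moves in front of it and produces two copies of \<open>u\<close>.\<close>

lemma jn_greatest:
  assumes "trm1 p u" "u \<le> s" "u \<le> t" shows "u \<le> jn p s t"
proof -
  note [simp] = trm1_typing[OF assms(1)]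
  have "u = u >> (cc >> mm)" by (simp add: B10)
  also have "\<dots> = (u >> cc) >> mm" by (simp add: sq_assoc)
  also have "\<dots> = copy p >> ((u || u) >> mm)" by (simp add: trm1_cc[OF assms(1)] sq_assoc)
  also have "\<dots> \<le> jn p s t" unfolding jn_def by (intro sq_mono[OF order_refl] sq_mono[OF pr_mono order_refl] assms)
  finally show ?thesis .
qed

lemma mt_least:
  assumes "trm1 p u" "s \<le> u" "t \<le> u" shows "mt p s t \<le> u"
proof -
  note [simp] = trm1_typing[OF assms(1)]
  have "mt p s t \<le> copy p >> ((u || u) >> MM)"
    unfolding mt_def by (intro sq_mono[OF order_refl] sq_mono[OF pr_mono order_refl] assms)
  also have "\<dots> = (u >> cc) >> MM" by (simp add: trm1_cc[OF assms(1)] sq_assoc)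
  also have "\<dots> = u >> (cc >> MM)" by (simp add: sq_assoc)
  also have "\<dots> \<le> u >> i1" by (intro sq_mono order_refl F7)
  finally show ?thesis by simp
qed

lemma bt_greatest: assumes "trm1 p u" shows "u \<le> bt p"
proof -
  note [simp] = trm1_typing[OF assms(1)]
  have "u >> i1 \<le> u >> (kk >> nn)" by (intro sq_mono order_refl F2)
  also have "\<dots> = (u >> kk) >> nn" by (simp add: sq_assoc)
  finally show ?thesis by (simp add: bt_def trm1_kk[OF assms])
qed

lemma tp_least: assumes "trm1 p u" shows "tp p \<le> u"
proof -
  note [simp] = trm1_typing[OF assms(1)]
  have "tp p = (u >> kk) >> NN" by (simp add: tp_def trm1_kk[OF assms])
  also have "\<dots> = u >> (kk >> NN)" by (simp add: sq_assoc)
  also have "\<dots> \<le> u >> i1" by (intro sq_mono order_refl F6)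
  finally show ?thesis by simp
qed

lemma jn_pre:
  assumes "cmap q p f" "trm1 p s" "trm1 p t"
  shows "f >> jn p s t = jn q (f >> s) (f >> t)"
proof -
  note [simp] = cmapD(1,2)[OF assms(1)] trm1_typing[OF assms(2)] trm1_typing[OF assms(3)]
  have "f >> jn p s t = (f >> copy p) >> ((s || t) >> mm)" by (simp add: jn_def sq_assoc)
  also have "\<dots> = copy q >> (((f || f) >> (s || t)) >> mm)"
    by (simp only: cmap_copy[OF assms(1)]) (simp add: sq_assoc)
  finally show ?thesis by (simp add: jn_def interchange)
qed

lemma bt_pre: assumes "cmap q p f" shows "f >> bt p = bt q"
proof -
  have "f >> bt p = (f >> disc p) >> nn" using cmapD(1,2)[OF assms] by (simp add: bt_def sq_assoc)
  then show ?thesis by (simp only: cmapD(3)[OF assms] bt_def)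
qed

lemma jn_ltr:
  assumes "trm1 p s" "trm1 p t"
  shows "jn p s t >> ltr a = jn p (s >> ltr a) (t >> ltr a)"
proof -
  note [simp] = trm1_typing[OF assms(1)] trm1_typing[OF assms(2)]
  have "jn p s t >> ltr a = copy p >> ((s || t) >> (mm >> ltr a))" by (simp add: jn_def sq_assoc)
  also have "\<dots> = copy p >> (((s || t) >> (ltr a || ltr a)) >> mm)"
    unfolding E10 by (simp add: sq_assoc)
  finally show ?thesis by (simp add: jn_def interchange)
qed

lemma bt_ltr: "bt p >> ltr a = bt p"
  by (simp add: bt_def sq_assoc E11)

definition JN :: "nat \<Rightarrow> 'a kd list \<Rightarrow> 'a kd" where "JN p ts = foldr (jn p) ts (bt p)"
definition MT :: "nat \<Rightarrow> 'a kd list \<Rightarrow> 'a kd" where "MT p ts = foldr (mt p) ts (tp p)"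
definition tuple :: "nat \<Rightarrow> 'a kd list \<Rightarrow> 'a kd" where "tuple p ts = foldr (\<lambda>t F. copy p >> (t || F)) ts (disc p)"

lemma JN_simps: "JN p [] = bt p" "JN p (t # ts) = jn p t (JN p ts)"
  and MT_simps: "MT p [] = tp p" "MT p (t # ts) = mt p t (MT p ts)"
  and tuple_simps: "tuple p [] = disc p" "tuple p (t # ts) = copy p >> (t || tuple p ts)"
  by (simp_all add: JN_def MT_def tuple_def)

lemma trm1_JN: "\<forall>t\<in>set ts. trm1 p t \<Longrightarrow> trm1 p (JN p ts)"
  by (induction ts) (simp_all add: JN_simps trm1_jn trm1_bt)
lemma trm1_MT: "\<forall>t\<in>set ts. trm1 p t \<Longrightarrow> trm1 p (MT p ts)"
  by (induction ts) (simp_all add: MT_simps trm1_mt trm1_tp)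

lemma JN_le: "\<forall>t\<in>set ts. trm1 p t \<Longrightarrow> t \<in> set ts \<Longrightarrow> JN p ts \<le> t"
proof (induction ts)
  case (Cons s ts)
  then have s: "trm1 p s" "trm1 p (JN p ts)" by (simp_all add: trm1_JN)
  from Cons.prems(2) consider "t = s" | "t \<in> set ts" by auto
  then show ?case
    using jn_le1[OF s] order_trans[OF jn_le2[OF s] Cons.IH] Cons.prems(1)
    by cases (simp_all add: JN_simps)
qed simp

lemma JN_greatest: "trm1 p u \<Longrightarrow> \<forall>t\<in>set ts. u \<le> t \<Longrightarrow> u \<le> JN p ts"
  by (induction ts) (simp_all add: JN_simps jn_greatest bt_greatest)

lemma MT_ge: "\<forall>t\<in>set ts. trm1 p t \<Longrightarrow> t \<in> set ts \<Longrightarrow> t \<le> MT p ts"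
proof (induction ts)
  case (Cons s ts)
  then have s: "trm1 p s" "trm1 p (MT p ts)" by (simp_all add: trm1_MT)
  from Cons.prems(2) consider "t = s" | "t \<in> set ts" by auto
  then show ?case
    using mt_ge1[OF s] order_trans[OF Cons.IH mt_ge2[OF s]] Cons.prems(1)
    by cases (simp_all add: MT_simps)
qed simp

lemma MT_least: "trm1 p u \<Longrightarrow> \<forall>t\<in>set ts. t \<le> u \<Longrightarrow> MT p ts \<le> u"
  by (induction ts) (simp_all add: MT_simps mt_least tp_least)

lemma JN_pre: "cmap q p f \<Longrightarrow> \<forall>t\<in>set ts. trm1 p t \<Longrightarrow> f >> JN p ts = JN q (map ((>>) f) ts)"
proof (induction ts)
  case (Cons t ts)
  then have "f >> jn p t (JN p ts) = jn q (f >> t) (f >> JN p ts)" by (intro jn_pre trm1_JN) simp_all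
  with Cons show ?case by (simp add: JN_simps)
qed (simp add: JN_simps bt_pre)

lemma JN_letter: "\<forall>t\<in>set ts. trm1 p t \<Longrightarrow> JN p ts >> ltr a = JN p (map (\<lambda>t. t >> ltr a) ts)"
proof (induction ts)
  case (Cons t ts)
  then have "jn p t (JN p ts) >> ltr a = jn p (t >> ltr a) (JN p ts >> ltr a)" by (intro jn_ltr trm1_JN) simp_all
  with Cons show ?case by (simp add: JN_simps)
qed (simp add: JN_simps bt_ltr)

lemma cmap_tuple: "\<forall>t\<in>set ts. trm1 p t \<Longrightarrow> cmap p (length ts) (tuple p ts)"
proof (induction ts)
  case Nil
  then show ?case by (simp add: tuple_simps cmap_disc)
next
  case (Cons t ts)
  then have "cmap (p + p) (Suc (length ts)) (t || tuple p ts)"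
    using cmap_pr[of p "Suc 0" t p "length ts" "tuple p ts"] by simp
  then show ?case
    using cmap_sq[OF cmap_copy_self] by (simp add: tuple_simps)
qed

lemma tuple_proj: "\<forall>t\<in>set ts. trm1 p t \<Longrightarrow> j < length ts \<Longrightarrow> tuple p ts >> proj (length ts) j = ts ! j"
proof (induction ts arbitrary: j)
  case (Cons t ts)
  then have t: "trm1 p t" and ts: "cmap p (length ts) (tuple p ts)" by (simp_all add: cmap_tuple)
  note [simp] = cmapD(1,2)[OF t] cmapD(1,2)[OF ts]
  show ?case
  proof (cases j)
    case 0
    then show ?thesis using copy_fst[OF t ts, of i1] by (simp add: tuple_simps proj_def sq_assoc)
  next
    case (Suc i)
    then have "proj (length (t # ts)) j = kk || (proj (length ts) i :: 'a kd)"
      by (simp add: proj_def)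
    then show ?thesis
      using Suc Cons.IH[of i] Cons.prems copy_snd[OF t ts, of "proj (length ts) i"] by (simp add: tuple_simps sq_assoc)
  qed
qed simp

section \<open>Right adjoints in the KDA order\<close>

definition has_radj :: "'a kd \<Rightarrow> bool" where
  "has_radj f \<longleftrightarrow> (\<exists>g. dom g = cod f \<and> cod g = dom f \<and> one (dom f) \<le> f >> g \<and> g >> f \<le> one (cod f))"

lemma has_radjI: "one X \<le> f >> g \<Longrightarrow> g >> f \<le> one Y \<Longrightarrow> dom f = X \<Longrightarrow> cod f = Y \<Longrightarrow> dom g = Y \<Longrightarrow> cod g = X \<Longrightarrow> has_radj f"
  unfolding has_radj_def by blast

lemma has_radj_one: "has_radj (one X)"
  by (rule has_radjI[of X _ "one X" X]) simp_all
lemma has_radj_sy: "has_radj (sy X Y)"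
  by (rule has_radjI[of "X @ Y" _ "sy Y X" "Y @ X"]) simp_all

lemma has_radj_sq:
  assumes "has_radj f" "has_radj g" "cod f = dom g"
  shows "has_radj (f >> g)"
proof -
  obtain f' g' where f': "dom f' = cod f" "cod f' = dom f" "one (dom f) \<le> f >> f'" "f' >> f \<le> one (cod f)"
    and g': "dom g' = cod g" "cod g' = dom g" "one (dom g) \<le> g >> g'" "g' >> g \<le> one (cod g)"
    using assms unfolding has_radj_def by blast
  note [simp] = f'(1,2) g'(1,2) assms(3)
  show ?thesis
  proof (rule has_radjI[of "dom f" _ "g' >> f'" "cod g"])
    have "one (dom f) \<le> f >> f'" by fact
    also have "\<dots> = f >> (one (dom g) >> f')" by simp
    also have "\<dots> \<le> f >> ((g >> g') >> f')" by (intro sq_mono[OF order_refl] sq_mono[OF _ order_refl] g')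
    finally show "one (dom f) \<le> (f >> g) >> (g' >> f')" by (simp add: sq_assoc)
    have "(g' >> f') >> (f >> g) = g' >> ((f' >> f) >> g)" by (simp add: sq_assoc)
    also have "\<dots> \<le> g' >> (one (cod f) >> g)" by (intro sq_mono[OF order_refl] sq_mono[OF _ order_refl] f')
    also have "\<dots> \<le> one (cod g)" using g'(4) by simp
    finally show "(g' >> f') >> (f >> g) \<le> one (cod g)" .
  qed simp_all
qed

lemma has_radj_pr:
  assumes "has_radj f" "has_radj g"
  shows "has_radj (f || g)"
proof -
  obtain f' g' where f': "dom f' = cod f" "cod f' = dom f" "one (dom f) \<le> f >> f'" "f' >> f \<le> one (cod f)"
    and g': "dom g' = cod g" "cod g' = dom g" "one (dom g) \<le> g >> g'" "g' >> g \<le> one (cod g)"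
    using assms unfolding has_radj_def by blast
  show ?thesis
    using pr_mono[OF f'(3) g'(3)] pr_mono[OF f'(4) g'(4)] f'(1,2) g'(1,2)
    by (intro has_radjI[of "dom f @ dom g" _ "f' || g'" "cod f @ cod g"]) (simp_all add: interchange)
qed

text \<open>The axioms F1 to F12 are the units and counits of these adjunctions. The right adjoints
  of \<open>cc\<close>, \<open>kk\<close>, \<open>mm\<close>, \<open>nn\<close>, \<open>MM\<close>,
  \<open>NN\<close> are \<open>mm\<close>, \<open>nn\<close>, \<open>WC\<close>, \<open>WK\<close>,
  \<open>cc\<close>, \<open>kk\<close>, so all operations that build the simulation can be slid
  laxly.\<close>

lemma has_radj_gens: "has_radj cc" "has_radj kk" "has_radj mm" "has_radj nn" "has_radj MM" "has_radj NN"
proof -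
  show "has_radj cc" by (rule has_radjI[OF F3]) (use F1 in simp_all)
  show "has_radj kk" by (rule has_radjI[OF F2]) (use F4 in simp_all)
  show "has_radj mm" by (rule has_radjI[of "[\<triangleright>,\<triangleright>]" _ WC]) (use F9 F11 in simp_all)
  show "has_radj nn" by (rule has_radjI[OF F12]) (use F10 in simp_all)
  show "has_radj MM" by (rule has_radjI[of "[\<triangleright>,\<triangleright>]" _ cc]) (use F5 F7 in simp_all)
  show "has_radj NN" by (rule has_radjI[OF F8]) (use F6 in simp_all)
qed

lemma has_radj_disc: "has_radj (disc n)"
  by (induction n) (simp_all add: has_radj_one has_radj_pr has_radj_gens)
lemma has_radj_copy: "has_radj (copy n)"
  by (induction n) (simp_all add: has_radj_one has_radj_pr has_radj_sq has_radj_gens has_radj_sy)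
lemma has_radj_proj: "has_radj (proj n j)"
  by (simp add: proj_def has_radj_one has_radj_pr has_radj_disc)

lemma has_radj_op:
  assumes "trm1 p s" "trm1 p t" "has_radj s" "has_radj t" "has_radj g" "dom g = [\<triangleright>,\<triangleright>]"
  shows "has_radj (copy p >> ((s || t) >> g))"
  using trm1_typing[OF assms(1)] trm1_typing[OF assms(2)] assms
  by (simp add: has_radj_sq has_radj_copy has_radj_pr)

lemma has_radj_JN: "\<forall>t\<in>set ts. trm1 p t \<and> has_radj t \<Longrightarrow> has_radj (JN p ts)"
proof (induction ts)
  case Nil
  then show ?case by (simp add: JN_simps bt_def has_radj_sq has_radj_disc has_radj_gens)
next
  case (Cons t ts)
  then show ?case
    using has_radj_op[OF _ trm1_JN, of p t ts mm] has_radj_gens by (simp add: JN_simps jn_def)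
qed

lemma has_radj_MT: "\<forall>t\<in>set ts. trm1 p t \<and> has_radj t \<Longrightarrow> has_radj (MT p ts)"
proof (induction ts)
  case Nil
  then show ?case by (simp add: MT_simps tp_def has_radj_sq has_radj_disc has_radj_gens)
next
  case (Cons t ts)
  then show ?case
    using has_radj_op[OF _ trm1_MT, of p t ts MM] has_radj_gens by (simp add: MT_simps mt_def)
qed

lemma has_radj_tuple: "\<forall>t\<in>set ts. trm1 p t \<and> has_radj t \<Longrightarrow> has_radj (tuple p ts)"
proof (induction ts)
  case (Cons t ts)
  then have "cmap p (length ts) (tuple p ts)" "trm1 p t" by (simp_all add: cmap_tuple)
  then have "dom t = R p" "dom (tuple p ts) = R p" by (simp_all add: cmap_def)
  then show ?case
    using Cons by (simp add: tuple_simps has_radj_sq has_radj_copy has_radj_pr)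
qed (simp add: tuple_simps has_radj_disc)

text \<open>Lax sliding: a right adjoint of \<open>h\<close> lets \<open>h\<close> be introduced on the feedback wire.\<close>

lemma tr_simulation:
  assumes "has_radj h" "dom h = X" "cod h = Y" "dom F = X @ A" "cod F = X @ B" "dom G = Y @ A" "cod G = Y @ B"
    and "F >> (h || one B) \<le> (h || one A) >> G"
  shows "tr X A B F \<le> tr Y A B G"
proof -
  obtain g where g: "dom g = Y" "cod g = X" "one X \<le> h >> g" "g >> h \<le> one Y"
    using assms(1-3) unfolding has_radj_def by blast
  note [simp] = assms(2-7) g(1,2)
  have "F = F >> (one X || one B)" by simp
  also have "\<dots> \<le> F >> ((h >> g) || one B)" by (intro sq_mono[OF order_refl] pr_mono order_refl g)
  also have "\<dots> = (F >> (h || one B)) >> (g || one B)" by (simp add: pr_split sq_assoc)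
  also have "\<dots> \<le> ((h || one A) >> G) >> (g || one B)" by (intro sq_mono[OF _ order_refl] assms)
  also have "\<dots> = (h || one A) >> (G >> (g || one B))" by (simp add: sq_assoc)
  finally have "tr X A B F \<le> tr X A B ((h || one A) >> (G >> (g || one B)))" by (rule tr_mono)
  \<comment> \<open>Sliding \<open>h\<close> around the loop brings it behind its adjoint
    \<open>g\<close>, where the counit removes the pair.\<close>
  also have "\<dots> = tr Y A B (G >> ((g >> h) || one B))"
    by (subst tr_slide[of h X Y]) (simp_all add: pr_split sq_assoc)
  also have "\<dots> \<le> tr Y A B (G >> (one Y || one B))" by (intro tr_mono sq_mono[OF order_refl] pr_mono order_refl g)
  finally show ?thesis by simp
qed

section \<open>Boolean matrices\<close>

text \<open>The union of the variables selected by \<open>P\<close>: one column of a boolean matrix.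
  In the KDA order it is the meet of the selected projections.\<close>

definition lin :: "nat \<Rightarrow> (nat \<Rightarrow> bool) \<Rightarrow> 'a kd" where
  "lin p P = JN p (map (proj p) (filter P [0..<p]))"

lemma trm1_proj: "j < n \<Longrightarrow> trm1 n (proj n j)"
  using cmap_proj[of j n] by simp

lemma trm1_lin: "trm1 p (lin p P)"
  unfolding lin_def by (intro trm1_JN) (auto intro: trm1_proj)

lemma lin_le: "i < p \<Longrightarrow> P i \<Longrightarrow> lin p P \<le> proj p i"
  unfolding lin_def by (intro JN_le) (auto intro: trm1_proj)

lemma lin_greatest: "trm1 p u \<Longrightarrow> (\<And>i. i < p \<Longrightarrow> P i \<Longrightarrow> u \<le> proj p i) \<Longrightarrow> u \<le> lin p P"
  unfolding lin_def by (intro JN_greatest) auto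

lemma lin_single: "j < p \<Longrightarrow> lin p (\<lambda>i. i = j) = proj p j"
  by (intro antisym lin_le lin_greatest trm1_proj) auto

lemma JN_eqI:
  assumes "\<forall>t\<in>set ts. trm1 p t" "trm1 p u" "\<forall>t\<in>set ts. u \<le> t"
    and "\<And>v. trm1 p v \<Longrightarrow> \<forall>t\<in>set ts. v \<le> t \<Longrightarrow> v \<le> u"
  shows "JN p ts = u"
proof (rule antisym)
  show "JN p ts \<le> u" by (intro assms(4) trm1_JN ballI JN_le assms(1))
  show "u \<le> JN p ts" by (intro JN_greatest assms)
qed

lemma cmap_lin:
  assumes "cmap q p f"
  shows "f >> lin p P = JN q (map (\<lambda>i. f >> proj p i) (filter P [0..<p]))"
  unfolding lin_def by (subst JN_pre[OF assms]) (auto intro: trm1_proj simp: o_def)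

definition has_matrix :: "nat \<Rightarrow> nat \<Rightarrow> 'a kd \<Rightarrow> (nat \<Rightarrow> nat \<Rightarrow> bool) \<Rightarrow> bool" where
  "has_matrix p q f S \<longleftrightarrow> cmap p q f \<and> (\<forall>j<q. f >> proj q j = lin p (\<lambda>i. S i j))"

definition boolean :: "nat \<Rightarrow> nat \<Rightarrow> 'a kd \<Rightarrow> bool" where
  "boolean p q f \<longleftrightarrow> (\<exists>S. has_matrix p q f S)"

lemma has_matrixD: "has_matrix p q f S \<Longrightarrow> cmap p q f" "has_matrix p q f S \<Longrightarrow> j < q \<Longrightarrow> f >> proj q j = lin p (\<lambda>i. S i j)"
  by (simp_all add: has_matrix_def)

lemma booleanI: "cmap p q f \<Longrightarrow> (\<And>j. j < q \<Longrightarrow> \<exists>P. f >> proj q j = lin p P) \<Longrightarrow> boolean p q f"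
proof -
  assume a: "cmap p q f" and b: "\<And>j. j < q \<Longrightarrow> \<exists>P. f >> proj q j = lin p P"
  define S where "S j = (SOME P. f >> proj q j = lin p P)" for j
  have "f >> proj q j = lin p (S j)" if "j < q" for j
    unfolding S_def using someI_ex[OF b[OF that]] .
  then show ?thesis unfolding boolean_def has_matrix_def using a by (intro exI[of _ "\<lambda>i j. S j i"]) simp
qed

lemma booleanD: "boolean p q f \<Longrightarrow> cmap p q f" "boolean p q f \<Longrightarrow> j < q \<Longrightarrow> \<exists>P. f >> proj q j = lin p P"
  unfolding boolean_def has_matrix_def by blast+

lemma boolean_typing: "boolean p q f \<Longrightarrow> dom f = R p" "boolean p q f \<Longrightarrow> cod f = R q"
  by (rule cmapD(1)[OF booleanD(1)], assumption, rule cmapD(2)[OF booleanD(1)])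

lemma lin_typing [simp]: "dom (lin p P) = R p" "cod (lin p P) = [\<triangleright>]"
  by (rule trm1_typing[OF trm1_lin])+

lemma proj_1_0: "proj (Suc 0) 0 = i1" by (simp add: proj_def)

lemma boolean_lin: "boolean p (Suc 0) (lin p P)"
proof (rule booleanI)
  show "trm1 p (lin p P)" by (rule trm1_lin)
  fix j assume "j < Suc 0"
  then have j: "j = 0" by simp
  show "\<exists>Q. lin p P >> proj (Suc 0) j = lin p Q"
    by (rule exI[of _ P]) (simp add: j proj_1_0)
qed

text \<open>Substituting unions into a union is a boolean matrix-vector product. Comparing lower
  bounds replaces all diagrammatic regrouping.\<close>

lemma lin_lin:
  assumes "cmap p q f" "\<And>j. j < q \<Longrightarrow> \<exists>P. f >> proj q j = lin p P"
  shows "\<exists>Q. f >> lin q P = lin p Q"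
proof -
  obtain S where S: "\<And>j. j < q \<Longrightarrow> f >> proj q j = lin p (S j)" using assms(2) by metis
  have "f >> lin q P = lin p (\<lambda>i. \<exists>j<q. P j \<and> S j i)"
    unfolding cmap_lin[OF assms(1)]
  proof (rule JN_eqI)
    show "\<forall>t\<in>set (map (\<lambda>i. f >> proj q i) (filter P [0..<q])). trm1 p t"
      by (auto simp: S trm1_lin)
    show "\<forall>t\<in>set (map (\<lambda>i. f >> proj q i) (filter P [0..<q])). lin p (\<lambda>i. \<exists>j<q. P j \<and> S j i) \<le> t"
      by (auto simp: S intro!: lin_greatest trm1_lin lin_le)
    fix v assume v: "trm1 p v" and le: "\<forall>t\<in>set (map (\<lambda>i. f >> proj q i) (filter P [0..<q])). v \<le> t"
    show "v \<le> lin p (\<lambda>i. \<exists>j<q. P j \<and> S j i)"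
    proof (rule lin_greatest[OF v])
      fix i assume i: "i < p" "\<exists>j<q. P j \<and> S j i"
      then obtain j where j: "j < q" "P j" "S j i" by auto
      then have "v \<le> lin p (S j)" using le by (auto simp: S)
      also have "\<dots> \<le> proj p i" by (intro lin_le i j)
      finally show "v \<le> proj p i" .
    qed
  qed (rule trm1_lin)
  then show ?thesis by blast
qed

lemma boolean_sq:
  assumes "boolean p q f" "boolean q r g"
  shows "boolean p r (f >> g)"
proof (rule booleanI)
  show "cmap p r (f >> g)" by (rule cmap_sq[OF booleanD(1)[OF assms(1)] booleanD(1)[OF assms(2)]])
  fix j assume j: "j < r"
  then obtain P where P: "g >> proj r j = lin q P" using booleanD(2)[OF assms(2)] by auto
  have "(f >> g) >> proj r j = f >> lin q P"
    using boolean_typing[OF assms(1)] boolean_typing[OF assms(2)] j by (simp add: sq_assoc P[symmetric])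
  then show "\<exists>P. (f >> g) >> proj r j = lin p P"
    using lin_lin[OF booleanD[OF assms(1)]] by simp
qed

lemma boolean_one: "boolean n n (one (R n))"
proof (rule booleanI[OF cmap_one])
  fix j assume "j < n"
  then have "one (R n) >> proj n j = lin n (\<lambda>i. i = j)" by (simp add: lin_single)
  then show "\<exists>P. one (R n) >> proj n j = lin n P" by blast
qed

lemma proj_add_left: "j < m \<Longrightarrow> proj (m + n) j = proj m j || disc n"
  by (auto dest!: less_imp_Suc_add simp: proj_def disc_add)

lemma proj_add_right: "proj (m + n) (m + j) = disc m || proj n j"
  by (simp add: proj_def disc_add)

lemma lin_weaken_left: "\<exists>Q. lin p P || disc r = lin (p + r) Q"
proof -
  let ?f = "one (R p) || disc r :: 'a kd"
  have c: "cmap (p + r) p ?f" using cmap_pr[OF cmap_one[of p] cmap_disc[of r]] by simp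
  have *: "?f >> proj p j = lin (p + r) (\<lambda>i. i = j)" if "j < p" for j
    using that interchange[of "one (R p)" "proj p j" "disc r :: 'a kd" "one []"] by (simp add: lin_single proj_add_left)
  have "\<exists>Q. ?f >> lin p P = lin (p + r) Q"
    by (rule lin_lin[OF c], rule exI, rule *)
  moreover have "?f >> lin p P = lin p P || disc r"
    using interchange[of "one (R p)" "lin p P" "disc r :: 'a kd" "one []"] by simp
  ultimately show ?thesis by (simp only:)
qed

lemma lin_weaken_right: "\<exists>Q. disc r || lin p P = lin (r + p) Q"
proof -
  let ?f = "disc r || one (R p) :: 'a kd"
  have c: "cmap (r + p) p ?f" using cmap_pr[OF cmap_disc[of r] cmap_one[of p]] by simp
  have *: "?f >> proj p j = lin (r + p) (\<lambda>i. i = r + j)" if "j < p" for j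
    using that interchange[of "disc r :: 'a kd" "one []" "one (R p)" "proj p j"]
      by (simp add: lin_single proj_add_right)
  have "\<exists>Q. ?f >> lin p P = lin (r + p) Q"
    by (rule lin_lin[OF c], rule exI, rule *)
  moreover have "?f >> lin p P = disc r || lin p P"
    using interchange[of "disc r :: 'a kd" "one []" "one (R p)" "lin p P"] by simp
  ultimately show ?thesis by (simp only:)
qed

lemma boolean_pr:
  fixes f :: "'a kd"
  assumes "boolean p q f" "boolean p' q' g"
  shows "boolean (p + p') (q + q') (f || g)"
proof (rule booleanI)
  note f = booleanD(1)[OF assms(1)] and g = booleanD(1)[OF assms(2)]
  show "cmap (p + p') (q + q') (f || g)" by (rule cmap_pr[OF f g])
  note [simp] = cmapD(1,2)[OF f] cmapD(1,2)[OF g]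
  fix j assume j: "j < q + q'"
  show "\<exists>P. (f || g) >> proj (q + q') j = lin (p + p') P"
  proof (cases "j < q")
    case True
    then obtain P where P: "f >> proj q j = lin p P" using booleanD(2)[OF assms(1)] by auto
    have "(f || g) >> proj (q + q') j = lin p P || disc p'"
      using True by (simp add: proj_add_left interchange P cmapD(3)[OF g])
    then show ?thesis using lin_weaken_left by simp
  next
    case False
    then obtain k where k: "j = q + k" "k < q'" using j less_diff_conv2
      by (metis add_diff_inverse_nat nat_add_left_cancel_less)
    then obtain P where P: "g >> proj q' k = lin p' P" using booleanD(2)[OF assms(2)] by auto
    have "(f || g) >> proj (q + q') j = disc p || lin p' P"
      using k by (simp add: proj_add_right interchange P cmapD(3)[OF f])
    then show ?thesis using lin_weaken_right by simp
  qed
qed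

lemma boolean_sy: "boolean (p + q) (p + q) (sy (R p) (R q) :: 'a kd)"
proof (rule booleanI[OF cmap_sy])
  fix j assume j: "j < p + q"
  show "\<exists>P. sy (R p) (R q) >> proj (p + q) j = (lin (p + q) P :: 'a kd)"
  proof (cases "j < q")
    case True
    have "sy (R p) (R q) >> proj (q + p) j = (disc p || (proj q j :: 'a kd))"
      using True sy_natural[of "disc p" "R p" "proj q j :: 'a kd" "R q" "[]" "[\<triangleright>]"] by (simp add: proj_add_left)
    also have "\<dots> = lin (p + q) (\<lambda>i. i = p + j)"
      using True by (simp add: lin_single proj_add_right)
    finally show ?thesis by (auto simp: add.commute)
  next
    case False
    then obtain k where k: "j = q + k" "k < p" using j
      by (metis add.commute add_diff_inverse_nat nat_add_left_cancel_less)
    have "sy (R p) (R q) >> proj (q + p) j = (proj p k || (disc q :: 'a kd))"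
      using k sy_natural[of "proj p k :: 'a kd" "R p" "disc q" "R q" "[\<triangleright>]" "[]"] by (simp add: proj_add_right)
    also have "\<dots> = lin (p + q) (\<lambda>i. i = k)"
      using k by (simp add: lin_single proj_add_left)
    finally show ?thesis by (auto simp: add.commute)
  qed
qed

lemma boolean_disc: "boolean p 0 (disc p)"
  by (rule booleanI[OF cmap_disc]) simp

lemma boolean_kk: "boolean (Suc 0) 0 kk"
  using boolean_disc[of "Suc 0"] by simp

text \<open>\<open>mm\<close> is the union of both variables: it lies below the two projections by
  \<open>mm_le\<close>, and every common lower bound lies below their \<open>jn\<close>, which is
  \<open>mm\<close> because the projections pair to the identity.\<close>

lemma boolean_mm: "boolean (Suc (Suc 0)) (Suc 0) (mm :: 'a kd)"
proof -
  let ?p = "Suc (Suc 0)"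
  have m: "trm1 ?p (mm :: 'a kd)" using cmap_mm by (simp add: numeral_2_eq_2)
  have p: "proj ?p 0 = i1 || (kk :: 'a kd)" "proj ?p (Suc 0) = kk || (i1 :: 'a kd)" by (simp_all add: proj_def)
  have "lin ?p (\<lambda>_. True) \<le> jn ?p (proj ?p 0) (proj ?p (Suc 0) :: 'a kd)"
    by (intro jn_greatest trm1_lin lin_le) simp_all
  also have "\<dots> = (copy ?p >> ((i1 || kk) || (kk || i1))) >> mm"
    by (simp add: jn_def p sq_assoc del: copy.simps)
  also have "copy ?p >> ((i1 || kk) || (kk || i1)) = (one (R ?p) :: 'a kd)"
  proof -
    have "cmap ?p (Suc 0 + Suc 0) (one (R ?p) :: 'a kd)" using cmap_one[of ?p] by simp
    from pairing[OF this] show ?thesis by (simp del: copy.simps)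
  qed
  also have "one (R ?p) >> mm = (mm :: 'a kd)" by simp
  finally have le: "lin ?p (\<lambda>_. True) \<le> (mm :: 'a kd)" .
  have "mm \<le> (proj ?p 0 :: 'a kd)" "mm \<le> (proj ?p (Suc 0) :: 'a kd)"
    unfolding p by (rule mm_le)+
  then have "(mm :: 'a kd) \<le> proj ?p i" if "i < ?p" for i
    using that less_2_cases[of i] by (metis numeral_2_eq_2 One_nat_def)
  then have ge: "(mm :: 'a kd) \<le> lin ?p (\<lambda>_. True)"
    by (intro lin_greatest[OF m])
  have "lin ?p (\<lambda>_. True) = (mm :: 'a kd)" by (rule antisym[OF le ge])
  then show ?thesis using boolean_lin[of ?p "\<lambda>_. True", where 'a = 'a] by (simp only:)
qed

lemma boolean_nn: "boolean 0 (Suc 0) nn"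
  using boolean_lin[of 0 "\<lambda>_. True"] by (simp add: lin_def JN_simps bt_def)

lemma boolean_copy: "boolean p (p + p) (copy p)"
proof (rule booleanI[OF cmap_copy_self])
  fix j assume j: "j < p + p"
  show "\<exists>P. copy p >> proj (p + p) j = lin p P"
  proof (cases "j < p")
    case True
    then have "copy p >> proj (p + p) j = lin p (\<lambda>i. i = j)"
      using copy_fst[OF cmap_one cmap_one, of "proj p j" p] by (simp add: proj_add_left lin_single)
    then show ?thesis by blast
  next
    case False
    then obtain k where k: "j = p + k" "k < p" using j by (metis add_diff_inverse_nat nat_add_left_cancel_less)
    then have "copy p >> proj (p + p) j = lin p (\<lambda>i. i = k)"
      using copy_snd[OF cmap_one cmap_one, of "proj p k" p] by (simp add: proj_add_right lin_single)
    then show ?thesis by blast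
  qed
qed

lemma boolean_cc: "boolean (Suc 0) (Suc (Suc 0)) cc"
  using boolean_copy[of "Suc 0"] by simp

lemma one_pr_effect: "dom g = X \<Longrightarrow> cod f = [] \<Longrightarrow> (f || one X) >> g = f || g"
  using interchange[of f "one []" "one X" g] by simp

lemma effect_pr_one: "dom f = X \<Longrightarrow> cod g = [] \<Longrightarrow> (one X || g) >> f = f || g"
  using interchange[of "one X" f g "one []"] by simp

text \<open>With \<open>B\<close> the pair of \<open>s \<union> x\<close> (or \<open>s\<close>) and \<open>v\<close>, feedback amounts to substituting \<open>s\<close> for the traced
  wire. One inequality is yanking, the other is (B12).\<close>

lemma boolean_tr:
  fixes B :: "'a kd"
  assumes "boolean (Suc p) (Suc q) B"
  shows "boolean p q (tr [\<triangleright>] (R p) (R q) B)"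
proof -
  note cB = booleanD(1)[OF assms]
  note [simp] = boolean_typing[OF assms]
  obtain P where P: "B >> proj (Suc q) 0 = lin (Suc p) P" using booleanD(2)[OF assms, of 0] by auto
  define v where "v = B >> (kk || one (R q))"
  \<comment> \<open>Row 0 belongs to the traced wire, so input \<open>i\<close> sits in row
    \<open>Suc i\<close>. The entry \<open>P 0\<close> is a self-loop and does not affect the least
    solution, hence it is dropped.\<close>
  define s where "s = (lin p (\<lambda>i. P (Suc i)) :: 'a kd)"
  define e where "e = copy p >> (s || one (R p))"
  have kk1: "boolean (Suc n) n (kk || one (R n) :: 'a kd)" for n
    using boolean_pr[OF boolean_kk boolean_one[of n]] by simp
  have bv: "boolean (Suc p) q v" unfolding v_def by (rule boolean_sq[OF assms kk1])
  have bs: "boolean p (Suc 0) s" unfolding s_def by (rule boolean_lin)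
  have be: "boolean p (Suc p) e" unfolding e_def using boolean_sq[OF boolean_copy
    boolean_pr[OF bs boolean_one[of p]]] by simp
  note [simp] = boolean_typing[OF bv] boolean_typing[OF bs] boolean_typing[OF be]
  have b1: "boolean (Suc p) (Suc (Suc p)) (i1 || e)"
    using boolean_pr[OF boolean_one[of "Suc 0"] be] by simp
  have b2: "boolean (Suc (Suc p)) (Suc (Suc p)) (s1 || one (R p) :: 'a kd)"
    using boolean_pr[OF boolean_sy[of "Suc 0" "Suc 0"] boolean_one[of p]] by simp
  have b3: "boolean (Suc (Suc p)) (Suc q) (i1 || v)"
    using boolean_pr[OF boolean_one[of "Suc 0"] bv] by simp
  have b4: "boolean (Suc (Suc p)) (Suc (Suc p)) ((mm >> cc) || one (R p) :: 'a kd)"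
    using boolean_pr[OF boolean_sq[OF boolean_mm boolean_cc] boolean_one[of p]] by simp
  have e0: "e >> (i1 || disc p) = s"
    using copy_fst[OF booleanD(1)[OF bs] cmap_one[of p], of i1] by (simp add: e_def sq_assoc)
  have e1: "e >> (kk || one (R p)) = one (R p)"
    using copy_snd[OF booleanD(1)[OF bs] cmap_one[of p], of "one (R p)"] by (simp add: e_def sq_assoc)
  let ?r = "e >> v"
  have pB: "B = copy (Suc p) >> (lin (Suc p) P || v)"
    using pairing[of "Suc p" "Suc 0" q B] cB P by (simp add: v_def proj_def del: copy.simps)
  have proj_Suc: "proj (Suc p) (Suc i) = kk || (proj p i :: 'a kd)" for i
    by (simp add: proj_def)
  have le: "tr [\<triangleright>] (R p) (R q) B \<le> ?r"
  proof -
    \<comment> \<open>\<open>?F\<close> emits \<open>s\<close> on the loop and hands the incoming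
      loop value to \<open>v\<close>, so its loop is a bare crossing and can be yanked.
      \<open>B\<close> lies below it because leaving variables out of a union moves up in the KDA
      order.\<close>
    let ?F = "(i1 || e) >> ((s1 || one (R p)) >> (i1 || v))"
    have "lin (Suc p) P \<le> kk || s"
    proof -
      have "kk || s = (kk || one (R p)) >> s" by (simp add: one_pr_effect)
      also have "\<dots> = JN (Suc p) (map (\<lambda>i. (kk || one (R p)) >> proj p i) (filter (\<lambda>i. P (Suc i)) [0..<p]))"
        unfolding s_def by (rule cmap_lin[OF booleanD(1)[OF kk1]])
      also have "lin (Suc p) P \<le> \<dots>"
        by (rule JN_greatest[OF trm1_lin]) (auto simp: one_pr_effect simp flip: proj_Suc intro!: lin_le)
      finally show ?thesis .
    qed
    then have "B \<le> copy (Suc p) >> ((kk || s) || v)"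
      unfolding pB by (intro sq_mono[OF order_refl] pr_mono order_refl)
    also have "\<dots> = ?F"
    proof -
      have bF: "boolean (Suc p) (Suc q) ?F"
        by (rule boolean_sq[OF b1 boolean_sq[OF b2 b3]])
      have "?F >> (i1 || disc q) = kk || s"
      proof -
        have "?F >> (i1 || disc q) = (i1 || e) >> ((s1 || one (R p)) >> (i1 || (v >> disc q)))"
          by (simp add: sq_assoc interchange)
        also have "v >> disc q = kk || disc p" using cmapD(3)[OF booleanD(1)[OF bv]] by simp
        also have "(s1 || one (R p)) >> (i1 || (kk || disc p)) = (s1 >> (i1 || kk)) || (disc p :: 'a kd)"
          using interchange[of s1 "i1 || kk :: 'a kd" "one (R p)" "disc p"] by simp
        also have "s1 >> (i1 || kk) = kk || (i1 :: 'a kd)"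
          by (rule effect_slide[symmetric]) simp_all
        also have "(i1 || e) >> ((kk || i1) || disc p) = kk || (e >> (i1 || disc p))"
          by (simp add: interchange)
        finally show ?thesis by (simp only: e0)
      qed
      moreover have "?F >> (kk || one (R q)) = v"
      proof -
        have "?F >> (kk || one (R q)) = (i1 || e) >> ((s1 || one (R p)) >> (kk || v))"
          by (simp add: sq_assoc interchange)
        also have "kk || v = (kk || one (R (Suc p))) >> v" by (simp add: one_pr_effect)
        also have "(s1 || one (R p)) >> ((kk || one (R (Suc p))) >> v) = ((s1 >> (kk || i1)) || one (R p)) >> v"
          by (simp add: pr_split sq_assoc)
        also have "s1 >> (kk || i1) = i1 || (kk :: 'a kd)"
          by (rule effect_slide'[symmetric]) simp_all
        also have "(i1 || e) >> (((i1 || kk) || one (R p)) >> v) = (i1 || (e >> (kk || one (R p)))) >> v"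
          by (simp add: pr_split sq_assoc)
        finally show ?thesis by (simp add: e1)
      qed
      ultimately show ?thesis
        using pairing[of "Suc p" "Suc 0" q ?F] booleanD(1)[OF bF] by (simp del: copy.simps)
    qed
    finally have "tr [\<triangleright>] (R p) (R q) B \<le> tr [\<triangleright>] (R p) (R q) ?F" by (rule tr_mono)
    also have "\<dots> = e >> (tr [\<triangleright>] (R (Suc p)) (R (Suc p)) (s1 || one (R p)) >> v)"
      by (subst tr_post, simp_all, subst tr_pre) simp_all
    also have "tr [\<triangleright>] (R (Suc p)) (R (Suc p)) (s1 || one (R p)) = (tr [\<triangleright>] [\<triangleright>] [\<triangleright>] s1 || one (R p) :: 'a kd)"
      by (subst tr_par) simp_all
    also have "\<dots> = one (R (Suc p))" by (simp add: tr_yank)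
    finally show ?thesis by simp
  qed
  have ge: "?r \<le> tr [\<triangleright>] (R p) (R q) B"
  proof -
    \<comment> \<open>\<open>?F\<close> sends the union of the loop value and \<open>s\<close> both
      around the loop and into \<open>v\<close>, which is the shape evaluated by B12. Adding
      variables to unions moves down in the KDA order, so \<open>?F\<close> lies below
      \<open>B\<close>.\<close>
    let ?F = "(i1 || e) >> (((mm >> cc) || one (R p)) >> (i1 || v))"
    have bF: "boolean (Suc p) (Suc q) ?F"
      by (rule boolean_sq[OF b1 boolean_sq[OF b4 b3]])
    have 1: "?F >> (i1 || disc q) = (i1 || e) >> (mm || disc p)"
    proof -
      have "?F >> (i1 || disc q) = (i1 || e) >> (((mm >> cc) || one (R p)) >> (i1 || (v >> disc q)))"
        by (simp add: sq_assoc interchange)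
      also have "v >> disc q = kk || disc p" using cmapD(3)[OF booleanD(1)[OF bv]] by simp
      also have "((mm >> cc) || one (R p)) >> (i1 || (kk || disc p)) = (mm >> (cc >> (i1 || kk))) || (disc p :: 'a kd)"
        using interchange[of "mm >> cc" "i1 || kk :: 'a kd" "one (R p)" "disc p"] by (simp add: sq_assoc)
      finally show ?thesis by (simp add: B2)
    qed
    have 2: "?F >> (kk || one (R q)) = (i1 || e) >> ((mm || one (R p)) >> v)"
    proof -
      have "?F >> (kk || one (R q)) = (i1 || e) >> (((mm >> cc) || one (R p)) >> (kk || v))"
        by (simp add: sq_assoc interchange)
      also have "kk || v = (kk || one (R (Suc p))) >> v" by (simp add: one_pr_effect)
      also have "((mm >> cc) || one (R p)) >> ((kk || one (R (Suc p))) >> v) =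
        ((mm >> (cc >> (kk || i1))) || one (R p)) >> v"
        by (simp add: pr_split sq_assoc)
      finally show ?thesis by (simp add: B2')
    qed
    have w0: "(i1 || e) >> (mm || disc p) \<le> proj (Suc p) 0"
    proof -
      have "(i1 || e) >> (mm || disc p) \<le> (i1 || e) >> ((i1 || kk) || disc p)"
        by (intro sq_mono[OF order_refl] pr_mono mm_le order_refl)
      also have "\<dots> = i1 || (e >> (kk || disc p))" by (simp add: interchange)
      also have "kk || disc p = (kk || one (R p)) >> (disc p :: 'a kd)" by (simp add: one_pr_effect)
      also have "e >> ((kk || one (R p)) >> disc p) = (e >> (kk || one (R p))) >> disc p" by (simp add: sq_assoc)
      finally show ?thesis by (simp add: e1 proj_def)
    qed
    have wS: "(i1 || e) >> (mm || disc p) \<le> kk || s"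
    proof -
      have "(i1 || e) >> (mm || disc p) \<le> (i1 || e) >> ((kk || i1) || disc p)"
        by (intro sq_mono[OF order_refl] pr_mono mm_le order_refl)
      also have "\<dots> = kk || (e >> (i1 || disc p))" by (simp add: interchange)
      finally show ?thesis by (simp add: e0)
    qed
    have le1: "(i1 || e) >> (mm || disc p) \<le> lin (Suc p) P"
    proof (rule lin_greatest)
      have "cmap (Suc q) (Suc 0) (i1 || disc q :: 'a kd)"
        using cmap_pr[OF cmap_one[of "Suc 0"] cmap_disc[of q]] by simp
      from cmap_sq[OF booleanD(1)[OF bF] this] show "trm1 (Suc p) ((i1 || e) >> (mm || disc p))" by (simp only: 1)
      fix i assume i: "i < Suc p" "P i"
      show "(i1 || e) >> (mm || disc p) \<le> proj (Suc p) i"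
      proof (cases i)
        case 0
        then show ?thesis using w0 by (simp only:)
      next
        case (Suc k)
        have "kk || s \<le> kk || proj p k"
          unfolding s_def using i Suc by (intro pr_mono order_refl lin_le) simp_all
        from order_trans[OF wS this] show ?thesis by (simp only: Suc proj_Suc)
      qed
    qed
    have le2: "(i1 || e) >> ((mm || one (R p)) >> v) \<le> v"
    proof -
      have "(i1 || e) >> ((mm || one (R p)) >> v) \<le> (i1 || e) >> (((i1 || kk) || one (R p)) >> v)"
        by (intro sq_mono[OF order_refl] sq_mono[OF _ order_refl] pr_mono mm_le order_refl)
      also have "\<dots> = (i1 || (e >> (kk || one (R p)))) >> v"
        by (simp add: pr_split sq_assoc)
      finally show ?thesis by (simp add: e1)
    qed
    have "?F = copy (Suc p) >> (((i1 || e) >> (mm || disc p)) || ((i1 || e) >> ((mm || one (R p)) >> v)))"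
      using pairing[of "Suc p" "Suc 0" q ?F] booleanD(1)[OF bF] by (simp add: 1 2 del: copy.simps)
    also have "\<dots> \<le> B"
      unfolding pB by (intro sq_mono[OF order_refl] pr_mono le1 le2)
    finally have "tr [\<triangleright>] (R p) (R q) ?F \<le> tr [\<triangleright>] (R p) (R q) B" by (rule tr_mono)
    moreover have "tr [\<triangleright>] (R p) (R q) ?F = e >> (tr [\<triangleright>] (R (Suc p)) (R (Suc p)) ((mm >> cc) || one (R p)) >> v)"
      by (subst tr_post, simp_all, subst tr_pre) simp_all
    moreover have "tr [\<triangleright>] (R (Suc p)) (R (Suc p)) ((mm >> cc) || one (R p)) =
      (tr [\<triangleright>] [\<triangleright>] [\<triangleright>] (mm >> cc) || one (R p) :: 'a kd)"
      by (subst tr_par) simp_all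
    moreover have "tr [\<triangleright>] [\<triangleright>] [\<triangleright>] (mm >> cc) = (i1 :: 'a kd)"
      using B12 by (simp add: tr_def)
    ultimately show ?thesis by simp
  qed
  from antisym[OF le ge] show ?thesis
    using boolean_sq[OF be bv] by simp
qed

section \<open>Normal forms\<close>

primrec letters :: "'a list \<Rightarrow> 'a kd" where
  "letters [] = one []" | "letters (a # as) = ltr a || letters as"

lemma letters_typing [simp]: "dom (letters as) = R (length as)" "cod (letters as) = R (length as)"
  by (induction as) simp_all

lemma letters_append: "letters (as @ bs) = letters as || letters bs"
  by (induction as) simp_all

text \<open>A finite automaton: the indices below \<open>length as\<close> of the boolean matrix are states, the remaining
  rows are inputs and the remaining columns outputs. Leaving state \<open>k\<close> emits the letter \<open>as ! k\<close>.\<close>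

abbreviation "layer as p B \<equiv> (letters as || one (R p)) >> B"
abbreviation "automaton as p n B \<equiv> tr (R (length as)) (R p) (R n) (layer as p B)"

definition nf :: "nat \<Rightarrow> nat \<Rightarrow> 'a kd \<Rightarrow> bool" where
  "nf p n D \<longleftrightarrow> (\<exists>as B. boolean (length as + p) (length as + n) B \<and>
     D = automaton as p n B)"

lemma nfE:
  assumes "nf p n D"
  obtains as B where "boolean (length as + p) (length as + n) B"
    "D = automaton as p n B"
    "dom B = R (length as) @ R p" "cod B = R (length as) @ R n"
  using assms unfolding nf_def by (metis boolean_typing replicate_add)

lemma nfI:
  "boolean (length as + p) (length as + n) B \<Longrightarrow>
   D = automaton as p n B \<Longrightarrow> nf p n D"
  unfolding nf_def by blast

lemma nf_typing:
  assumes "nf p n D" shows "dom D = R p" "cod D = R n"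
proof -
  obtain as B where "boolean (length as + p) (length as + n) B"
    and D: "D = automaton as p n B"
    and [simp]: "dom B = R (length as) @ R p" "cod B = R (length as) @ R n"
    using assms by (rule nfE)
  show "dom D = R p" "cod D = R n" unfolding D by simp_all
qed

lemma nf_bool: assumes "boolean p n B" shows "nf p n B"
proof (rule nfI[of "[]"])
  note [simp] = boolean_typing[OF assms]
  show "boolean (length [] + p) (length [] + n) B" using assms by simp
  show "B = tr (R (length [])) (R p) (R n) ((letters [] || one (R p)) >> B)" by simp
qed

text \<open>A single state: the crossing leads the input into the state and the state, through its
  letter, to the output. The trace is then a yank followed by the letter.\<close>

lemma nf_letter: "nf (Suc 0) (Suc 0) (ltr a)"
proof (rule nfI[of "[a]"])
  show "boolean (length [a] + Suc 0) (length [a] + Suc 0) s1"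
    using boolean_sy[of "Suc 0" "Suc 0"] by simp
  have "(ltr a || i1) >> s1 = s1 >> (i1 || ltr a)"
    by (rule sy_natural) simp_all
  then show "ltr a = tr (R (length [a])) (R (Suc 0)) (R (Suc 0)) ((letters [a] || one (R (Suc 0))) >> s1)"
    using tr_post[of s1 "[\<triangleright>]" "[\<triangleright>]" "[\<triangleright>]" "ltr a" "[\<triangleright>]"] by (simp add: tr_yank)
qed

lemma nf_pre:
  assumes "nf p n D" "boolean p' p C"
  shows "nf p' n (C >> D)"
proof -
  obtain as B where B: "boolean (length as + p) (length as + n) B"
    and D: "D = automaton as p n B"
    and [simp]: "dom B = R (length as) @ R p" "cod B = R (length as) @ R n"
    using assms(1) by (rule nfE)
  note [simp] = boolean_typing[OF assms(2)]
  show ?thesis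
  proof (rule nfI)
    show "boolean (length as + p') (length as + n) ((one (R (length as)) || C) >> B)"
      by (rule boolean_sq[OF boolean_pr[OF boolean_one assms(2)] B])
    have "(one (R (length as)) || C) >> (layer as p B) =
       (letters as || one (R p')) >> ((one (R (length as)) || C) >> B)"
      by (simp add: interchange_seq)
    then show "C >> D = tr (R (length as)) (R p') (R n) ((letters as || one (R p')) >>
      ((one (R (length as)) || C) >> B))"
      unfolding D by (subst tr_pre) simp_all
  qed
qed

lemma nf_post:
  assumes "nf p n D" "boolean n n' C"
  shows "nf p n' (D >> C)"
proof -
  obtain as B where B: "boolean (length as + p) (length as + n) B"
    and D: "D = automaton as p n B"
    and [simp]: "dom B = R (length as) @ R p" "cod B = R (length as) @ R n"
    using assms(1) by (rule nfE)
  note [simp] = boolean_typing[OF assms(2)]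
  show ?thesis
  proof (rule nfI)
    show "boolean (length as + p) (length as + n') (B >> (one (R (length as)) || C))"
      by (rule boolean_sq[OF B boolean_pr[OF boolean_one assms(2)]])
    show "D >> C = tr (R (length as)) (R p) (R n') ((letters as || one (R p)) >> (B >> (one (R (length as)) || C)))"
      unfolding D by (subst tr_post) (simp_all add: sq_assoc)
  qed
qed

lemma nf_par_one:
  assumes "nf p n D"
  shows "nf (p + r) (n + r) (D || one (R r))"
proof -
  obtain as B where B: "boolean (length as + p) (length as + n) B"
    and D: "D = automaton as p n B"
    and [simp]: "dom B = R (length as) @ R p" "cod B = R (length as) @ R n"
    using assms(1) by (rule nfE)
  show ?thesis
  proof (rule nfI)
    show "boolean (length as + (p + r)) (length as + (n + r)) (B || one (R r))"
      using boolean_pr[OF B boolean_one[of r]] by (simp add: add.assoc)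
    show "D || one (R r) = tr (R (length as)) (R (p + r)) (R (n + r)) ((letters as || one (R (p + r))) >>
      (B || one (R r)))"
      unfolding D by (subst tr_par) (simp_all add: replicate_add pr_split)
  qed
qed

lemma nf_one_par:
  assumes "nf p n D"
  shows "nf (r + p) (r + n) (one (R r) || D)"
proof -
  have "sy (R r) (R p) >> ((D || one (R r)) >> sy (R n) (R r)) = (sy (R r) (R p) >> sy (R p) (R r)) >> (one (R r) || D)"
    using nf_typing[OF assms] sy_natural[of D "R p" "one (R r)" "R r" "R n" "R r"] by (simp add: sq_assoc del: sy_sy)
  also have "\<dots> = one (R r) || D" using nf_typing[OF assms] by simp
  finally have *: "one (R r) || D = sy (R r) (R p) >> ((D || one (R r)) >> sy (R n) (R r))" ..
  have "nf (p + r) (r + n) ((D || one (R r)) >> sy (R n) (R r))"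
    using nf_post[OF nf_par_one[OF assms], of r] boolean_sy[of n r] by (simp add: add.commute)
  from nf_pre[OF this] show ?thesis
    unfolding * using boolean_sy[of r p] by (simp add: add.commute)
qed

text \<open>The states of the composite are the disjoint union of both sets of states. Those of
  \<open>E\<close> come first because the trace of \<open>E\<close> ends up inside that of
  \<open>D\<close>, and \<open>tr_append\<close> performs the inner trace on the leading
  block.\<close>

lemma nf_sq:
  fixes D :: "'a kd"
  assumes "nf p n D" "nf n k E"
  shows "nf p k (D >> E)"
proof -
  obtain as B where B: "boolean (length as + p) (length as + n) B"
    and D: "D = automaton as p n B"
    and [simp]: "dom B = R (length as) @ R p" "cod B = R (length as) @ R n"
    using assms(1) by (rule nfE)
  let ?Q = "R (length as)"
  note [simp] = nf_typing[OF assms(2)]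
  obtain bs C where C: "boolean (length bs + (length as + n)) (length bs + (length as + k)) C"
    and E: "one ?Q || E = tr (R (length bs)) (R (length as + n)) (R (length as + k)) ((letters bs ||
      one (R (length as + n))) >> C)"
    and [simp]: "dom C = R (length bs) @ R (length as + n)" "cod C = R (length bs) @ R (length as + k)"
    using nf_one_par[OF assms(2)] by (rule nfE)
  let ?P = "R (length bs)"
  let ?K = "(letters (bs @ as) || one (R p)) >> ((one ?P || B) >> C)"
  show ?thesis
  proof (rule nfI)
    show "boolean (length (bs @ as) + p) (length (bs @ as) + k) ((one ?P || B) >> C)"
      using boolean_sq[OF boolean_pr[OF boolean_one B] C] by (simp add: add.assoc)
    have "D >> E = tr ?Q (R p) (R k) ((layer as p B) >> (one ?Q || E))"
      unfolding D by (subst tr_post) simp_all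
    also have "(layer as p B) >> (one ?Q || E) =
      tr ?P (R (length as + p)) (R (length as + k)) ((one ?P || (layer as p B)) >>
        ((letters bs || one (R (length as + n))) >> C))"
      unfolding E by (subst tr_pre) (simp_all add: replicate_add)
    also have "(one ?P || (layer as p B)) >> ((letters bs || one (R (length as + n))) >> C) = ?K"
    proof -
      let ?X = "letters as || one (R p)"
      have "(one ?P || (?X >> B)) >> ((letters bs || one (R (length as + n))) >> C) = (letters bs || (?X >> B)) >> C"
        by (subst interchange_seq) (simp_all add: replicate_add)
      moreover have "(letters bs || ?X) >> ((one ?P || B) >> C) = (letters bs || (?X >> B)) >> C"
        by (subst interchange_seq) (simp_all add: replicate_add)
      moreover have "letters (bs @ as) || one (R p) = letters bs || ?X"
        by (simp add: letters_append)
      ultimately show ?thesis by (simp only:)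
    qed
    also have "tr ?Q (R p) (R k) (tr ?P (R (length as + p)) (R (length as + k)) ?K) = tr (?P @ ?Q) (R p) (R k) ?K"
      by (subst tr_append) (simp_all add: replicate_add letters_append)
    finally show "D >> E = tr (R (length (bs @ as))) (R p) (R k) ?K"
      by (simp add: replicate_add)
  qed
qed

lemma nf_pr:
  assumes "nf p n D" "nf p' n' E"
  shows "nf (p + p') (n + n') (D || E)"
proof -
  have "D || E = (D || one (R p')) >> (one (R n) || E)"
    using nf_typing[OF assms(1)] nf_typing[OF assms(2)] by (simp add: interchange)
  then show ?thesis
    using nf_sq[OF nf_par_one[OF assms(1)] nf_one_par[OF assms(2)]] by simp
qed

text \<open>Feedback adds no states. The traced wire is moved in front of the state wires; its loop
  then involves the boolean matrix only and is evaluated by \<open>boolean_tr\<close>.\<close>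

lemma nf_tr:
  fixes D :: "'a kd"
  assumes "nf (Suc p) (Suc n) D"
  shows "nf p n (tr [\<triangleright>] (R p) (R n) D)"
proof -
  obtain as B where B: "boolean (length as + Suc p) (length as + Suc n) B"
    and D: "D = tr (R (length as)) (R (Suc p)) (R (Suc n)) ((letters as || one (R (Suc p))) >> B)"
    and B': "dom B = R (length as) @ R (Suc p)" "cod B = R (length as) @ R (Suc n)"
    using assms(1) by (rule nfE)
  let ?q = "length as"
  let ?Q = "R (length as)" and ?o = "[\<triangleright>]"
  have [simp]: "dom B = ?Q @ ?o @ R p" "cod B = ?Q @ ?o @ R n" using B' by simp_all
  define F where "F = (letters as || one (R (Suc p))) >> B"
  have [simp]: "dom F = ?Q @ ?o @ R p" "cod F = ?Q @ ?o @ R n" by (simp_all add: F_def)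
  define C where "C = (sy ?o ?Q || one (R p)) >> B >> (sy ?Q ?o || one (R n))"
  have [simp]: "dom C = ?o @ ?Q @ R p" "cod C = ?o @ ?Q @ R n" by (simp_all add: C_def)
  have C: "boolean (Suc (?q + p)) (Suc (?q + n)) C"
    unfolding C_def
  proof (intro boolean_sq)
    show "boolean (Suc (?q + p)) (?q + Suc p) (sy ?o ?Q || one (R p) :: 'a kd)"
      using boolean_pr[OF boolean_sy[of "Suc 0" ?q] boolean_one[of p]] by simp
    show "boolean (?q + Suc n) (Suc (?q + n)) (sy ?Q ?o || one (R n) :: 'a kd)"
      using boolean_pr[OF boolean_sy[of ?q "Suc 0"] boolean_one[of n]] by simp
  qed (rule B)
  let ?G = "((sy ?o ?Q || one (R p)) >> F) >> (sy ?Q ?o || one (R n))"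
  have G: "?G = (i1 || (letters as || one (R p))) >> C"
  proof -
    have "(sy ?o ?Q || one (R p)) >> (letters as || one (R (Suc p))) = (sy ?o ?Q >> (letters as || i1)) || one (R p)"
      by (simp add: pr_split)
    also have "sy ?o ?Q >> (letters as || i1) = (i1 || letters as) >> sy ?o ?Q"
      by (rule sy_natural[symmetric]) simp_all
    finally have "(sy ?o ?Q || one (R p)) >> (letters as || one (R (Suc p))) =
      (i1 || (letters as || one (R p))) >> (sy ?o ?Q || one (R p))"
      by (simp add: pr_split)
    then have "((sy ?o ?Q || one (R p)) >> (letters as || one (R (Suc p)))) >> (B >> (sy ?Q ?o || one (R n))) =
       ((i1 || (letters as || one (R p))) >> (sy ?o ?Q || one (R p))) >> (B >> (sy ?Q ?o || one (R n)))"
      by (simp only:)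
    then show ?thesis
      unfolding F_def C_def by (simp add: sq_assoc)
  qed
  have "tr ?o (R p) (R n) D = tr (?Q @ ?o) (R p) (R n) F"
    unfolding D F_def[symmetric] by (subst tr_append) simp_all
  \<comment> \<open>Inserting a crossing and its inverse gives \<open>tr_slide\<close> something to
    carry around the loop, which reorders the traced wires.\<close>
  also have "F = (F >> (sy ?Q ?o || one (R n))) >> (sy ?o ?Q || one (R n))"
    by (simp add: sq_assoc interchange)
  also have "tr (?Q @ ?o) (R p) (R n) ((F >> (sy ?Q ?o || one (R n))) >> (sy ?o ?Q || one (R n))) =
     tr (?o @ ?Q) (R p) (R n) ((sy ?o ?Q || one (R p)) >> (F >> (sy ?Q ?o || one (R n))))"
    by (rule tr_slide[symmetric]) simp_all
  also have "(sy ?o ?Q || one (R p)) >> (F >> (sy ?Q ?o || one (R n))) = ?G"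
    by (simp add: sq_assoc)
  also have "tr (?o @ ?Q) (R p) (R n) ?G = tr ?Q (R p) (R n) (tr ?o (?Q @ R p) (?Q @ R n)
    ((i1 || (letters as || one (R p))) >> C))"
    unfolding G by (subst tr_append) simp_all
  also have "tr ?o (?Q @ R p) (?Q @ R n) ((i1 || (letters as || one (R p))) >> C) =
     (letters as || one (R p)) >> tr ?o (?Q @ R p) (?Q @ R n) C"
    by (rule tr_pre[symmetric]) simp_all
  finally show ?thesis
    using boolean_tr[OF C] by (intro nfI) (simp_all add: replicate_add)
qed

lemma append_eq_replicateE:
  assumes "xs @ ys = replicate n x"
  obtains i j where "n = i + j" "xs = replicate i x" "ys = replicate j x"
proof -
  have "\<forall>y\<in>set (xs @ ys). y = x" unfolding assms by simp
  then have "replicate (length xs) x = xs" "replicate (length ys) x = ys"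
    by (simp_all add: replicate_length_same)
  moreover have "n = length xs + length ys" using arg_cong[OF assms, of length] by simp
  ultimately show ?thesis by (intro that[of "length xs" "length ys"]) simp_all
qed

lemma struct_boolean:
  fixes f :: "'a kd"
  assumes "struct f" "dom f = R n"
  shows "boolean n n f"
  using assms
proof (induction arbitrary: n rule: struct.induct)
  case (one X)
  then show ?case using boolean_one by simp
next
  case (sy X Y)
  then have "X @ Y = R n" by simp
  then obtain i j where "n = i + j" "X = R i" "Y = R j" by (rule append_eq_replicateE)
  then show ?case using boolean_sy by simp
next
  case (sq f g)
  then have f: "boolean n n f" by simp
  then have "boolean n n g" using sq.IH(2)[of n] sq.hyps boolean_typing[OF f] by simp
  with f show ?case by (rule boolean_sq)
next
  case (pr f g)
  then have "dom f @ dom g = R n" by simp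
  then obtain i j where ij: "n = i + j" "dom f = R i" "dom g = R j" by (rule append_eq_replicateE)
  then show ?case using boolean_pr[OF pr.IH(1)[OF ij(2)] pr.IH(2)[OF ij(3)]] by simp
qed

text \<open>In an effect the backward wires act as outputs. \<open>\<pi>\<close> sorts them to the
  front, \<open>D\<close> runs on the forward wires, and caps join the outputs of \<open>D\<close>
  to the backward wires, so all of the content lies in a forward automaton.\<close>

definition fwd_effect :: "obj \<Rightarrow> 'a kd \<Rightarrow> bool" where
  "fwd_effect V \<phi> \<longleftrightarrow> (\<exists>\<pi> n p D. struct \<pi> \<and> dom \<pi> = V \<and> cod \<pi> = L n @ R p \<and> nf p n D \<and>
     \<phi> = \<pi> >> ((one (L n) || D) >> ev (R n)))"

lemma fwd_effectI:
  "struct \<pi> \<Longrightarrow> dom \<pi> = V \<Longrightarrow> cod \<pi> = L n @ R p \<Longrightarrow> nf p n D \<Longrightarrow>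
     \<phi> = \<pi> >> ((one (L n) || D) >> ev (R n)) \<Longrightarrow> fwd_effect V \<phi>"
  unfolding fwd_effect_def by blast

lemma fwd_effectE:
  assumes "fwd_effect V \<phi>"
  obtains \<pi> n p D where "struct \<pi>" "dom \<pi> = V" "cod \<pi> = L n @ R p" "nf p n D"
     "\<phi> = \<pi> >> ((one (L n) || D) >> ev (R n))" "dom D = R p" "cod D = R n"
  using assms unfolding fwd_effect_def by (metis nf_typing)

lemma fwd_effect_typing: assumes "fwd_effect V \<phi>" shows "dom \<phi> = V" "cod \<phi> = []"
proof -
  obtain \<pi> n p D where *: "struct \<pi>" "dom \<pi> = V" "cod \<pi> = L n @ R p" "nf p n D"
     "\<phi> = \<pi> >> ((one (L n) || D) >> ev (R n))" "dom D = R p" "cod D = R n"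
    using assms by (rule fwd_effectE)
  show "dom \<phi> = V" "cod \<phi> = []" unfolding *(5) using *(2,3,6,7) by simp_all
qed

lemma fwd_effect_struct:
  assumes "fwd_effect V \<phi>" "struct \<rho>" "cod \<rho> = V" "dom \<rho> = V'"
  shows "fwd_effect V' (\<rho> >> \<phi>)"
proof -
  obtain \<pi> n p D where *: "struct \<pi>" "dom \<pi> = V" "cod \<pi> = L n @ R p" "nf p n D"
     "\<phi> = \<pi> >> ((one (L n) || D) >> ev (R n))" "dom D = R p" "cod D = R n"
    using assms(1) by (rule fwd_effectE)
  show ?thesis
  proof (rule fwd_effectI)
    show "struct (\<rho> >> \<pi>)" using assms(2,3) *(1,2) by (intro struct.sq) simp_all
    show "\<rho> >> \<phi> = (\<rho> >> \<pi>) >> ((one (L n) || D) >> ev (R n))"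
      unfolding *(5) using assms(3) *(2,3,6,7) by (simp add: sq_assoc)
  qed (use assms(3,4) * in simp_all)
qed

text \<open>After permuting \<open>W\<close> past \<open>U\<close>, the two effects stand side by
  side and their automata are combined by \<open>nf_pr\<close>; it remains to merge the two sorting
  permutations into one.\<close>

lemma fwd_effect_nest:
  fixes \<phi> :: "'a kd"
  assumes "fwd_effect (U @ V) \<phi>" "fwd_effect W \<psi>"
  shows "fwd_effect (U @ W @ V) ((one U || \<psi> || one V) >> \<phi>)"
proof -
  obtain \<pi> n p D where *: "struct \<pi>" "dom \<pi> = U @ V" "cod \<pi> = L n @ R p" "nf p n D"
     "\<phi> = \<pi> >> ((one (L n) || D) >> ev (R n))" "dom D = R p" "cod D = R n"
    using assms(1) by (rule fwd_effectE)
  obtain \<rho> m q E where r: "struct \<rho>" "dom \<rho> = W" "cod \<rho> = L m @ R q" "nf q m E"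
     "\<psi> = \<rho> >> ((one (L m) || E) >> ev (R m))" "dom E = R q" "cod E = R m"
    using assms(2) by (rule fwd_effectE)
  note [simp] = *(2,3,6,7) r(2,3,6,7)
  \<comment> \<open>The last crossing collects all backward wires. Those of \<open>\<pi>\<close>
    come first, since the duals of the outputs \<open>R m @ R n\<close> of \<open>E || D\<close>
    appear in reverse order.\<close>
  let ?\<sigma> = "(sy U W || one V) >> ((\<rho> || \<pi>) >> (sy (L m @ R q) (L n) || one (R p)))"
  have c: "L (m + n) = L n @ L m" by (simp flip: replicate_add add: add.commute)
  have sl: "one U || \<psi> = sy U W >> (\<psi> || one U)"
    by (rule effect_slide') (simp_all add: fwd_effect_typing[OF assms(2)])
  note [simp] = fwd_effect_typing[OF assms(2)]
  have "(one U || \<psi> || one V) >> \<phi> = ((one U || \<psi>) || one V) >> \<phi>" by simp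
  also have "\<dots> = (sy U W || one V) >> ((\<psi> || one (U @ V)) >> \<phi>)"
    unfolding sl using fwd_effect_typing[OF assms(1)] by (simp add: pr_sq_one sq_assoc)
  also have "(\<psi> || one (U @ V)) >> \<phi> = \<psi> || \<phi>"
    using fwd_effect_typing[OF assms(1)] by (simp add: one_pr_effect)
  also have "\<psi> || \<phi> = (\<rho> || \<pi>) >> ((one (L m) || E || (one (L n) || D)) >> (ev (R m) || ev (R n)))"
  proof -
    have "\<psi> || \<phi> = (\<rho> || \<pi>) >> (((one (L m) || E) >> ev (R m)) || ((one (L n) || D) >> ev (R n)))"
      unfolding *(5) r(5) by (subst interchange) simp_all
    also have "((one (L m) || E) >> ev (R m)) || ((one (L n) || D) >> ev (R n)) =
       ((one (L m) || E) || (one (L n) || D)) >> (ev (R m) || ev (R n))"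
      by (subst interchange) simp_all
    finally show ?thesis by simp
  qed
  also have "ev (R m) || ev (R n) = (sy (L m @ R m) (L n) || one (R n)) >> (ev (R (m + n)) :: 'a kd)"
  proof -
    have "ev (R m) || ev (R n) = ((ev (R m) || one (L n)) || one (R n)) >> (ev (R n) :: 'a kd)"
      by (simp add: one_pr_effect)
    also have "ev (R m) || one (L n) = sy (L m @ R m) (L n) >> (one (L n) || (ev (R m) :: 'a kd))"
      by (rule effect_slide) simp_all
    finally show ?thesis
      by (simp add: replicate_add ev_append pr_sq_one sq_assoc)
  qed
  also have "(one (L m) || E || (one (L n) || D)) >> ((sy (L m @ R m) (L n) || one (R n)) >> ev (R (m + n))) =
     (sy (L m @ R q) (L n) || one (R p)) >> ((one (L (m + n)) || (E || D)) >> ev (R (m + n)))"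
  proof -
    have "(one (L m) || E || (one (L n) || D)) >> (sy (L m @ R m) (L n) || one (R n)) =
       (((one (L m) || E) || one (L n)) >> sy (L m @ R m) (L n)) || D"
      using interchange[of "(one (L m) || E) || one (L n)" "sy (L m @ R m) (L n)" D "one (R n)"] by simp
    also have "((one (L m) || E) || one (L n)) >> sy (L m @ R m) (L n) =
      sy (L m @ R q) (L n) >> (one (L n) || (one (L m) || E))"
      by (rule sy_natural) simp_all
    also have "(sy (L m @ R q) (L n) >> (one (L n) || (one (L m) || E))) || D =
       (sy (L m @ R q) (L n) || one (R p)) >> (one (L (m + n)) || (E || D))"
      using interchange[of "sy (L m @ R q) (L n)" "one (L n) || (one (L m) || E)" "one (R p)" D] by (simp add: c)
    finally have e: "(one (L m) || E || (one (L n) || D)) >> (sy (L m @ R m) (L n) || one (R n)) =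
       (sy (L m @ R q) (L n) || one (R p)) >> (one (L (m + n)) || (E || D))" .
    have t: "cod (one (L m) || E || (one (L n) || D)) = dom (sy (L m @ R m) (L n) || (one (R n) :: 'a kd))"
      "cod (sy (L m @ R m) (L n) || (one (R n) :: 'a kd)) = dom (ev (R (m + n)) :: 'a kd)"
      "cod (sy (L m @ R q) (L n) || (one (R p) :: 'a kd)) = dom (one (L (m + n)) || (E || D))"
      "cod (one (L (m + n)) || (E || D)) = dom (ev (R (m + n)) :: 'a kd)"
      by (simp_all add: c replicate_add[of m n \<triangleright>])
    show ?thesis
      by (simp only: sq_assoc[OF t(1,2), symmetric] e sq_assoc[OF t(3,4)])
  qed
  also have "(sy U W || one V) >> ((\<rho> || \<pi>) >> ((sy (L m @ R q) (L n) || one (R p)) >>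
    ((one (L (m + n)) || (E || D)) >> ev (R (m + n))))) =
     ?\<sigma> >> ((one (L (m + n)) || (E || D)) >> ev (R (m + n)))"
    by (simp add: c replicate_add[of m n \<triangleright>] sq_assoc)
  finally have eq: "(one U || \<psi> || one V) >> \<phi> = ?\<sigma> >> ((one (L (m + n)) || (E || D)) >> ev (R (m + n)))" .
  show ?thesis
  proof (rule fwd_effectI[OF _ _ _ _ eq])
    show "struct ?\<sigma>" by (intro struct.intros * r) simp_all
    show "nf (q + p) (m + n) (E || D)" by (rule nf_pr[OF r(4) *(4)])
  qed (simp_all add: replicate_add[of _ _ \<triangleright>] c)
qed

lemma LR_split_R:
  assumes "L n @ R p = U @ [\<triangleright>] @ V"
  shows "\<exists>a b. p = Suc (a + b) \<and> U = L n @ R a \<and> V = R b"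
  using assms
proof (induction n arbitrary: U)
  case 0
  have "U @ ([\<triangleright>] @ V) = R p" using 0 by simp
  then obtain a k where a: "p = a + k" "U = R a" "[\<triangleright>] @ V = R k" by (rule append_eq_replicateE)
  then obtain b where "k = Suc b" "V = R b" by (cases k) simp_all
  then show ?case using a by (intro exI[of _ a] exI[of _ b]) simp
next
  case (Suc n)
  then obtain U' where U: "U = \<triangleleft> # U'" by (cases U) simp_all
  then have "L n @ R p = U' @ [\<triangleright>] @ V" using Suc.prems by simp
  from Suc.IH[OF this] U show ?case by simp
qed

text \<open>A permutation of the sorted wires is absorbed by the automaton: \<open>s\<close> acts on
  the inputs directly, while \<open>r\<close> passes through the caps and arrives at the outputs as
  its transpose \<open>r'\<close>.\<close>

lemma absorb_transpose:
  fixes D :: "'a kd"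
  assumes "dom r = A" "cod r = A" "dom s = B" "cod s = B" "dom D = B" "cod D = dual A"
    "dom r' = dual A" "cod r' = dual A"
    "(r || one (dual A)) >> ev (dual A) = (one A || r') >> ev (dual A)"
  shows "(r || s) >> ((one A || D) >> ev (dual A)) = (one A || ((s >> D) >> r')) >> ev (dual A)"
proof -
  note [simp] = assms(1-8)
  have "(r || s) >> ((one A || D) >> ev (dual A)) = (r || (s >> D)) >> ev (dual A)"
    by (subst interchange_seq) simp_all
  also have "r || (s >> D) = (one A || (s >> D)) >> (r || one (dual A))"
    by (subst interchange) simp_all
  also have "\<dots> >> ev (dual A) = (one A || (s >> D)) >> ((r || one (dual A)) >> ev (dual A))"
    by (rule sq_assoc) simp_all
  also have "\<dots> = ((one A || (s >> D)) >> (one A || r')) >> ev (dual A)"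
    unfolding assms(9) by (rule sq_assoc[symmetric]) simp_all
  also have "(one A || (s >> D)) >> (one A || r') = one A || ((s >> D) >> r')"
    by (subst interchange) simp_all
  finally show ?thesis .
qed

lemma sq_assoc3:
  "cod a = dom b \<Longrightarrow> cod b = dom c \<Longrightarrow> cod c = dom d \<Longrightarrow> (a >> (b >> c)) >> d = a >> (b >> (c >> d))"
  by (simp add: sq_assoc)

text \<open>Joining an input of \<open>D\<close> by a cup to the backward wire that is capped with
  an output closes a feedback loop. The crossing after \<open>D\<close> puts the looped output last,
  where its cap is outermost and so meets the first backward wire.\<close>

lemma cup_trace:
  fixes D :: "'a kd"
  assumes "dom D = [\<triangleright>] @ M" "cod D = [\<triangleright>] @ Y"
  shows "(cu || one (dual Y @ M)) >> ((l1 || sy [\<triangleright>] (dual Y) || one M) >>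
     ((one ([\<triangleleft>] @ dual Y) || (D >> sy [\<triangleright>] Y)) >> ev (Y @ [\<triangleright>]))) =
     (one (dual Y) || tr [\<triangleright>] M Y D) >> ev Y"
proof -
  let ?r = "[\<triangleright>]" and ?l = "[\<triangleleft>]" and ?Z = "dual Y"
  note [simp] = assms
  have "(one (?l @ ?Z) || (D >> sy ?r Y)) >> ev (Y @ ?r) =
     (one (?l @ ?Z) || D) >> ((l1 || ((one ?Z || sy ?r Y) >> (ev Y || i1))) >> ca)"
    by (simp add: ev_append one_pr_sq sq_assoc)
  also have "(one ?Z || sy ?r Y) >> (ev Y || i1) = (sy ?Z ?r || one Y) >> (i1 || (ev Y :: 'a kd))"
    by (rule effect_past) simp_all
  also have "(l1 || ((sy ?Z ?r || one Y) >> (i1 || ev Y))) >> ca = (l1 || sy ?Z ?r || one Y) >> (ca || (ev Y :: 'a kd))"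
    using effect_pr_one[of "ca :: 'a kd" "[\<triangleleft>,\<triangleright>]" "ev Y"] by (simp add: one_pr_sq sq_assoc)
  finally have 1: "(one (?l @ ?Z) || (D >> sy ?r Y)) >> ev (Y @ ?r) =
     (one (?l @ ?Z) || D) >> ((l1 || sy ?Z ?r || one Y) >> (ca || ev Y))" .
  have 2: "one (?l @ ?Z) || D = (sy ?l ?Z || one (?r @ M)) >> ((one (?Z @ ?l) || D) >> (sy ?Z ?l || one (?r @ Y)))"
  proof -
    have "(sy ?l ?Z || one (?r @ M)) >> ((one (?Z @ ?l) || D) >> (sy ?Z ?l || one (?r @ Y))) =
      (sy ?l ?Z >> sy ?Z ?l) || D"
      using interchange[of "one (?Z @ ?l)" "sy ?Z ?l" D "one (?r @ Y)"] interchange[of "sy ?l ?Z" "sy ?Z ?l"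
        "one (?r @ M)" D] by simp
    then show ?thesis by simp
  qed
  have 3: "(one ?Z || ca) = ((sy ?Z ?l || i1) >> (l1 || sy ?Z ?r)) >> (ca || (one ?Z :: 'a kd))"
    unfolding hexagon[symmetric] by (rule effect_slide') simp_all
  have 4: "(one ?Z || cu) = (cu || (one ?Z :: 'a kd)) >> ((l1 || sy ?r ?Z) >> (sy ?l ?Z || i1))"
    unfolding hexagon'[symmetric] by (rule state_slide[symmetric]) simp_all
  have 5: "one ?Z || tr ?r M Y D = ((one ?Z || cu) || one M) >> ((one (?Z @ ?l) || D) >> ((one ?Z || ca) || one Y))"
  proof -
    have "tr ?r M Y D = (cu || one M) >> ((l1 || D) >> (ca || one Y))"
      by (simp add: tr_def sq_assoc)
    then show ?thesis by (simp add: one_pr_sq)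
  qed
  have "(one ?Z || tr ?r M Y D) >> ev Y = ((one ?Z || cu) || one M) >> ((one (?Z @ ?l) || D) >>
    (((one ?Z || ca) || one Y) >> ev Y))"
    unfolding 5 by (rule sq_assoc3) simp_all
  also have "((one ?Z || ca) || one Y) >> ev Y = (sy ?Z ?l || one (?r @ Y)) >> ((l1 || sy ?Z ?r || one Y) >>
    (ca || (ev Y :: 'a kd)))"
  proof -
    have e: "(one ?Z || ca) || one Y = (sy ?Z ?l || one (?r @ Y)) >> ((l1 || sy ?Z ?r || one Y) >>
      (ca || (one (?Z @ Y) :: 'a kd)))"
      unfolding 3 by (simp add: pr_sq_one sq_assoc)
    have f: "(ca || one (?Z @ Y)) >> ev Y = ca || (ev Y :: 'a kd)"
      by (rule one_pr_effect) simp_all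
    show ?thesis unfolding e f[symmetric] by (rule sq_assoc3) simp_all
  qed
  also have "(one ?Z || cu) || one M = (cu || one (?Z @ M)) >> ((l1 || sy ?r ?Z || one M) >>
    (sy ?l ?Z || (one (?r @ M) :: 'a kd)))"
    unfolding 4 by (simp add: pr_sq_one sq_assoc)
  finally have "(one ?Z || tr ?r M Y D) >> ev Y = ((cu || one (?Z @ M)) >> ((l1 || sy ?r ?Z || one M) >>
     (sy ?l ?Z || one (?r @ M)))) >> ((one (?Z @ ?l) || D) >> ((sy ?Z ?l || one (?r @ Y)) >>
       ((l1 || sy ?Z ?r || one Y) >> (ca || ev Y))))" .
  also have "\<dots> = (cu || one (?Z @ M)) >> ((l1 || sy ?r ?Z || one M) >>
     ((sy ?l ?Z || one (?r @ M)) >> ((one (?Z @ ?l) || D) >> ((sy ?Z ?l || one (?r @ Y)) >>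
       ((l1 || sy ?Z ?r || one Y) >> (ca || ev Y))))))"
    by (rule sq_assoc3) simp_all
  also have "\<dots> = (cu || one (?Z @ M)) >> ((l1 || sy ?r ?Z || one M) >>
     ((one (?l @ ?Z) || D) >> ((l1 || sy ?Z ?r || one Y) >> (ca || ev Y))))"
  proof -
    have "(one (?l @ ?Z) || D) >> g = (sy ?l ?Z || one (?r @ M)) >> ((one (?Z @ ?l) || D) >>
      ((sy ?Z ?l || one (?r @ Y)) >> g))"
      if "dom g = ?l @ ?Z @ ?r @ Y" for g :: "'a kd"
      unfolding 2 using that by (intro sq_assoc3) simp_all
    from this[of "(l1 || sy ?Z ?r || one Y) >> (ca || ev Y)"] show ?thesis by simp
  qed
  finally show ?thesis unfolding 1 ..
qed

text \<open>Two uses of \<open>struct_factor\<close> locate the ends of the cup inside the sorting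
  permutation and bring each to the front of its block. What is left of the permutation is absorbed
  into the automaton, and the cup becomes a trace, handled by \<open>nf_tr\<close>.\<close>

lemma fwd_effect_cup:
  fixes \<phi> :: "'a kd"
  assumes "fwd_effect (U @ [\<triangleleft>, \<triangleright>] @ V) \<phi>"
  shows "fwd_effect (U @ V) ((one U || cu || one V) >> \<phi>)"
proof -
  obtain \<pi> n p D where *: "struct \<pi>" "dom \<pi> = U @ [\<triangleleft>, \<triangleright>] @ V" "cod \<pi> = L n @ R p" "nf p n D"
     "\<phi> = \<pi> >> ((one (L n) || D) >> ev (R n))" "dom D = R p" "cod D = R n"
    using assms(1) by (rule fwd_effectE)
  let ?l = "[\<triangleleft>]" and ?r = "[\<triangleright>]"
  note [simp] = *(2,3,6,7)
  \<comment> \<open>Sliding the cup in front of \<open>U\<close> adds this crossing; afterwards its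
    two wires are the leading ones.\<close>
  define \<pi>1 where "\<pi>1 = (sy [\<triangleleft>, \<triangleright>] U || one V) >> \<pi>"
  have p1: "struct \<pi>1" "dom \<pi>1 = [] @ ?l @ (?r @ U @ V)" "cod \<pi>1 = L n @ R p"
    unfolding \<pi>1_def by (auto intro!: struct.intros *)
  from struct_factor[OF p1(1,2)] obtain U1 V1 g where g: "cod \<pi>1 = U1 @ ?l @ V1" "struct g"
    "dom g = [] @ ?r @ (U @ V)" "cod g = U1 @ V1"
    "(sy ?l [] || one (?r @ U @ V)) >> \<pi>1 = (one ?l || g) >> (sy ?l U1 || one V1)" by auto
  from LR_split[of n p U1 V1] g(1) p1(3) obtain i j where ij: "n = Suc (i + j)" "U1 = L i" "V1 = L j @ R p" by auto
  from struct_factor[OF g(2,3)] obtain U2 V2 h where h: "cod g = U2 @ ?r @ V2" "struct h"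
    "dom h = U @ V" "cod h = U2 @ V2"
    "(sy ?r [] || one (U @ V)) >> g = (one ?r || h) >> (sy ?r U2 || one V2)" by auto
  have "L (i + j) @ R p = U2 @ ?r @ V2" using h(1) g(4) ij by (simp add: replicate_add)
  from LR_split_R[OF this] obtain a b where ab: "p = Suc (a + b)" "U2 = L (i + j) @ R a" "V2 = R b" by auto
  define N where "N = i + j"
  define m where "m = a + b"
  define \<rho>1 where "\<rho>1 = (sy ?l (L i) || one (L j) :: 'a kd)"
  define \<rho>2 where "\<rho>2 = (sy ?r (R a) || one (R b) :: 'a kd)"
  have n: "n = Suc N" and p: "p = Suc m" using ij(1) ab(1) by (simp_all add: N_def m_def)
  have LN: "L N = L i @ L j" and Rm: "R m = R a @ R b" by (simp_all add: N_def m_def replicate_add)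
  have r1: "struct \<rho>1" "dom \<rho>1 = ?l @ L N" "cod \<rho>1 = ?l @ L N"
    by (auto simp: \<rho>1_def LN replicate_app_Cons_same intro: struct.intros)
  have r2: "struct \<rho>2" "dom \<rho>2 = ?r @ R m" "cod \<rho>2 = ?r @ R m"
    by (auto simp: \<rho>2_def Rm replicate_app_Cons_same intro: struct.intros)
  have h': "dom h = U @ V" "cod h = L N @ R m" using h(3,4) ab by (simp_all add: N_def Rm)
  note [simp] = r1(2,3) r2(2,3) h'
  have pi1: "\<pi>1 = (one [\<triangleleft>, \<triangleright>] || h) >> ((one ?l || sy ?r (L N) || one (R m)) >> (\<rho>1 || \<rho>2))"
  proof -
    have t: "dom \<pi>1 = ?l @ ?r @ U @ V" "dom g = ?r @ U @ V" using p1(2) g(3) by simp_all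
    have "g = (one ?r || h) >> (sy ?r (L N @ R a) || one (R b))"
      using h(5) t(2) ab by (simp add: N_def)
    also have "sy ?r (L N @ R a) = (sy ?r (L N) || one (R a)) >> (one (L N) || (sy ?r (R a) :: 'a kd))"
      by (rule hexagon)
    finally have g': "g = (one ?r || h) >> ((sy ?r (L N) || one (R m)) >> (one (L N) || \<rho>2))"
      by (simp only:) (simp add: \<rho>2_def Rm pr_sq_one sq_assoc)
    have "\<pi>1 = (one ?l || g) >> (sy ?l (L i) || one (L j @ R p))"
      using g(5) t(1) ij by simp
    also have "sy ?l (L i) || one (L j @ R p) = \<rho>1 || (one (?r @ R m) :: 'a kd)"
      by (simp add: \<rho>1_def p)
    also have "(one ?l || g) >> (\<rho>1 || one (?r @ R m)) =
      (one [\<triangleleft>, \<triangleright>] || h) >> ((one ?l || sy ?r (L N) || one (R m)) >> ((one (?l @ L N) || \<rho>2) >> (\<rho>1 || one (?r @ R m))))"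
      unfolding g' by (simp add: one_pr_sq sq_assoc replicate_app_Cons_same)
    also have "(one (?l @ L N) || \<rho>2) >> (\<rho>1 || one (?r @ R m)) = \<rho>1 || \<rho>2"
      by (subst interchange) simp_all
    finally show ?thesis .
  qed
  from struct_transpose[OF r1(1)] obtain \<rho>' where r': "struct \<rho>'" "dom \<rho>' = R n" "cod \<rho>' = R n"
    "(\<rho>1 || one (R n)) >> ev (R n) = (one (L n) || \<rho>') >> ev (R n)"
    by (auto simp: n replicate_app_Cons_same simp flip: replicate_Suc)
  note [simp] = r'(2,3)
  \<comment> \<open>\<open>\<rho>2\<close> permutes the inputs of \<open>D\<close>;
    \<open>\<rho>1\<close> acts on the backward wires and reaches the outputs as the transpose
    \<open>\<rho>'\<close>.\<close>
  define D1 where "D1 = (\<rho>2 >> D) >> \<rho>'"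
  have D1: "nf p n D1"
    unfolding D1_def by (intro nf_post[OF nf_pre[OF *(4)]] struct_boolean r2 r') (simp_all add: p)
  have t: "dom D1 = ?r @ R m" "cod D1 = R N @ ?r" using nf_typing[OF D1] by (simp_all add: n p replicate_app_Cons_same)
  \<comment> \<open>The first backward wire is capped with the last output; this crossing moves that
    output to the front, where it is fed back.\<close>
  define D2 where "D2 = D1 >> sy (R N) ?r"
  have D2: "nf (Suc m) (Suc N) D2"
    unfolding D2_def using nf_post[OF D1, of "Suc N"] boolean_sy[of N "Suc 0"] by (simp add: n p)
  have t2: "dom D2 = ?r @ R m" "cod D2 = ?r @ R N" using nf_typing[OF D2] by simp_all
  note [simp] = t t2
  have D12: "D1 = D2 >> sy ?r (R N)" by (simp add: D2_def sq_assoc)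
  let ?T = "tr ?r (R m) (R N) D2"
  have [simp]: "dom ?T = R m" "cod ?T = R N" by simp_all
  have "(one U || cu || one V) >> \<phi> = (((cu || one U) >> sy [\<triangleleft>, \<triangleright>] U) || one V) >> \<phi>"
    by (subst state_slide) simp_all
  also have "\<dots> = (cu || one (U @ V)) >> (\<pi>1 >> ((one (L n) || D) >> ev (R n)))"
    unfolding *(5) \<pi>1_def by (simp add: pr_sq_one sq_assoc)
  also have "\<pi>1 >> ((one (L n) || D) >> ev (R n)) = (one [\<triangleleft>, \<triangleright>] || h) >> ((one ?l || sy ?r (L N) || one (R m)) >>
     ((\<rho>1 || \<rho>2) >> ((one (L n) || D) >> ev (R n))))"
    unfolding pi1 by (simp add: n p sq_assoc replicate_app_Cons_same)
  also have "(\<rho>1 || \<rho>2) >> ((one (L n) || D) >> ev (R n)) = (one (?l @ L N) || D1) >> ev (R N @ ?r)"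
    using absorb_transpose[of \<rho>1 "L n" \<rho>2 "R p" D \<rho>'] r'(4) unfolding D1_def
    by (simp add: n p replicate_app_Cons_same)
  also have "(cu || one (U @ V)) >> ((one [\<triangleleft>, \<triangleright>] || h) >> ((one ?l || sy ?r (L N) || one (R m)) >>
     ((one (?l @ L N) || D1) >> ev (R N @ ?r)))) =
     h >> ((cu || one (L N @ R m)) >> ((one ?l || sy ?r (L N) || one (R m)) >>
     ((one (?l @ L N) || D1) >> ev (R N @ ?r))))" (is "?a >> (?b >> ?c) = h >> (?d >> ?c)")
  proof -
    have e: "?a >> ?b = h >> ?d"
      using interchange[of cu "one [\<triangleleft>, \<triangleright>]" "one (U @ V)" h] interchange[of "one []" cu h "one (L N @ R m)"] by simp
    have "dom ?c = [\<triangleleft>, \<triangleright>] @ L N @ R m" by (simp add: replicate_app_Cons_same)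
    then have "?a >> (?b >> ?c) = (?a >> ?b) >> ?c" "h >> (?d >> ?c) = (h >> ?d) >> ?c"
      by (simp_all add: sq_assoc)
    with e show ?thesis by (simp only:)
  qed
  also have "?d >> ?c = (one (L N) || ?T) >> ev (R N)"
    using cup_trace[of D2 "R m" "R N"] by (simp add: D12)
  finally have "(one U || cu || one V) >> \<phi> = h >> ((one (L N) || ?T) >> ev (R N))" .
  then show ?thesis
    by (rule fwd_effectI[OF h(2) h' nf_tr[OF D2]])
qed

lemma fwd_effect_co1:
  fixes \<phi> :: "'a kd"
  assumes "fwd_effect (U @ [flip w, w] @ V) \<phi>"
  shows "fwd_effect (U @ V) ((one U || co1 w || one V) >> \<phi>)"
proof (cases w)
  case Fwd
  then show ?thesis using fwd_effect_cup[of U V \<phi>] assms by simp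
next
  case Bwd
  note [simp] = fwd_effect_typing[OF assms]
  let ?s = "one U || sy [\<triangleleft>] [\<triangleright>] || one V :: 'a kd"
  have "struct ?s" by (intro struct.intros)
  then have "fwd_effect (U @ [\<triangleleft>, \<triangleright>] @ V) (?s >> \<phi>)"
    by (rule fwd_effect_struct[OF assms]) (simp_all add: Bwd)
  from fwd_effect_cup[OF this] show ?thesis
    by (simp add: Bwd one_pr_sq_one sq_assoc)
qed

lemma fwd_effect_co:
  fixes \<phi> :: "'a kd"
  assumes "fwd_effect (U @ dual Y @ Y @ V) \<phi>"
  shows "fwd_effect (U @ V) ((one U || co Y || one V) >> \<phi>)"
  using assms
proof (induction Y arbitrary: \<phi>)
  case Nil
  then show ?case using fwd_effect_typing[OF Nil] by simp
next
  case (Cons w Y)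
  note [simp] = fwd_effect_typing[OF Cons.prems]
  have "fwd_effect ((U @ dual Y) @ [flip w, w] @ (Y @ V)) \<phi>" using Cons.prems by simp
  from fwd_effect_co1[OF this]
  have "fwd_effect (U @ dual Y @ Y @ V) ((one (U @ dual Y) || co1 w || one (Y @ V)) >> \<phi>)" by simp
  from Cons.IH[OF this] show ?case
    by (simp add: one_pr_sq_one sq_assoc)
qed

section \<open>Bending all outputs: every automaton diagram has a normal form as an effect\<close>

definition eff :: "'a kd \<Rightarrow> 'a kd" where
  "eff d = (d || one (dual (cod d))) >> ev (dual (cod d))"

lemma eff_typing [simp]: "dom (eff d) = dom d @ dual (cod d)" "cod (eff d) = []"
  by (simp_all add: eff_def)

definition fwd_rep :: "'a kd \<Rightarrow> bool" where
  "fwd_rep d \<longleftrightarrow> fwd_effect (dom d @ dual (cod d)) (eff d)"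

lemma fwd_rep_nf:
  assumes "nf p n D"
  shows "fwd_rep D"
  unfolding fwd_rep_def
proof (rule fwd_effectI)
  note [simp] = nf_typing[OF assms]
  show "struct (sy (R p) (L n))" by (rule struct.sy)
  have "(D || one (L n)) >> sy (R n) (L n) = sy (R p) (L n) >> (one (L n) || D)"
    by (rule sy_natural) simp_all
  then have "((D || one (L n)) >> sy (R n) (L n)) >> ev (R n) = (sy (R p) (L n) >> (one (L n) || D)) >> ev (R n)"
    by simp
  then show "eff D = sy (R p) (L n) >> ((one (L n) || D) >> ev (R n))"
    using ev_dual[of "R n", where 'a = 'a] by (simp add: eff_def sq_assoc)
  show "nf p n D" by (rule assms)
qed (simp_all add: nf_typing[OF assms])

lemma fwd_effect_ev1: "fwd_effect [flip w, w] (ev1 w)"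
proof -
  have 1: "fwd_effect [\<triangleleft>, \<triangleright>] (ca :: 'a kd)"
  proof (rule fwd_effectI)
    show "struct (one [\<triangleleft>, \<triangleright>])" by (rule struct.one)
    show "nf (Suc 0) (Suc 0) (one (R (Suc 0)))" by (intro nf_bool boolean_one)
  qed simp_all
  show ?thesis
  proof (cases w)
    case Fwd
    then show ?thesis using 1 by simp
  next
    case Bwd
    then show ?thesis using fwd_effect_struct[OF 1 struct.sy[of "[\<triangleright>]" "[\<triangleleft>]"]] by simp
  qed
qed

lemma fwd_effect_ev: "fwd_effect (X @ dual X) (ev (dual X) :: 'a kd)"
proof (induction X)
  case Nil
  have "fwd_effect [] (one [] :: 'a kd)"
  proof (rule fwd_effectI)
    show "struct (one [])" by (rule struct.one)
    show "nf 0 0 (one (R 0))" by (intro nf_bool boolean_one)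
  qed simp_all
  then show ?case by simp
next
  case (Cons w X)
  have "fwd_effect ([w] @ [flip w]) (ev1 (flip w) :: 'a kd)" using fwd_effect_ev1[of "flip w"] by simp
  from fwd_effect_nest[OF this Cons] show ?case by (simp add: ev_append)
qed

lemma fwd_rep_one: "fwd_rep (one X)"
  using fwd_effect_ev[of X] by (simp add: fwd_rep_def eff_def)

lemma fwd_rep_struct:
  assumes "struct f" shows "fwd_rep f"
proof -
  have "struct (f || one (dual (cod f)))" by (intro struct.intros assms)
  from fwd_effect_struct[OF fwd_effect_ev[of "cod f"] this] show ?thesis
    by (simp add: fwd_rep_def eff_def)
qed

lemma fwd_rep_pr:
  fixes f :: "'a kd"
  assumes "fwd_rep f" "fwd_rep g"
  shows "fwd_rep (f || g)"
proof -
  let ?B = "dual (cod f)" and ?D = "dual (cod g)"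
  have "fwd_effect (dom f @ (dom g @ ?D) @ ?B) ((one (dom f) || eff g || one ?B) >> eff f)"
    by (rule fwd_effect_nest) (use assms in \<open>simp_all add: fwd_rep_def\<close>)
  also have "(one (dom f) || eff g || one ?B) >> eff f = eff (f || g)"
  proof -
    have "eff (f || g) = ((f || g || one (?D @ ?B)) >> (one (cod f) || ev ?D || one ?B)) >> ev ?B"
      by (simp add: eff_def ev_append sq_assoc)
    also have "(f || g || one (?D @ ?B)) >> (one (cod f) || ev ?D || one ?B) = f || eff g || one ?B"
      using interchange[of f "one (cod f)" "(g || one ?D) || one ?B" "ev ?D || one ?B"]
        interchange[of "g || one ?D" "ev ?D" "one ?B" "one ?B"] by (simp add: eff_def)
    also have "f || eff g || one ?B = (one (dom f) || eff g || one ?B) >> (f || one ?B)"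
      using interchange[of "one (dom f)" f "eff g || one ?B" "one ?B"] by simp
    finally show ?thesis by (simp add: eff_def sq_assoc)
  qed
  finally show ?thesis by (simp add: fwd_rep_def)
qed

text \<open>By a zigzag, composing amounts to placing the two bent diagrams side by side and joining
  both occurrences of the middle object by cups. \<open>fwd_effect_co\<close> absorbs these cups as
  feedback.\<close>

lemma fwd_rep_sq:
  fixes f :: "'a kd"
  assumes "fwd_rep f" "fwd_rep g" "cod f = dom g"
  shows "fwd_rep (f >> g)"
proof -
  let ?X = "dom f" and ?Y = "dom g" and ?Z = "dual (cod g)"
  note [simp] = assms(3)
  have "fwd_effect ((?X @ dual ?Y) @ (?Y @ ?Z) @ []) ((one (?X @ dual ?Y) || eff g || one []) >> eff f)"
    by (rule fwd_effect_nest) (use assms in \<open>simp_all add: fwd_rep_def\<close>)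
  then have "fwd_effect (?X @ dual ?Y @ ?Y @ ?Z) ((one (?X @ dual ?Y) || eff g) >> eff f)" by simp
  from fwd_effect_co[OF this]
  have "fwd_effect (?X @ ?Z) ((one ?X || co ?Y || one ?Z) >> ((one (?X @ dual ?Y) || eff g) >> eff f))" .
  also have "(one (?X @ dual ?Y) || eff g) >> eff f = eff f || eff g"
    by (rule effect_pr_one) simp_all
  also have "eff f || eff g = (f || one (dual ?Y @ ?Y @ ?Z)) >> ((ev (dual ?Y) || one (?Y @ ?Z)) >> eff g)"
  proof -
    have "eff f || eff g = (eff f || one (?Y @ ?Z)) >> eff g"
      by (rule one_pr_effect[symmetric]) simp_all
    then show ?thesis by (simp add: eff_def[of f] pr_sq_one sq_assoc)
  qed
  also have "(one ?X || co ?Y || one ?Z) >> ((f || one (dual ?Y @ ?Y @ ?Z)) >>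
    ((ev (dual ?Y) || one (?Y @ ?Z)) >> eff g)) =
     (f || one ?Z) >> ((((one ?Y || co ?Y) >> (ev (dual ?Y) || one ?Y)) || one ?Z) >> eff g)"
  proof -
    have "(one ?X || co ?Y || one ?Z) >> (f || one (dual ?Y @ ?Y @ ?Z)) = (f || one ?Z) >> (one ?Y || co ?Y || one ?Z)"
      using interchange[of "one ?X" f "co ?Y || one ?Z" "one (dual ?Y @ ?Y @ ?Z)"] interchange[of f "one ?Y"
        "one ?Z" "co ?Y || one ?Z"] by simp
    moreover have "(one ?X || co ?Y || one ?Z) >> ((f || one (dual ?Y @ ?Y @ ?Z)) >>
      ((ev (dual ?Y) || one (?Y @ ?Z)) >> eff g)) =
       ((one ?X || co ?Y || one ?Z) >> (f || one (dual ?Y @ ?Y @ ?Z))) >> ((ev (dual ?Y) || one (?Y @ ?Z)) >> eff g)"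
      by (rule sq_assoc[symmetric]) simp_all
    ultimately show ?thesis
      by (simp add: pr_sq_one sq_assoc)
  qed
  also have "(((one ?Y || co ?Y) >> (ev (dual ?Y) || one ?Y)) || one ?Z) >> eff g = eff g"
    by (simp add: snake_left)
  also have "(f || one ?Z) >> eff g = eff (f >> g)"
    by (simp add: eff_def pr_sq_one sq_assoc)
  finally show ?thesis by (simp add: fwd_rep_def)
qed

text \<open>Bending the outputs of a cup yields a cap, by a zigzag equation.\<close>

lemma fwd_rep_cu: "fwd_rep (cu :: 'a kd)"
proof -
  have "eff (cu :: 'a kd) = ((cu || one [\<triangleleft>]) >> (one [\<triangleleft>] || (sy [\<triangleright>] [\<triangleleft>] >> ca))) || i1 >> ca"
    by (simp add: eff_def pr_sq_one sq_assoc)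
  then have "eff (cu :: 'a kd) = ca"
    using snake2[of \<triangleright>, where 'a = 'a] by simp
  then show ?thesis using fwd_effect_ev1[of \<triangleright>, where 'a = 'a] by (simp add: fwd_rep_def)
qed

lemma fwd_rep_ca: "fwd_rep (ca :: 'a kd)"
  using fwd_effect_ev1[of \<triangleright>, where 'a = 'a] by (simp add: fwd_rep_def eff_def)

lemma fwd_rep_gen: "g \<in> automaton_gens \<Longrightarrow> fwd_rep (ge g)"
  unfolding automaton_gens_def
  using fwd_rep_nf[OF nf_bool[OF boolean_cc]] fwd_rep_nf[OF nf_bool[OF boolean_kk]]
    fwd_rep_nf[OF nf_bool[OF boolean_mm]] fwd_rep_nf[OF nf_bool[OF boolean_nn]] fwd_rep_cu fwd_rep_ca
    fwd_rep_nf[OF nf_letter] by auto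

lemma fwd_rep_automaton: "automaton_diagram d \<Longrightarrow> fwd_rep (abs_kd d)"
proof (induction rule: automaton_diagram.induct)
  case (gen g)
  from fwd_rep_gen[OF this] show ?case by (simp add: ge.abs_eq)
next
  case (idn X)
  then show ?case using fwd_rep_one[of X] by (simp add: one.abs_eq)
next
  case (symm X Y)
  then show ?case using fwd_rep_struct[OF struct.sy[of X Y]] by (simp add: sy.abs_eq)
next
  case (seq f g)
  then show ?case using fwd_rep_sq[of "abs_kd f" "abs_kd g"] by (simp add: sq.abs_eq cod.abs_eq dom.abs_eq)
next
  case (par f g)
  then show ?case using fwd_rep_pr[of "abs_kd f" "abs_kd g"] by (simp add: pr.abs_eq)
qed

section \<open>Simulation\<close>

text \<open>\<open>run as S i m w\<close>: the word \<open>w\<close> leads from input \<open>i\<close> to state \<open>m\<close>, whose own letter is not yet part of \<open>w\<close>.\<close>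

inductive run :: "'a list \<Rightarrow> (nat \<Rightarrow> nat \<Rightarrow> bool) \<Rightarrow> nat \<Rightarrow> nat \<Rightarrow> 'a list \<Rightarrow> bool" for as S i where
  run_start: "m < length as \<Longrightarrow> S (length as + i) m \<Longrightarrow> run as S i m []"
| run_step: "run as S i k w \<Longrightarrow> m < length as \<Longrightarrow> S k m \<Longrightarrow> run as S i m (w @ [as ! k])"

lemma run_less: "run as S i m w \<Longrightarrow> m < length as"
  by (induction rule: run.induct) auto

lemma run_NilD: "run as S i m [] \<Longrightarrow> S (length as + i) m"
  by (erule run.cases) auto

lemma run_snocD: "run as S i m (w @ [a]) \<Longrightarrow> \<exists>k. run as S i k w \<and> S k m \<and> as ! k = a"
  by (erule run.cases) auto

text \<open>The primed automaton is the larger one in the KDA order, hence has the smaller language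
  from each input \<open>i\<close> to each output \<open>j\<close>. The first conjunct treats the
  empty word, which stems from direct entries between inputs and outputs; the second treats words
  ending with the letter of the last state \<open>k\<close>.\<close>

definition lang_le where
  "lang_le p n as S as' S' \<longleftrightarrow> (\<forall>i<p. \<forall>j<n.
     (S' (length as' + i) (length as' + j) \<longrightarrow> S (length as + i) (length as + j)) \<and>
     (\<forall>k w. run as' S' i k w \<and> S' k (length as' + j) \<longrightarrow>
       (\<exists>m. run as S i m w \<and> as ! m = as' ! k \<and> S m (length as + j))))"

lemma mt_pre:
  assumes "cmap q p f" "trm1 p s" "trm1 p t"
  shows "f >> mt p s t = mt q (f >> s) (f >> t)"
proof -
  note [simp] = cmapD(1,2)[OF assms(1)] trm1_typing[OF assms(2)] trm1_typing[OF assms(3)]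
  have "f >> mt p s t = (f >> copy p) >> ((s || t) >> MM)" by (simp add: mt_def sq_assoc)
  also have "\<dots> = copy q >> (((f || f) >> (s || t)) >> MM)"
    by (simp only: cmap_copy[OF assms(1)]) (simp add: sq_assoc)
  finally show ?thesis by (simp add: mt_def interchange)
qed

lemma tp_pre: assumes "cmap q p f" shows "f >> tp p = tp q"
proof -
  have "f >> tp p = (f >> disc p) >> NN" using cmapD(1,2)[OF assms] by (simp add: tp_def sq_assoc)
  then show ?thesis by (simp only: cmapD(3)[OF assms] tp_def)
qed

lemma MT_pre: "cmap q p f \<Longrightarrow> \<forall>t\<in>set ts. trm1 p t \<Longrightarrow> f >> MT p ts = MT q (map ((>>) f) ts)"
proof (induction ts)
  case (Cons t ts)
  then have "f >> mt p t (MT p ts) = mt q (f >> t) (f >> MT p ts)" by (intro mt_pre trm1_MT) simp_all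
  with Cons show ?case by (simp add: MT_simps)
qed (simp add: MT_simps tp_pre)

lemma cmap_letters: "cmap (length as) (length as) (letters as)"
proof (induction as)
  case Nil
  then show ?case using cmap_one[of 0] by simp
next
  case (Cons a as)
  then show ?case using cmap_pr[OF cmap_ltr Cons] by simp
qed

lemma letters_proj: "i < length as \<Longrightarrow> letters as >> proj (length as) i = proj (length as) i >> (ltr (as ! i) :: 'a kd)"
proof (induction as arbitrary: i)
  case (Cons a as)
  note d = cmapD(3)[OF cmap_letters[of as]]
  show ?case
  proof (cases i)
    case 0
    have "letters (a # as) >> proj (length (a # as)) i = ltr a || (disc (length as) :: 'a kd)"
      by (simp add: 0 proj_def interchange d)
    also have "\<dots> = (i1 || disc (length as)) >> ltr a"
      by (rule effect_pr_one[symmetric]) simp_all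
    finally show ?thesis by (simp add: 0 proj_def)
  next
    case (Suc j)
    then have j: "j < length as" using Cons.prems by simp
    have P: "proj (length (a # as)) i = kk || (proj (length as) j :: 'a kd)"
      by (simp add: Suc proj_def)
    have "letters (a # as) >> proj (length (a # as)) i = kk || (letters as >> (proj (length as) j :: 'a kd))"
      unfolding P using j by (simp add: interchange E7)
    also have "\<dots> = (kk || proj (length as) j) >> ltr (as ! j)"
      unfolding Cons.IH[OF j] using j interchange[of kk "one []" "proj (length as) j" "ltr (as ! j)"] by simp
    finally show ?thesis unfolding P by (simp add: Suc)
  qed
qed simp

definition inp :: "'a list \<Rightarrow> nat \<Rightarrow> nat \<Rightarrow> 'a kd" where
  "inp as p i = (if i < length as then proj (length as + p) i >> ltr (as ! i) else proj (length as + p) i)"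

lemma trm1_inp: "i < length as + p \<Longrightarrow> trm1 (length as + p) (inp as p i)"
  by (simp add: inp_def trm1_proj trm1_ltr)

lemma inp_proj: "i < length as + p \<Longrightarrow> (letters as || one (R p)) >> proj (length as + p) i = (inp as p i :: 'a kd)"
proof (cases "i < length as")
  case True
  have "(letters as || one (R p)) >> proj (length as + p) i = (proj (length as) i >> ltr (as ! i)) || (disc p :: 'a kd)"
    using True by (simp add: proj_add_left interchange letters_proj)
  also have "\<dots> = (proj (length as) i || disc p) >> ltr (as ! i)"
    using True interchange[of "proj (length as) i" "ltr (as ! i)" "disc p :: 'a kd" "one []"] by simp
  finally show ?thesis using True by (simp add: inp_def proj_add_left)
next
  case False
  assume "i < length as + p"
  with False obtain j where j: "i = length as + j" "j < p"
    by (metis add_diff_inverse_nat nat_add_left_cancel_less)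
  then show ?thesis
    using cmapD(3)[OF cmap_letters[of as]] by (simp add: inp_def proj_add_right interchange)
qed

lemma cmap_layer:
  assumes "has_matrix (length as + p) (length as + n) B S"
  shows "cmap (length as + p) (length as + n) (layer as p B)"
  by (rule cmap_sq[OF cmap_pr[OF cmap_letters cmap_one] has_matrixD(1)[OF assms]])

lemma layer_proj:
  assumes B: "has_matrix (length as + p) (length as + n) B S" and j: "j < length as + n"
  shows "(layer as p B) >> proj (length as + n) j =
    JN (length as + p) (map (inp as p) (filter (\<lambda>i. S i j) [0..<length as + p]))"
proof -
  note [simp] = cmapD(1,2)[OF has_matrixD(1)[OF B]]
  have "(layer as p B) >> proj (length as + n) j = (letters as || one (R p)) >> (B >> proj (length as + n) j)"
    using j by (simp add: sq_assoc replicate_add)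
  also have "\<dots> = (letters as || one (R p)) >> lin (length as + p) (\<lambda>i. S i j)"
    by (simp only: has_matrixD(2)[OF B j])
  also have "\<dots> = JN (length as + p) (map (\<lambda>i. (letters as || one (R p)) >>
    proj (length as + p) i) (filter (\<lambda>i. S i j) [0..<length as + p]))"
    by (rule cmap_lin[OF cmap_pr[OF cmap_letters cmap_one]])
  also have "map (\<lambda>i. (letters as || one (R p)) >> proj (length as + p) i) (filter (\<lambda>i. S i j) [0..<length as + p]) =
     map (inp as p) (filter (\<lambda>i. S i j) [0..<length as + p])"
    by (rule map_cong) (simp_all add: inp_proj)
  finally show ?thesis .
qed

lemma layer_proj_le:
  assumes "has_matrix (length as + p) (length as + n) B S" "j < length as + n" "i < length as + p" "S i j"
  shows "(layer as p B) >> proj (length as + n) j \<le> inp as p i"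
  unfolding layer_proj[OF assms(1,2)] by (rule JN_le) (use assms(3,4) in \<open>auto simp: trm1_inp\<close>)

text \<open>The simulation \<open>h\<close> sends a state \<open>k\<close> of the second automaton to the union, over all \<open>i\<close> and \<open>w\<close> with
  \<open>run as' S' i k w\<close>, of the intersection of all states of the first automaton that \<open>w\<close> reaches
  from \<open>i\<close>. Only finitely many intersections occur.\<close>

lemma nf_simulation:
  fixes B B' :: "'a kd"
  assumes B: "has_matrix (length as + p) (length as + n) B S"
    and B': "has_matrix (length as' + p) (length as' + n) B' S'"
    and incl: "lang_le p n as S as' S'"
  shows "automaton as p n B \<le>
     automaton as' p n B'"
proof -
  define q where "q = length as"
  define q' where "q' = length as'"
  define F where "F = layer as p B"
  define F' where "F' = layer as' p B'"
  have cF: "cmap (q + p) (q + n) F" unfolding F_def q_def by (rule cmap_layer[OF B])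
  have cF': "cmap (q' + p) (q' + n) F'" unfolding F'_def q'_def by (rule cmap_layer[OF B'])
  \<comment> \<open>The state of the determinised first automaton after reading \<open>w\<close>
    from input \<open>i\<close>.\<close>
  define Z where "Z i w = {m. run as S i m w}" for i w
  have Zq: "Z i w \<subseteq> {..<q}" for i w unfolding Z_def q_def using run_less by blast
  have finZ: "finite (Z i w)" for i w using Zq finite_subset by blast
  define X where "X A = (MT q (map (proj q) (sorted_list_of_set A)) :: 'a kd)" for A
  have tX: "trm1 q (X A)" and rX: "has_radj (X A)" if "A \<subseteq> {..<q}" for A
    using that finite_subset[OF that] unfolding X_def
    by (auto intro!: trm1_MT has_radj_MT trm1_proj has_radj_proj)
  \<comment> \<open>Infinitely many words may reach \<open>k\<close>, but their sets
    \<open>Z i w\<close> are subsets of the finite set of states, so the union over them is a finite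
    term.\<close>
  define ZZ where "ZZ k = {Z i w |i w. i < p \<and> run as' S' i k w}" for k
  have "ZZ k \<subseteq> Pow {..<q}" for k unfolding ZZ_def using Zq by blast
  then have "finite (ZZ k)" for k by (rule finite_subset) simp
  then have "\<exists>zs. set zs = ZZ k" for k by (rule finite_list)
  then obtain zz where zz: "set (zz k) = ZZ k" for k by metis
  define hk where "hk k = JN q (map X (zz k))" for k
  have tXz: "\<forall>t\<in>set (map X (zz k)). trm1 q t" for k
    using tX Zq by (auto simp: zz ZZ_def)
  have rXz: "\<forall>t\<in>set (map X (zz k)). trm1 q t \<and> has_radj t" for k
    using tX rX Zq by (auto simp: zz ZZ_def)
  have thk: "trm1 q (hk k)" and rhk: "has_radj (hk k)" for k
    unfolding hk_def by (rule trm1_JN[OF tXz], rule has_radj_JN[OF rXz])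
  define h where "h = tuple q (map hk [0..<q'])"
  have ch: "cmap q q' h"
    unfolding h_def using cmap_tuple[of "map hk [0..<q']" q] thk by simp
  have rh: "has_radj h"
    unfolding h_def by (rule has_radj_tuple) (use thk rhk in simp)
  have hproj: "h >> proj q' k = hk k" if "k < q'" for k
    unfolding h_def using tuple_proj[of "map hk [0..<q']" q k] thk that by simp
  note [simp] = cmapD(1,2)[OF cF] cmapD(1,2)[OF cF'] cmapD(1,2)[OF ch] trm1_typing[OF thk]
  \<comment> \<open>The terms \<open>X A\<close> and \<open>hk k\<close> speak about states alone:
    \<open>?E\<close> forgets the inputs, and \<open>?G\<close> below is the next state computed by
    the first automaton.\<close>
  let ?E = "one (R q) || disc p :: 'a kd"
  have cE: "cmap (q + p) q ?E" using cmap_pr[OF cmap_one[of q] cmap_disc[of p]] by simp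
  have Eproj: "?E >> proj q m = proj (q + p) m" if "m < q" for m
    using that by (simp add: proj_add_left effect_pr_one)
  let ?G = "F >> (one (R q) || disc n)"
  have cG: "cmap (q + p) q ?G"
    using cmap_sq[OF cF] cmap_pr[OF cmap_one[of q] cmap_disc[of n]] by simp
  have Gproj: "?G >> proj q m = F >> proj (q + n) m" if "m < q" for m
    using that by (simp add: proj_add_left effect_pr_one sq_assoc replicate_add)
  have X_ge: "?E >> (proj q m >> ltr a) \<le> ?E >> (X A >> ltr a)" if "A \<subseteq> {..<q}" "m \<in> A" for A m a
    unfolding X_def using that finite_subset[OF that(1)]
    by (intro sq_mono[OF order_refl] sq_mono[OF _ order_refl] MT_ge) (auto intro: trm1_proj)
  have inp_le: "inp as p m = ?E >> (proj q m >> ltr (as ! m))" if "m < q" for m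
    using that Eproj[OF that] by (simp add: inp_def q_def flip: sq_assoc)
  \<comment> \<open>Intersections are joins in the KDA order, so an upper bound on the next value of
    \<open>X A\<close> can be checked at each state of \<open>A\<close> separately.\<close>
  have GX_le: "?G >> X A \<le> u" if A: "A \<subseteq> {..<q}" and u: "trm1 (q + p) u"
    and le: "\<And>m. m \<in> A \<Longrightarrow> F >> proj (q + n) m \<le> u" for A u
  proof -
    have *: "\<forall>t\<in>set (map (proj q) (sorted_list_of_set A)). trm1 q (t :: 'a kd)"
      using A finite_subset[OF A] by (auto intro: trm1_proj)
    show ?thesis unfolding X_def MT_pre[OF cG *]
      by (rule MT_least[OF u]) (use A finite_subset[OF A] in \<open>auto simp: Gproj subset_iff intro!: le\<close>)
  qed
  have F_le: "F >> proj (q + n) j \<le> inp as p i" if "j < q + n" "i < q + p" "S i j" for i j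
    unfolding F_def using layer_proj_le[OF B, of j i] that by (simp add: q_def)
  have h_inp1: "(h || one (R p)) >> inp as' p i = JN (q + p) (map (\<lambda>A. ?E >> (X A >> ltr (as' ! i))) (zz i))"
    if i: "i < q'" for i
  proof -
    have "(h || one (R p)) >> inp as' p i = ((h || one (R p)) >> (proj q' i || disc p)) >> ltr (as' ! i)"
      using i by (simp add: inp_def q'_def[symmetric] proj_add_left sq_assoc)
    also have "(h || one (R p)) >> (proj q' i || disc p) = hk i || disc p"
      using i by (simp add: interchange hproj)
    also have "hk i || disc p = ?E >> hk i" by (simp add: effect_pr_one)
    also have "(?E >> hk i) >> ltr (as' ! i) = ?E >> (hk i >> ltr (as' ! i))" by (simp add: sq_assoc)
    also have "hk i >> ltr (as' ! i) = JN q (map (\<lambda>A. X A >> ltr (as' ! i)) (zz i))"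
      unfolding hk_def JN_letter[OF tXz] by (simp add: o_def)
    also have "?E >> \<dots> = JN (q + p) (map (\<lambda>A. ?E >> (X A >> ltr (as' ! i))) (zz i))"
      by (subst JN_pre[OF cE]) (use tXz[of i] in \<open>auto simp: o_def intro: trm1_ltr\<close>)
    finally show ?thesis .
  qed
  have h_inp2: "(h || one (R p)) >> inp as' p (q' + i) = inp as p (q + i)" if i: "i < p" for i
    using i cmapD(3)[OF ch] by (simp add: inp_def q_def[symmetric] q'_def[symmetric] proj_add_right interchange)
  \<comment> \<open>This is the lax square required by \<open>tr_simulation\<close>. In each column
    \<open>j\<close> the right-hand side is a meet of the contributions of all rows \<open>i\<close>
    with \<open>S' i j\<close>; the four cases arise since each of \<open>i\<close> and
    \<open>j\<close> is a state or an external wire.\<close>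
  have key: "F >> (h || one (R n)) \<le> (h || one (R p)) >> F'"
  proof (rule cmap_leI)
    have ch1: "cmap (q + n) (q' + n) (h || one (R n))" and ch2: "cmap (q + p) (q' + p) (h || one (R p))"
      by (rule cmap_pr[OF ch cmap_one])+
    show c1: "cmap (q + p) (q' + n) (F >> (h || one (R n)))" by (rule cmap_sq[OF cF ch1])
    show c2: "cmap (q + p) (q' + n) ((h || one (R p)) >> F')" by (rule cmap_sq[OF ch2 cF'])
    fix j assume j: "j < q' + n"
    let ?l = "F >> (h || one (R n)) >> proj (q' + n) j"
    have tl: "trm1 (q + p) ?l" by (rule cmap_sq[OF c1 trm1_proj[OF j]])
    have l1: "?l \<le> ?G >> X A" if "j < q'" "A \<in> ZZ j" for A
    proof -
      have "?l = F >> (hk j || disc n)"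
        using that(1) by (simp add: proj_add_left sq_assoc interchange hproj replicate_add)
      also have "hk j || disc n = (one (R q) || disc n) >> hk j" by (simp add: effect_pr_one)
      also have "F >> ((one (R q) || disc n) >> hk j) = ?G >> hk j" by (simp add: sq_assoc replicate_add)
      also have "\<dots> \<le> ?G >> X A"
        unfolding hk_def by (intro sq_mono[OF order_refl] JN_le[OF tXz]) (use that zz in auto)
      finally show ?thesis .
    qed
    have l2: "?l = F >> proj (q + n) (q + j0)" if "j = q' + j0" "j0 < n" for j0
      using that cmapD(3)[OF ch] by (simp add: proj_add_right sq_assoc interchange replicate_add)
    have r: "((h || one (R p)) >> F') >> proj (q' + n) j =
      JN (q + p) (map (\<lambda>i. (h || one (R p)) >> inp as' p i) (filter (\<lambda>i. S' i j) [0..<q' + p]))"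
    proof -
      have "((h || one (R p)) >> F') >> proj (q' + n) j = (h || one (R p)) >> (F' >> proj (q' + n) j)"
        using j by (simp add: sq_assoc replicate_add)
      also have "F' >> proj (q' + n) j = JN (q' + p) (map (inp as' p) (filter (\<lambda>i. S' i j) [0..<q' + p]))"
        unfolding F'_def q'_def by (rule layer_proj[OF B']) (use j in \<open>simp add: q'_def\<close>)
      also have "(h || one (R p)) >> \<dots> = JN (q + p) (map (\<lambda>i. (h || one (R p)) >>
        inp as' p i) (filter (\<lambda>i. S' i j) [0..<q' + p]))"
        by (subst JN_pre[OF ch2]) (auto simp: o_def q'_def intro: trm1_inp)
      finally show ?thesis .
    qed
    have "?l \<le> (h || one (R p)) >> inp as' p i" if i: "i < q' + p" "S' i j" for i
    proof (cases "i < q'")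
      case True
      show ?thesis unfolding h_inp1[OF True]
      proof (rule JN_greatest[OF tl], clarsimp)
        fix A assume "A \<in> set (zz i)"
        then obtain i0 w where A: "A = Z i0 w" "i0 < p" "run as' S' i0 i w" by (auto simp: zz ZZ_def)
        have tE: "trm1 (q + p) (?E >> (X A >> ltr (as' ! i)))"
          by (rule cmap_sq[OF cE trm1_ltr[OF tX]]) (use A Zq in simp)
        show "?l \<le> ?E >> (X A >> ltr (as' ! i))"
        proof (cases "j < q'")
          case jq: True
          \<comment> \<open>Prolonging \<open>w\<close> by the letter of \<open>i\<close> is one
            step of the subset construction: each element of \<open>?A'\<close> has a predecessor in
            \<open>A\<close> that carries this letter.\<close>
          let ?A' = "Z i0 (w @ [as' ! i])"
          have "run as' S' i0 j (w @ [as' ! i])" by (rule run_step[OF A(3)]) (use jq i q'_def in simp_all)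
          then have "?A' \<in> ZZ j" unfolding ZZ_def using A(2) by blast
          then have "?l \<le> ?G >> X ?A'" by (rule l1[OF jq])
          also have "\<dots> \<le> ?E >> (X A >> ltr (as' ! i))"
          proof (rule GX_le[OF Zq tE])
            fix m assume "m \<in> ?A'"
            then have rm: "run as S i0 m (w @ [as' ! i])" by (simp add: Z_def)
            then obtain k where k: "run as S i0 k w" "S k m" "as ! k = as' ! i" using run_snocD by metis
            have km: "k < q" "m < q" using run_less[OF k(1)] run_less[OF rm] by (simp_all add: q_def)
            have "F >> proj (q + n) m \<le> inp as p k" by (rule F_le) (use km k in simp_all)
            also have "\<dots> = ?E >> (proj q k >> ltr (as' ! i))" using inp_le[OF km(1)] k(3) by simp
            also have "\<dots> \<le> ?E >> (X A >> ltr (as' ! i))" by (rule X_ge) (use A Zq k in \<open>simp_all add: Z_def\<close>)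
            finally show "F >> proj (q + n) m \<le> ?E >> (X A >> ltr (as' ! i))" .
          qed
          finally show ?thesis .
        next
          case False
          then obtain j0 where j0: "j = q' + j0" "j0 < n" using j
            by (metis add_diff_inverse_nat nat_add_left_cancel_less)
          \<comment> \<open>Here the inclusion of languages enters: the word that the second
            automaton emits at \<open>j0\<close> also has a run in the first, through some state
            \<open>m\<close> of \<open>A\<close>.\<close>
          then obtain m where m: "run as S i0 m w" "as ! m = as' ! i" "S m (q + j0)"
            using incl A(2,3) i(2) unfolding lang_le_def q_def q'_def by blast
          have mq: "m < q" using run_less[OF m(1)] by (simp add: q_def)
          have "?l \<le> inp as p m" unfolding l2[OF j0] by (rule F_le) (use mq m j0 in simp_all)
          also have "\<dots> = ?E >> (proj q m >> ltr (as' ! i))" using inp_le[OF mq] m(2) by simp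
          also have "\<dots> \<le> ?E >> (X A >> ltr (as' ! i))" by (rule X_ge) (use A Zq m in \<open>simp_all add: Z_def\<close>)
          finally show ?thesis .
        qed
      qed
    next
      case False
      then obtain i0 where i0: "i = q' + i0" "i0 < p" using i by (metis add_diff_inverse_nat nat_add_left_cancel_less)
      have ti: "trm1 (q + p) (inp as p (q + i0))" using trm1_inp[of "q + i0" as p] i0 by (simp add: q_def)
      have "?l \<le> inp as p (q + i0)"
      proof (cases "j < q'")
        case jq: True
        \<comment> \<open>Entering state \<open>j\<close> from an input corresponds to the empty
          word, hence to the set of states that the same input enters in the first
          automaton.\<close>
        have "run as' S' i0 j []" by (rule run_start) (use jq i i0 q'_def in simp_all)
        then have "Z i0 [] \<in> ZZ j" unfolding ZZ_def using i0 by blast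
        then have "?l \<le> ?G >> X (Z i0 [])" by (rule l1[OF jq])
        also have "\<dots> \<le> inp as p (q + i0)"
        proof (rule GX_le[OF Zq ti])
          fix m assume "m \<in> Z i0 []"
          then have rm: "run as S i0 m []" by (simp add: Z_def)
          show "F >> proj (q + n) m \<le> inp as p (q + i0)"
            by (rule F_le) (use run_less[OF rm] run_NilD[OF rm] i0 in \<open>simp_all add: q_def\<close>)
        qed
        finally show ?thesis .
      next
        case False
        then obtain j0 where j0: "j = q' + j0" "j0 < n" using j by (metis add_diff_inverse_nat nat_add_left_cancel_less)
        then have "S (q + i0) (q + j0)"
          using incl i0 i(2) unfolding lang_le_def q_def q'_def by blast
        then show ?thesis unfolding l2[OF j0] by (intro F_le) (use i0 j0 in simp_all)
      qed
      then show ?thesis using h_inp2[OF i0(2)] i0(1) by simp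
    qed
    then show "?l \<le> ((h || one (R p)) >> F') >> proj (q' + n) j"
      unfolding r by (intro JN_greatest[OF tl]) auto
  qed
  show ?thesis
    using tr_simulation[OF rh _ _ _ _ _ _ key]
    unfolding F_def[symmetric] F'_def[symmetric] q_def[symmetric] q'_def[symmetric]
    by (simp add: replicate_add)
qed

section \<open>A sound model\<close>

text \<open>A bijection extending \<open>w \<mapsto> w @ [a]\<close>: words starting with the extra letter \<open>None\<close> make room for the
  words that do not end in \<open>a\<close>.\<close>

definition ext :: "'a \<Rightarrow> 'a option list \<Rightarrow> 'a option list" where
  "ext a v = (if v = [] \<or> hd v \<noteq> None then v @ [Some a] else if last v = Some a then v else tl v)"

definition unext :: "'a \<Rightarrow> 'a option list \<Rightarrow> 'a option list" where
  "unext a v = (if v \<noteq> [] \<and> last v = Some a then (if hd v = None then v else butlast v) else None # v)"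

lemma unext_ext: "unext a (ext a v) = v"
  by (cases v rule: list.exhaust[case_names Nil Cons]) (auto simp: ext_def unext_def)

lemma ext_unext: "ext a (unext a v) = v"
  by (cases v rule: rev_cases) (auto simp: ext_def unext_def hd_append split: if_splits)

lemma bij_ext: "bij (ext a)"
  by (rule o_bij[of "unext a"]) (auto simp: unext_ext ext_unext)

text \<open>Injectivity makes taking images preserve intersections, as E8 demands; surjectivity
  makes it preserve \<open>UNIV\<close>, as E9 demands.\<close>

lemma inj_ext: "inj (ext a)" and surj_ext: "surj (ext a)"
  using bij_ext[of a] by (simp_all add: bij_def)

lemma ext_map: "ext a (map Some w) = map Some (w @ [a])"
  by (cases w) (auto simp: ext_def)

text \<open>\<open>map_gen Some\<close> merely moves a generator to the larger alphabet; letters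
  alone receive a new meaning.\<close>

definition model_gen :: "'a gen \<Rightarrow> 'a option lrel" where
  "model_gen g = (case g of Letter a \<Rightarrow> {([L], [K]) | L K. ext a ` L \<subseteq> K} | _ \<Rightarrow> gen_sem (map_gen Some g))"

lemma model_gen_arity: "has_arity (model_gen g) (length (gen_src g)) (length (gen_tgt g))"
  by (cases g) (auto simp: model_gen_def has_arity_def)

lemma model_gen_ord: "obj_ord (gen_src g) O model_gen g = model_gen g" "model_gen g O obj_ord (gen_tgt g) = model_gen g"
proof -
  have m: "gen_src (map_gen Some g) = gen_src g" "gen_tgt (map_gen Some g) = gen_tgt g"
    by (cases g; simp)+
  have "obj_ord (gen_src g) O model_gen g = model_gen g \<and> model_gen g O obj_ord (gen_tgt g) = model_gen g"
  proof (cases "\<exists>a. g = Letter a")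
    case True
    then obtain a where "g = Letter a" by blast
    then show ?thesis by (auto simp: model_gen_def) blast+
  next
    case False
    then have "model_gen g = gen_sem (map_gen Some g)" by (cases g) (auto simp: model_gen_def)
    then show ?thesis using gen_sem_ord[of "map_gen Some g"] m by simp
  qed
  then show "obj_ord (gen_src g) O model_gen g = model_gen g" "model_gen g O obj_ord (gen_tgt g) = model_gen g" by auto
qed

primrec model_trm :: "'a trm \<Rightarrow> 'a option lrel" where
  "model_trm (TGen g) = model_gen g"
| "model_trm (TId X) = obj_ord X"
| "model_trm (TSym X Y) = trm_sem (TSym X Y)"
| "model_trm (TSeq f g) = model_trm f O model_trm g"
| "model_trm (TPar f g) = rel_par (model_trm f) (model_trm g)"

lemma model_trm_arity: "well_typed f \<Longrightarrow> has_arity (model_trm f) (length (tsrc f)) (length (ttgt f))"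
proof (induction f)
  case (TSym X Y)
  then show ?case using has_arity_trm_sem[of "TSym X Y"] by (simp del: trm_sem.simps)
qed (auto intro: model_gen_arity has_arity_obj_ord has_arity_par has_arity_seq)

lemma model_trm_ord: "well_typed f \<Longrightarrow> obj_ord (tsrc f) O model_trm f =
  model_trm f \<and> model_trm f O obj_ord (ttgt f) = model_trm f"
proof (induction f)
  case (TSym X Y)
  then show ?case using trm_sem_ord[of "TSym X Y"] by (simp del: trm_sem.simps)
next
  case (TSeq f g)
  then have "obj_ord (tsrc f) O model_trm f = model_trm f" "model_trm g O obj_ord (ttgt g) = model_trm g" by auto
  then show ?case by (simp only: tsrc.simps ttgt.simps model_trm.simps O_assoc)
      (simp only: O_assoc[symmetric])
next
  case (TPar f g)
  then have "well_typed f" by simp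
  note ar = model_trm_arity[OF this]
  show ?case
    using TPar by (simp add: obj_ord_append flip: rel_par_O[OF has_arity_obj_ord ar]
        rel_par_O[OF ar has_arity_obj_ord])
qed (simp_all add: model_gen_ord obj_ord_idem)

lemma model_trm_smc_eq: "smc_eq f g \<Longrightarrow> model_trm f = model_trm g"
proof (induction rule: smc_eq.induct)
  case (interchange f g f' g')
  then have "has_arity (model_trm f) (length (tsrc f)) (length (tsrc g))"
    "has_arity (model_trm g) (length (tsrc g)) (length (ttgt g))"
    using model_trm_arity[of f] model_trm_arity[of g] by auto
  then show ?case by (simp add: rel_par_O)
next
  case (sym_natural f g)
  note swap = rel_swap_par[OF model_trm_arity[OF sym_natural(1)] model_trm_arity[OF sym_natural(2)]]
  have "rel_par (model_trm f) (model_trm g) O obj_ord (ttgt f @ ttgt g) = rel_par (model_trm f) (model_trm g)"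
    "obj_ord (tsrc f @ tsrc g) O rel_par (model_trm f) (model_trm g) = rel_par (model_trm f) (model_trm g)"
    using model_trm_ord[of "TPar f g"] sym_natural by simp_all
  then show ?case
    unfolding model_trm.simps trm_sem_TSym obj_ord_append[symmetric] by (metis O_assoc swap)
next
  case (sym_involutive X Y)
  show ?case using trm_sem_smc_eq[OF smc_eq.sym_involutive[of X Y]] by (simp del: trm_sem.simps(3))
next
  case (hexagon X Y Z)
  show ?case using trm_sem_smc_eq[OF smc_eq.hexagon[of X Y Z]] by (simp del: trm_sem.simps(3))
qed (auto simp: model_trm_ord rel_par_assoc obj_ord_append O_assoc)

lift_definition model :: "'a diagram \<Rightarrow> 'a option lrel" is model_trm
  by (rule model_trm_smc_eq)

lemma model_simps:
  "model (gen x) = model_gen x" "model (idn X) = obj_ord X"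
  "model (\<sigma> X Y) = {(xs @ ys, vs @ us) | xs ys us vs. (xs, us) \<in> obj_ord X \<and> (ys, vs) \<in> obj_ord Y}"
  "tgt f = src g \<Longrightarrow> model (f ;; g) = model f O model g" "model (f \<oplus> g) = rel_par (model f) (model g)"
  by (transfer; simp)+

lemma model_arity: "has_arity (model d) (length (src d)) (length (tgt d))"
  by transfer (auto simp: smc_eq_wt intro: model_trm_arity)

text \<open>The length constraint lets \<open>ex_length\<close> replace the intermediate list by one
  quantified language per wire.\<close>

lemma mem_seq: "tgt f = src g \<Longrightarrow> (xs, zs) \<in> model (f ;; g) \<longleftrightarrow> (\<exists>ys. length ys =
  length (tgt f) \<and> (xs, ys) \<in> model f \<and> (ys, zs) \<in> model g)"
  using has_arityD[OF model_arity, of _ _ f] by (auto simp: model_simps)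

lemma mem_par: "(xs, ys) \<in> model (f \<oplus> g) \<longleftrightarrow>
   (take (length (src f)) xs, take (length (tgt f)) ys) \<in> model f \<and> (drop (length (src f)) xs,
     drop (length (tgt f)) ys) \<in> model g"
proof
  assume "(xs, ys) \<in> model (f \<oplus> g)"
  then obtain a b c d where *: "xs = a @ b" "ys = c @ d" "(a, c) \<in> model f" "(b, d) \<in> model g"
    by (auto simp: model_simps elim: rel_parE)
  from has_arityD[OF model_arity *(3)] * show "(take (length (src f)) xs, take (length (tgt f)) ys) \<in> model f \<and>
    (drop (length (src f)) xs, drop (length (tgt f)) ys) \<in> model g"
    by simp
next
  assume "(take (length (src f)) xs, take (length (tgt f)) ys) \<in> model f \<and> (drop (length (src f)) xs,
    drop (length (tgt f)) ys) \<in> model g"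
  then show "(xs, ys) \<in> model (f \<oplus> g)"
    unfolding model_simps using rel_parI[of _ _ "model f" _ _ "model g"] by (metis append_take_drop_id)
qed

text \<open>An opaque inclusion, so that the simplifier leaves the bounds intact for instantiating the wires.\<close>

definition sb :: "'b set \<Rightarrow> 'b set \<Rightarrow> bool" where "sb x y \<longleftrightarrow> x \<subseteq> y"

lemma sb_refl: "sb x x" by (simp add: sb_def)

lemma mem_model_gen:
  "([x], [y, z]) \<in> model_gen BCopy \<longleftrightarrow> sb x y \<and> sb x z" "([x], []) \<in> model_gen BDiscard"
  "([x, y], [z]) \<in> model_gen BMerge \<longleftrightarrow> sb (x \<union> y) z" "([], [z]) \<in> model_gen BUnit \<longleftrightarrow> sb {} z"
  "([], [x, y]) \<in> model_gen Cup \<longleftrightarrow> sb x y" "([x, y], []) \<in> model_gen Cap \<longleftrightarrow> sb y x"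
  "([x], [y]) \<in> model_gen (Letter a) \<longleftrightarrow> sb (ext a ` x) y"
  "([x, y], [z]) \<in> model_gen WMerge \<longleftrightarrow> sb (x \<inter> y) z" "([], [z]) \<in> model_gen WUnit \<longleftrightarrow> sb UNIV z"
  "([x], [y, z]) \<in> model_gen WCopy \<longleftrightarrow> sb x (y \<union> z)" "([x], []) \<in> model_gen WDiscard \<longleftrightarrow> sb x {}"
  by (auto simp: model_gen_def sb_def)

lemma mem_one: "([x], [y]) \<in> obj_ord [\<triangleright>] \<longleftrightarrow> sb x y" "([x], [y]) \<in> obj_ord [\<triangleleft>] \<longleftrightarrow> sb y x"
  "([], []) \<in> obj_ord []"
  by (auto simp: sb_def)

lemma ex_length:
  "(\<exists>ys. length ys = 0 \<and> P ys) \<longleftrightarrow> P []"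
  "(\<exists>ys. length ys = Suc n \<and> P ys) \<longleftrightarrow> (\<exists>y ys. length ys = n \<and> P (y # ys))"
  by (auto simp: length_Suc_conv)

lemma mem_sym: "(ps, qs) \<in> model (\<sigma> X Y) \<longleftrightarrow>
   (take (length X) ps, drop (length Y) qs) \<in> obj_ord X \<and> (drop (length X) ps, take (length Y) qs) \<in> obj_ord Y"
proof
  assume "(ps, qs) \<in> model (\<sigma> X Y)"
  then obtain xs ys us vs where *: "ps = xs @ ys" "qs = vs @ us" "(xs, us) \<in> obj_ord X" "(ys, vs) \<in> obj_ord Y"
    by (auto simp: model_simps)
  with has_arityD[OF has_arity_obj_ord *(3)] has_arityD[OF has_arity_obj_ord *(4)]
  show "(take (length X) ps, drop (length Y) qs) \<in> obj_ord X \<and> (drop (length X) ps, take (length Y) qs) \<in> obj_ord Y"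
    by simp
next
  assume "(take (length X) ps, drop (length Y) qs) \<in> obj_ord X \<and> (drop (length X) ps, take (length Y) qs) \<in> obj_ord Y"
  then show "(ps, qs) \<in> model (\<sigma> X Y)"
    unfolding model_simps by (metis (mono_tags, lifting) append_take_drop_id mem_Collect_eq)
qed

lemmas mem_rules = mem_seq mem_par model_simps(1,2) mem_model_gen mem_one mem_sym numeral_2_eq_2 sw_def ex_length

lemma subset_listI:
  assumes "src d = X" "tgt d = Y"
   "\<And>xs ys. length xs = length X \<Longrightarrow> length ys = length Y \<Longrightarrow> (xs, ys) \<in> model d \<Longrightarrow> (xs, ys) \<in> model d'"
  shows "model d \<subseteq> model d'"
  using has_arityD[OF model_arity, of _ _ d] assms by auto

text \<open>For most axioms every intermediate wire can be given the extreme value its bound allows,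
  found by unification with \<open>sb_refl\<close>. D5 and E12 need chosen witnesses, E8 and E9 the
  bijectivity of \<open>ext\<close>.\<close>

lemma eq_axiom_sound: "kda_eq_axiom f g \<Longrightarrow> model f \<subseteq> model g \<and> model g \<subseteq> model f"
proof (induction rule: kda_eq_axiom.induct)
  case C1
  show ?case
    by (rule conjI; rule subset_listI, (simp add: sw_def)+, clarsimp simp: length_Suc_conv,
      (clarsimp simp: mem_rules simp del: obj_ord.simps length_0_conv length_Suc_conv)?,
        (intro exI conjI; (rule sb_refl)?)?, ((force simp: sb_def)+)?)
next
  case C3
  show ?case
    by (rule conjI; rule subset_listI, (simp add: sw_def)+, clarsimp simp: length_Suc_conv,
      (clarsimp simp: mem_rules simp del: obj_ord.simps length_0_conv length_Suc_conv)?,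
        (intro exI conjI; (rule sb_refl)?)?, ((force simp: sb_def)+)?)
next
  case D5
  show ?case
  proof
    show "model (\<^bold>m ;; \<^bold>C) \<subseteq> model ((\<^bold>C \<oplus> \<^bold>C) ;; \<^bold>s ;; (\<^bold>m \<oplus> \<^bold>m))"
    proof (rule subset_listI, (simp add: sw_def)+, clarsimp simp: length_Suc_conv,
      clarsimp simp: mem_rules simp del: obj_ord.simps length_0_conv length_Suc_conv)
      fix x y z u v
      assume *: "sb (x \<union> y) v" "sb v (z \<union> u)"
      show "\<exists>k l m n. (\<exists>a b. sb x (a \<union> b) \<and> (\<exists>c d. sb y (c \<union> d) \<and> sb a k \<and> sb b m \<and> sb c l \<and> sb d n)) \<and>
          sb (k \<union> l) z \<and> sb (m \<union> n) u"
        \<comment> \<open>Each of the two inputs \<open>x\<close> and \<open>y\<close> is cut along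
          the two outputs \<open>z\<close> and \<open>u\<close>.\<close>
        by (rule exI[of _ "x \<inter> z"], rule exI[of _ "y \<inter> z"], rule exI[of _ "x \<inter> u"], rule exI[of _ "y \<inter> u"],
          rule conjI, rule exI[of _ "x \<inter> z"], rule exI[of _ "x \<inter> u"], rule conjI[OF _ exI[of _ "y \<inter> z"]],
          insert *, unfold sb_def, blast, rule exI[of _ "y \<inter> u"], blast, blast)
    qed
    show "model ((\<^bold>C \<oplus> \<^bold>C) ;; \<^bold>s ;; (\<^bold>m \<oplus> \<^bold>m)) \<subseteq> model (\<^bold>m ;; \<^bold>C)"
      by (rule subset_listI, (simp add: sw_def)+, clarsimp simp: length_Suc_conv,
        (clarsimp simp: mem_rules simp del: obj_ord.simps length_0_conv length_Suc_conv)?, (intro exI conjI)?,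
          ((rule sb_refl | (force simp: sb_def))+)?)
  qed
next
  case (E8 a)
  show ?case
  proof
    show "model ((letter a \<oplus> letter a) ;; \<^bold>M) \<subseteq> model (\<^bold>M ;; letter a)"
      by (rule subset_listI, (simp add: sw_def)+, clarsimp simp: length_Suc_conv,
        (clarsimp simp: mem_rules simp del: obj_ord.simps length_0_conv length_Suc_conv)?, (intro exI conjI)?,
          ((rule sb_refl | (force simp: sb_def))+)?)
    show "model (\<^bold>M ;; letter a) \<subseteq> model ((letter a \<oplus> letter a) ;; \<^bold>M)"
    proof (rule subset_listI, (simp add: sw_def)+, clarsimp simp: length_Suc_conv,
      clarsimp simp: mem_rules simp del: obj_ord.simps length_0_conv length_Suc_conv)
      fix x y z u
      assume *: "sb (x \<inter> y) u" "sb (ext a ` u) z"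
      have "ext a ` x \<inter> ext a ` y \<subseteq> z"
        using * image_Int[OF inj_ext, of a x y] unfolding sb_def by blast
      then show "\<exists>v. sb (ext a ` x) v \<and> (\<exists>w. sb (ext a ` y) w \<and> sb (v \<inter> w) z)"
        unfolding sb_def by blast
    qed
  qed
next
  case (E9 a)
  show ?case
  proof
    show "model \<^bold>N \<subseteq> model (\<^bold>N ;; letter a)"
      by (rule subset_listI, (simp add: sw_def)+, clarsimp simp: length_Suc_conv,
        (clarsimp simp: mem_rules simp del: obj_ord.simps length_0_conv length_Suc_conv)?, (intro exI conjI)?,
          ((rule sb_refl | (force simp: sb_def))+)?)
    show "model (\<^bold>N ;; letter a) \<subseteq> model \<^bold>N"
    proof (rule subset_listI, (simp add: sw_def)+, clarsimp simp: length_Suc_conv,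
      clarsimp simp: mem_rules simp del: obj_ord.simps length_0_conv length_Suc_conv)
      fix x y
      assume *: "sb UNIV y" "sb (ext a ` y) x"
      \<comment> \<open>This is the step that fails for plain appending, whose image misses the
        empty word and all words with another last letter.\<close>
      then show "sb UNIV x"
        using surj_ext[of a] unfolding sb_def by blast
    qed
  qed
next
  case (E12 a)
  show ?case
  proof
    show "model (\<^bold>C ;; (letter a \<oplus> letter a)) \<subseteq> model (letter a ;; \<^bold>C)"
      by (rule subset_listI, (simp add: sw_def)+, clarsimp simp: length_Suc_conv,
        (clarsimp simp: mem_rules simp del: obj_ord.simps length_0_conv length_Suc_conv)?, (intro exI conjI)?,
          ((rule sb_refl | (force simp: sb_def))+)?)
    show "model (letter a ;; \<^bold>C) \<subseteq> model (\<^bold>C ;; (letter a \<oplus> letter a))"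
    proof (rule subset_listI, (simp add: sw_def)+, clarsimp simp: length_Suc_conv,
      clarsimp simp: mem_rules simp del: obj_ord.simps length_0_conv length_Suc_conv)
      fix x y z u
      assume *: "sb (ext a ` x) u" "sb u (y \<union> z)"
      show "\<exists>v w. sb x (v \<union> w) \<and> sb (ext a ` v) y \<and> sb (ext a ` w) z"
        by (rule exI[of _ "ext a -` y"], rule exI[of _ "ext a -` z"]) (use * in \<open>auto simp: sb_def\<close>)
    qed
  qed
qed ((rule conjI; rule subset_listI, (simp add: sw_def)+, clarsimp simp: length_Suc_conv,
  (clarsimp simp: mem_rules simp del: obj_ord.simps length_0_conv length_Suc_conv)?, (intro exI conjI)?,
    ((rule sb_refl | (force simp: sb_def))+)?)+)

lemma le_axiom_sound: "kda_le_axiom f g \<Longrightarrow> model f \<subseteq> model g"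
  by (induction rule: kda_le_axiom.induct; rule subset_listI, (simp add: sw_def)+,
    clarsimp simp: length_Suc_conv, (clarsimp simp: mem_rules simp del: obj_ord.simps length_0_conv
      length_Suc_conv)?, (intro exI conjI)?, ((rule sb_refl | (force simp: sb_def))+)?)

section \<open>Membership in the model\<close>

lemma rel_par_mono: "Q \<subseteq> Q' \<Longrightarrow> S \<subseteq> S' \<Longrightarrow> rel_par Q S \<subseteq> rel_par Q' S'"
  unfolding rel_par_def by blast

lemma kda_le_sound: "f \<le>\<^sub>K\<^sub>D\<^sub>A g \<Longrightarrow> model f \<subseteq> model g"
proof (induction rule: kda_le.induct)
  case (seq f f' g g')
  then have "tgt f' = src g'" using kda_le_typing by metis
  then show ?case using seq by (simp add: model_simps relcomp_mono)
next
  case (par f f' g g')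
  then show ?case by (simp add: model_simps rel_par_mono)
qed (use eq_axiom_sound le_axiom_sound in blast)+

text \<open>Soundness is what makes the model, unlike the language semantics, well defined on KDA
  classes.\<close>

lift_definition kmodel :: "'a kd \<Rightarrow> 'a option lrel" is model
  using kda_le_sound unfolding kda_eq_def by blast

lemma kmodel_mono: "f \<le> g \<Longrightarrow> kmodel f \<subseteq> kmodel g"
  by transfer (rule kda_le_sound)

lemma kmodel_simps:
  "kmodel (ge x) = model_gen x" "kmodel (one X) = obj_ord X"
  "cod f = dom g \<Longrightarrow> kmodel (f >> g) = kmodel f O kmodel g" "kmodel (f || g) = rel_par (kmodel f) (kmodel g)"
  by (transfer; simp add: model_simps)+

lemma kmodel_sy: "kmodel (sy X Y) = {(xs @ ys, vs @ us) | xs ys us vs. (xs, us) \<in> obj_ord X \<and> (ys, vs) \<in> obj_ord Y}"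
  by transfer (simp add: model_simps)

lemma kmodel_arity: "has_arity (kmodel d) (length (dom d)) (length (cod d))"
  by transfer (rule model_arity)

section \<open>Languages over the original alphabet inside the model\<close>

abbreviation embed :: "'a lang \<Rightarrow> 'a option lang" where "embed K \<equiv> map Some ` K"
abbreviation restrict :: "'a option lang \<Rightarrow> 'a lang" where "restrict K \<equiv> map Some -` K"

lemma restrict_embed: "restrict (embed K) = K"
  by (auto simp: inj_vimage_image_eq inj_map_eq_map)

lemma obj_ord_map:
  assumes "mono f"
  shows "(xs, ys) \<in> obj_ord X \<Longrightarrow> (map f xs, map f ys) \<in> obj_ord X"
proof (induction X arbitrary: xs ys)
  case (Cons w X)
  then obtain a as b bs where *: "xs = a @ as" "ys = b @ bs" "(a, b) \<in> wire_ord w" "(as, bs) \<in> obj_ord X"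
    by (auto elim: rel_parE)
  have "(map f a, map f b) \<in> wire_ord w"
    using *(3) monoD[OF assms] by (cases w) auto
  then show ?case using * Cons.IH by (simp add: rel_parI)
qed auto

text \<open>The restriction to automaton diagrams matters: the white unit forces the language
  \<open>UNIV\<close>, which \<open>embed\<close> does not preserve.\<close>

lemma sem_embed: "automaton_diagram d \<Longrightarrow> (xs, ys) \<in> \<lbrakk>d\<rbrakk> \<Longrightarrow> (map embed xs, map embed ys) \<in> model d"
proof (induction arbitrary: xs ys rule: automaton_diagram.induct)
  case (gen g)
  then show ?case
    by (auto simp: automaton_gens_def sem_simps model_simps model_gen_def image_image ext_map image_subset_iff
      subset_iff simp del: map_append)
next
  case (idn X)
  then show ?case by (simp add: sem_simps model_simps obj_ord_map monoI image_mono)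
next
  case (symm X Y)
  then obtain as bs cs ds where *: "xs = as @ bs" "ys = ds @ cs" "(as, cs) \<in> obj_ord X" "(bs, ds) \<in> obj_ord Y"
    by (auto simp: sem_simps model_simps)
  have m: "mono (embed :: _ \<Rightarrow> 'a option lang)" by (simp add: monoI image_mono)
  from obj_ord_map[OF m *(3)] obj_ord_map[OF m *(4)] show ?case
    unfolding sem_simps model_simps *(1,2) map_append by blast
next
  case (seq f g)
  then show ?case by (auto simp: sem_simps model_simps intro!: relcompI)
next
  case (par f g)
  then show ?case by (auto simp: sem_simps model_simps elim!: rel_parE intro!: rel_parI)
qed

lemma sem_restrict: "automaton_diagram d \<Longrightarrow> (xs, ys) \<in> model d \<Longrightarrow> (map restrict xs, map restrict ys) \<in> \<lbrakk>d\<rbrakk>"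
proof (induction arbitrary: xs ys rule: automaton_diagram.induct)
  case (gen g)
  then show ?case
    by (auto simp: automaton_gens_def sem_simps model_simps model_gen_def image_subset_iff subset_iff
      ext_map[symmetric] simp del: map_append)
next
  case (idn X)
  then show ?case by (simp add: sem_simps model_simps obj_ord_map monoI vimage_mono)
next
  case (symm X Y)
  then obtain as bs cs ds where *: "xs = as @ bs" "ys = ds @ cs" "(as, cs) \<in> obj_ord X" "(bs, ds) \<in> obj_ord Y"
    by (auto simp: sem_simps model_simps)
  have m: "mono (restrict :: _ \<Rightarrow> 'a lang)" by (simp add: monoI vimage_mono)
  from obj_ord_map[OF m *(3)] obj_ord_map[OF m *(4)] show ?case
    unfolding sem_simps model_simps *(1,2) map_append by blast
next
  case (seq f g)
  then show ?case by (auto simp: sem_simps model_simps intro!: relcompI)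
next
  case (par f g)
  then show ?case by (auto simp: sem_simps model_simps elim!: rel_parE intro!: rel_parI)
qed

lemma sem_iff: "automaton_diagram d \<Longrightarrow> (xs, ys) \<in> \<lbrakk>d\<rbrakk> \<longleftrightarrow> (map embed xs, map embed ys) \<in> model d"
  using sem_embed[of d xs ys] sem_restrict[of d "map embed xs" "map embed ys"]
  by (auto simp: o_def restrict_embed)

lemma obj_ord_left: "(xs, ys) \<in> obj_ord (dom f) \<Longrightarrow> (ys, zs) \<in> kmodel f \<Longrightarrow> (xs, zs) \<in> kmodel f"
  using kmodel_simps(3)[of "one (dom f)" f] by (auto simp: kmodel_simps)

lemma obj_ord_right: "(xs, ys) \<in> kmodel f \<Longrightarrow> (ys, zs) \<in> obj_ord (cod f) \<Longrightarrow> (xs, zs) \<in> kmodel f"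
  using kmodel_simps(3)[of f "one (cod f)"] by (auto simp: kmodel_simps)

lemma kmodel_pr: "(xs, us) \<in> kmodel f \<Longrightarrow> (ys, vs) \<in> kmodel g \<Longrightarrow> (xs @ ys, us @ vs) \<in> kmodel (f || g)"
  by (simp add: kmodel_simps rel_parI)

lemma kmodel_pr_iff:
  assumes "length xs = length (dom f)" "length us = length (cod f)"
  shows "(xs @ ys, us @ vs) \<in> kmodel (f || g) \<longleftrightarrow> (xs, us) \<in> kmodel f \<and> (ys, vs) \<in> kmodel g"
proof
  assume "(xs @ ys, us @ vs) \<in> kmodel (f || g)"
  then obtain a b c d where *: "xs @ ys = a @ b" "us @ vs = c @ d" "(a, c) \<in> kmodel f" "(b, d) \<in> kmodel g"
    by (auto simp: kmodel_simps elim: rel_parE)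
  with has_arityD[OF kmodel_arity *(3)] assms show "(xs, us) \<in> kmodel f \<and> (ys, vs) \<in> kmodel g" by auto
qed (auto intro: kmodel_pr)

lemma kmodel_sq: "cod f = dom g \<Longrightarrow> (xs, ys) \<in> kmodel f \<Longrightarrow> (ys, zs) \<in> kmodel g \<Longrightarrow> (xs, zs) \<in> kmodel (f >> g)"
  by (auto simp: kmodel_simps)

lemma kmodel_one: "length xs = length X \<Longrightarrow> (xs, xs) \<in> kmodel (one X)"
  by (simp add: kmodel_simps obj_ord_refl)

lemma kmodel_disc: "length xs = p \<Longrightarrow> (xs, []) \<in> kmodel (disc p)"
proof (induction p arbitrary: xs)
  case 0
  then show ?case by (simp add: kmodel_simps)
next
  case (Suc p)
  then obtain x xs' where "xs = x # xs'" "length xs' = p" by (auto simp: length_Suc_conv)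
  moreover have "([x], []) \<in> kmodel kk" by (simp add: kmodel_simps mem_model_gen)
  ultimately show ?case using kmodel_pr[of "[x]" "[]" kk xs' "[]" "disc p"] Suc.IH by simp
qed

lemma kmodel_sy_refl: "length xs = length X \<Longrightarrow> length ys = length Y \<Longrightarrow> (xs @ ys, ys @ xs) \<in> kmodel (sy X Y)"
  unfolding kmodel_sy using obj_ord_refl by blast

lemma kmodel_copy: "length xs = p \<Longrightarrow> (xs, xs @ xs) \<in> kmodel (copy p)"
proof (induction p arbitrary: xs)
  case 0
  then show ?case by (simp add: kmodel_simps)
next
  case (Suc p)
  then obtain x xs' where x: "xs = x # xs'" "length xs' = p" by (auto simp: length_Suc_conv)
  have "([x], [x, x]) \<in> kmodel cc" by (simp add: kmodel_simps mem_model_gen sb_def)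
  from kmodel_pr[OF this Suc.IH[OF x(2)]] have "(x # xs', x # x # xs' @ xs') \<in> kmodel (cc || copy p)" by simp
  moreover have "([x] @ ([x] @ xs') @ xs', [x] @ (xs' @ [x]) @ xs') \<in> kmodel (i1 || sy [\<triangleright>] (R p) || one (R p))"
    by (intro kmodel_pr kmodel_one kmodel_sy_refl) (simp_all add: x)
  ultimately show ?case
    using kmodel_sq[of "cc || copy p" "i1 || sy [\<triangleright>] (R p) || one (R p)" "x # xs'" "x # x # xs' @ xs'"] by (simp add: x)
qed

lemma kmodel_proj: "length xs = p \<Longrightarrow> i < p \<Longrightarrow> (xs, [xs ! i]) \<in> kmodel (proj p i)"
proof -
  assume a: "length xs = p" "i < p"
  have "(take i xs @ [xs ! i] @ drop (Suc i) xs, [] @ [xs ! i] @ []) \<in> kmodel (proj p i)"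
    unfolding proj_def by (intro kmodel_pr kmodel_one kmodel_disc) (use a in simp_all)
  then show ?thesis using a by (simp add: id_take_nth_drop[symmetric])
qed

lemma kmodel_projD: "(xs, [K]) \<in> kmodel (proj p i) \<Longrightarrow> i < p \<Longrightarrow> xs ! i \<subseteq> K"
proof -
  assume a: "(xs, [K]) \<in> kmodel (proj p i)" "i < p"
  have l: "length xs = p" using has_arityD[OF kmodel_arity a(1)] a(2) by simp
  have "(take i xs @ [xs ! i] @ drop (Suc i) xs, [] @ [K] @ []) \<in> kmodel (disc i || i1 || disc (p - Suc i))"
    using a l by (simp add: id_take_nth_drop[symmetric] proj_def)
  then have "([xs ! i] @ drop (Suc i) xs, [K] @ []) \<in> kmodel (i1 || disc (p - Suc i))"
    by (subst (asm) kmodel_pr_iff) (use a l in simp_all)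
  then have "([xs ! i], [K]) \<in> kmodel i1"
    by (subst (asm) kmodel_pr_iff) simp_all
  then show ?thesis by (auto simp: kmodel_simps)
qed

lemma kmodel_trm_mono: "trm1 p t \<Longrightarrow> (xs, [K]) \<in> kmodel t \<Longrightarrow> K \<subseteq> K' \<Longrightarrow> (xs, [K']) \<in> kmodel t"
  by (rule obj_ord_right[of _ "[K]"]) (auto simp: trm1_typing)

lemma kmodel_JN: "\<forall>t\<in>set ts. trm1 p t \<and> (xs, [K]) \<in> kmodel t \<Longrightarrow> length xs = p \<Longrightarrow> (xs, [K]) \<in> kmodel (JN p ts)"
proof (induction ts)
  case Nil
  have "([], [K]) \<in> kmodel nn" by (simp add: kmodel_simps mem_model_gen sb_def)
  with kmodel_disc[OF Nil(2)] show ?case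
    unfolding JN_simps bt_def by (intro kmodel_sq) simp_all
next
  case (Cons t ts)
  then have t: "trm1 p t" "(xs, [K]) \<in> kmodel t" and ts: "trm1 p (JN p ts)" "(xs, [K]) \<in> kmodel (JN p ts)"
    by (simp_all add: trm1_JN)
  have m: "([K] @ [K], [K]) \<in> kmodel mm" by (simp add: kmodel_simps mem_model_gen sb_def)
  show ?case
    unfolding JN_simps jn_def
    by (intro kmodel_sq[OF _ kmodel_copy[OF Cons.prems(2)] kmodel_sq[OF _ kmodel_pr[OF t(2) ts(2)] m]])
      (simp_all add: trm1_typing[OF t(1)] trm1_typing[OF ts(1)])
qed

lemma kmodel_lin: "length xs = p \<Longrightarrow> (\<And>i. i < p \<Longrightarrow> P i \<Longrightarrow> xs ! i \<subseteq> K) \<Longrightarrow> (xs, [K]) \<in> kmodel (lin p P)"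
  unfolding lin_def
  by (rule kmodel_JN) (auto intro: trm1_proj kmodel_trm_mono[OF trm1_proj kmodel_proj])

lemma kmodel_tuple: "\<forall>t\<in>set ts. trm1 p t \<Longrightarrow> length xs = p \<Longrightarrow> length ys = length ts \<Longrightarrow>
    (\<And>j. j < length ts \<Longrightarrow> (xs, [ys ! j]) \<in> kmodel (ts ! j)) \<Longrightarrow> (xs, ys) \<in> kmodel (tuple p ts)"
proof (induction ts arbitrary: ys)
  case Nil
  then show ?case by (simp add: tuple_simps kmodel_disc)
next
  case (Cons t ts)
  then obtain y ys' where y: "ys = [y] @ ys'" "length ys' = length ts" by (auto simp: length_Suc_conv)
  have t: "trm1 p t" and ts: "cmap p (length ts) (tuple p ts)" using Cons.prems(1) by (simp_all add: cmap_tuple)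
  have 1: "(xs, [y]) \<in> kmodel t" using Cons.prems(4)[of 0] y by simp
  have 2: "(xs, ys') \<in> kmodel (tuple p ts)"
    using Cons.prems(4)[of "Suc _"] y by (intro Cons.IH) (use Cons.prems in simp_all)
  show ?case unfolding tuple_simps y
    by (intro kmodel_sq[OF _ kmodel_copy[OF Cons.prems(2)] kmodel_pr[OF 1 2]]) (simp add: trm1_typing[OF t]
      cmapD[OF ts])
qed

text \<open>For the converse, \<open>cmap_eqI\<close> shows that \<open>f\<close> is the tuple of
  the columns of its matrix, and membership in that tuple can be computed column by column.\<close>

lemma kmodel_has_matrix:
  fixes f :: "'a kd"
  assumes "has_matrix p q f S" "length xs = p" "length ys = q"
  shows "(xs, ys) \<in> kmodel f \<longleftrightarrow> (\<forall>i<p. \<forall>j<q. S i j \<longrightarrow> xs ! i \<subseteq> ys ! j)"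
proof
  note [simp] = cmapD(1,2)[OF has_matrixD(1)[OF assms(1)]]
  assume a: "(xs, ys) \<in> kmodel f"
  show "\<forall>i<p. \<forall>j<q. S i j \<longrightarrow> xs ! i \<subseteq> ys ! j"
  proof (intro allI impI)
    fix i j assume ij: "i < p" "j < q" "S i j"
    have "(xs, [ys ! j]) \<in> kmodel (f >> proj q j)"
      by (rule kmodel_sq[OF _ a kmodel_proj]) (use ij assms in simp_all)
    also have "f >> proj q j = lin p (\<lambda>i. S i j)" by (rule has_matrixD(2)[OF assms(1) ij(2)])
    also have "kmodel (lin p (\<lambda>i. S i j)) \<subseteq> kmodel (proj p i)" by (intro kmodel_mono lin_le ij)
    finally show "xs ! i \<subseteq> ys ! j" using kmodel_projD ij by blast
  qed
next
  assume a: "\<forall>i<p. \<forall>j<q. S i j \<longrightarrow> xs ! i \<subseteq> ys ! j"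
  let ?ts = "map (\<lambda>j. lin p (\<lambda>i. S i j) :: 'a kd) [0..<q]"
  have t: "\<forall>t\<in>set ?ts. trm1 p t" by (simp add: trm1_lin)
  have "f = tuple p ?ts"
  proof (rule cmap_eqI)
    show "cmap p q f" by (rule has_matrixD(1)[OF assms(1)])
    show "cmap p q (tuple p ?ts)" using cmap_tuple[OF t] by simp
    show "f >> proj q j = tuple p ?ts >> proj q j" if "j < q" for j
    proof -
      have "tuple p ?ts >> proj q j = lin p (\<lambda>i. S i j)" using tuple_proj[OF t, of j] that by simp
      then show ?thesis by (simp only: has_matrixD(2)[OF assms(1) that])
    qed
  qed
  moreover have "(xs, ys) \<in> kmodel (tuple p ?ts)"
    by (rule kmodel_tuple[OF t]) (use assms a in \<open>auto intro: kmodel_lin\<close>)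
  ultimately show "(xs, ys) \<in> kmodel f" by simp
qed

lemma kmodel_letters:
  "length xs = length as \<Longrightarrow> length ys = length as \<Longrightarrow>
   (xs, ys) \<in> kmodel (letters as) \<longleftrightarrow> (\<forall>i<length as. ext (as ! i) ` (xs ! i) \<subseteq> ys ! i)"
proof (induction as arbitrary: xs ys)
  case Nil
  then show ?case by (simp add: kmodel_simps)
next
  case (Cons a as)
  then obtain x xs' y ys' where *: "xs = [x] @ xs'" "ys = [y] @ ys'" "length xs' = length as" "length ys' = length as"
    by (auto simp: length_Suc_conv)
  have "(xs, ys) \<in> kmodel (letters (a # as)) \<longleftrightarrow> ext a ` x \<subseteq> y \<and> (xs', ys') \<in> kmodel (letters as)"
    unfolding * letters.simps by (subst kmodel_pr_iff) (simp_all add: kmodel_simps mem_model_gen sb_def)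
  also have "\<dots> \<longleftrightarrow> (\<forall>i<Suc (length as). ext ((a # as) ! i) ` (xs ! i) \<subseteq> ys ! i)"
    unfolding Cons.IH[OF *(3,4)] by (simp add: * All_less_Suc2)
  finally show ?case by simp
qed

lemma obj_ord_R: "(xs, ys) \<in> obj_ord (R n) \<longleftrightarrow> length xs = n \<and> list_all2 (\<subseteq>) xs ys"
proof (induction n arbitrary: xs ys)
  case (Suc n)
  show ?case
  proof
    assume "(xs, ys) \<in> obj_ord (R (Suc n))"
    then show "length xs = Suc n \<and> list_all2 (\<subseteq>) xs ys" by (auto simp: Suc elim!: rel_parE)
  next
    assume "length xs = Suc n \<and> list_all2 (\<subseteq>) xs ys"
    then obtain x xs' y ys' where *: "xs = [x] @ xs'" "ys = [y] @ ys'" "x \<subseteq> y" "length xs' = n" "list_all2 (\<subseteq>) xs' ys'"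
      by (auto simp: length_Suc_conv list_all2_Cons1)
    show "(xs, ys) \<in> obj_ord (R (Suc n))" unfolding * replicate_Suc obj_ord.simps
      by (rule rel_parI) (simp_all add: Suc *)
  qed
qed auto

lemma obj_ord_L: "(xs, ys) \<in> obj_ord (L n) \<longleftrightarrow> length xs = n \<and> list_all2 (\<subseteq>) ys xs"
proof (induction n arbitrary: xs ys)
  case (Suc n)
  show ?case
  proof
    assume "(xs, ys) \<in> obj_ord (L (Suc n))"
    then show "length xs = Suc n \<and> list_all2 (\<subseteq>) ys xs" by (auto simp: Suc elim!: rel_parE)
  next
    assume "length xs = Suc n \<and> list_all2 (\<subseteq>) ys xs"
    then obtain x xs' y ys' where *: "xs = [x] @ xs'" "ys = [y] @ ys'" "y \<subseteq> x" "length xs' = n" "list_all2 (\<subseteq>) ys' xs'"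
      by (auto simp: length_Suc_conv list_all2_Cons2)
    show "(xs, ys) \<in> obj_ord (L (Suc n))" unfolding * replicate_Suc obj_ord.simps
      by (rule rel_parI) (simp_all add: Suc *)
  qed
qed auto

lemma obj_ord_L_rev: "(xs, ys) \<in> obj_ord (L n) \<Longrightarrow> (rev ys, rev xs) \<in> obj_ord (R n)"
  by (auto simp: obj_ord_L obj_ord_R list_all2_lengthD)

lemma kmodel_co_refl: "length xs = n \<Longrightarrow> ([], rev xs @ xs) \<in> kmodel (co (R n))"
proof (induction n arbitrary: xs)
  case 0
  then show ?case by (simp add: kmodel_simps)
next
  case (Suc n)
  then obtain x xs' where *: "xs = x # xs'" "length xs' = n" by (auto simp: length_Suc_conv)
  have "([], [x, x]) \<in> kmodel cu" by (simp add: kmodel_simps mem_model_gen sb_def)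
  then have "(rev xs' @ [] @ xs', rev xs' @ [x, x] @ xs') \<in> kmodel (one (L n) || cu || one (R n))"
    by (intro kmodel_pr kmodel_one) (simp_all add: *)
  with Suc.IH[OF *(2)] show ?case
    using kmodel_sq[of "co (R n)" "one (L n) || cu || one (R n)" "[]" "rev xs' @ xs'"] by (simp add: *)
qed

lemma kmodel_ev_refl: "length xs = n \<Longrightarrow> (rev xs @ xs, []) \<in> kmodel (ev (R n))"
proof (induction n arbitrary: xs)
  case 0
  then show ?case by (simp add: kmodel_simps)
next
  case (Suc n)
  then obtain x xs' where *: "xs = x # xs'" "length xs' = n" by (auto simp: length_Suc_conv)
  have "([x, x], []) \<in> kmodel ca" by (simp add: kmodel_simps mem_model_gen sb_def)
  then have "(rev xs' @ [x, x] @ xs', rev xs' @ [] @ xs') \<in> kmodel (one (L n) || ca || one (R n))"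
    by (intro kmodel_pr kmodel_one) (simp_all add: *)
  with Suc.IH[OF *(2)] show ?case
    using kmodel_sq[of "one (L n) || ca || one (R n)" "ev (R n)" _ "rev xs' @ xs'"] by (simp add: *)
qed

lemma kmodel_co_elim: "([], zs) \<in> kmodel (co (R n)) \<Longrightarrow> \<exists>us vs. zs = rev us @ vs \<and> (us, vs) \<in> obj_ord (R n)"
proof (induction n arbitrary: zs)
  case 0
  then show ?case by (simp add: kmodel_simps)
next
  case (Suc n)
  then obtain ys where "([], ys) \<in> kmodel (co (R n))" "(ys, zs) \<in> kmodel (one (L n) || cu || one (R n))"
    by (auto simp: kmodel_simps(3))
  with Suc.IH obtain us vs where u: "(us, vs) \<in> obj_ord (R n)" "(rev us @ vs,
    zs) \<in> kmodel (one (L n) || cu || one (R n))"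
    by blast
  then obtain a b a' b' x y where *: "rev us @ vs = a' @ b'" "zs = a @ [x, y] @ b" "x \<subseteq> y"
    "(a', a) \<in> obj_ord (L n)" "(b', b) \<in> obj_ord (R n)"
    by (auto simp: kmodel_simps model_gen_def elim!: rel_parE)
  have "length us = n" "length a' = n" using u(1) *(4) by (simp_all add: obj_ord_R obj_ord_L)
  with *(1) have "a' = rev us" "b' = vs" by simp_all
  with * u(1) have "(rev a, b) \<in> obj_ord (R n)" using obj_ord_L_rev[OF *(4)] obj_ord_trans by (metis rev_rev_ident)
  with *(3) have "(x # rev a, y # b) \<in> obj_ord (R (Suc n))" unfolding obj_ord_R by simp
  moreover have "zs = rev (x # rev a) @ y # b" by (simp add: *)
  ultimately show ?case by blast
qed

lemma kmodel_ev_elim: "(zs, []) \<in> kmodel (ev (R n)) \<Longrightarrow> \<exists>us vs. zs = rev us @ vs \<and> (vs, us) \<in> obj_ord (R n)"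
proof (induction n arbitrary: zs)
  case 0
  then show ?case by (simp add: kmodel_simps)
next
  case (Suc n)
  then obtain ys where "(ys, []) \<in> kmodel (ev (R n))" "(zs, ys) \<in> kmodel (one (L n) || ca || one (R n))"
    by (auto simp: kmodel_simps(3))
  with Suc.IH obtain us vs where u: "(vs, us) \<in> obj_ord (R n)" "(zs,
    rev us @ vs) \<in> kmodel (one (L n) || ca || one (R n))"
    by blast
  then obtain a b a' b' x y where *: "rev us @ vs = a' @ b'" "zs = a @ [x, y] @ b" "y \<subseteq> x"
    "(a, a') \<in> obj_ord (L n)" "(b, b') \<in> obj_ord (R n)"
    by (auto simp: kmodel_simps model_gen_def elim!: rel_parE)
  have "length us = n" "length a' = n" using u(1) *(4) by (auto simp: obj_ord_R obj_ord_L list_all2_lengthD)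
  with *(1) have "a' = rev us" "b' = vs" by simp_all
  with * u(1) have "(b, rev a) \<in> obj_ord (R n)" using obj_ord_L_rev[OF *(4)] obj_ord_trans by (metis rev_rev_ident)
  with *(3) have "(y # b, x # rev a) \<in> obj_ord (R (Suc n))" unfolding obj_ord_R by simp
  moreover have "zs = rev (x # rev a) @ y # b" by (simp add: *)
  ultimately show ?case by blast
qed

lemma kmodel_trI:
  assumes "dom F = R q @ A" "cod F = R q @ B" "length xs = q" "(xs @ zs, xs @ ws) \<in> kmodel F"
  shows "(zs, ws) \<in> kmodel (tr (R q) A B F)"
proof -
  have l: "length zs = length A" "length ws = length B" using has_arityD[OF kmodel_arity assms(4)] assms by simp_all
  have "([] @ zs, (rev xs @ xs) @ zs) \<in> kmodel (co (R q) || one A)"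
    by (intro kmodel_pr kmodel_co_refl kmodel_one) (simp_all add: assms l)
  moreover have "(rev xs @ xs @ zs, rev xs @ xs @ ws) \<in> kmodel (one (L q) || F)"
    by (intro kmodel_pr kmodel_one) (simp_all add: assms)
  moreover have "((rev xs @ xs) @ ws, [] @ ws) \<in> kmodel (ev (R q) || one B)"
    by (intro kmodel_pr kmodel_ev_refl kmodel_one) (simp_all add: assms l)
  ultimately show ?thesis unfolding tr_def
    by (subst kmodel_simps(3), simp add: assms) (subst kmodel_simps(3), simp add: assms, auto)
qed

text \<open>Cups and caps carry inclusions, so a loop only forces the value \<open>x\<close> fed in
  to contain the value \<open>y\<close> that comes out.\<close>

lemma kmodel_trE:
  assumes "dom F = R q @ A" "cod F = R q @ B" "(zs, ws) \<in> kmodel (tr (R q) A B F)"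
  shows "\<exists>x y. (y, x) \<in> obj_ord (R q) \<and> (x @ zs, y @ ws) \<in> kmodel F"
proof -
  have l: "length zs = length A" "length ws = length B" using has_arityD[OF kmodel_arity assms(3)] assms by simp_all
  obtain a b where "(zs, a) \<in> kmodel (co (R q) || one A)" "(a, b) \<in> kmodel (one (L q) || F)"
    "(b, ws) \<in> kmodel (ev (R q) || one B)"
    using assms(3) unfolding tr_def
    by (subst (asm) kmodel_simps(3), simp add: assms) (subst (asm) kmodel_simps(3), simp add: assms, auto)
  note 1 = this
  from 1(1) obtain p r u zs' where u: "zs = p @ r" "a = u @ zs'" "(p, u) \<in> kmodel (co (R q))" "(r, zs') \<in> obj_ord A"
    by (auto simp: kmodel_simps elim!: rel_parE)
  from 1(3) obtain p' r' v ws' where v: "ws = p' @ r'" "b =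
    v @ ws'" "(v, p') \<in> kmodel (ev (R q))" "(ws', r') \<in> obj_ord B"
    by (auto simp: kmodel_simps elim!: rel_parE)
  have [simp]: "p = []" "p' = []" using has_arityD[OF kmodel_arity u(3)] has_arityD[OF kmodel_arity v(3)] by simp_all
  from kmodel_co_elim[of u q] obtain u1 u2 where u': "u = rev u1 @ u2" "(u1, u2) \<in> obj_ord (R q)" using u(3) by auto
  from kmodel_ev_elim[of v q] obtain v1 v2 where v': "v = rev v1 @ v2" "(v2, v1) \<in> obj_ord (R q)" using v(3) by auto
  have l': "length u1 = q" "length v1 = q" "length v2 = q" "length u2 = q"
    using u'(2) v'(2) by (auto simp: obj_ord_R list_all2_lengthD)
  have "(rev u1 @ u2 @ zs', rev v1 @ v2 @ ws') \<in> kmodel (one (L q) || F)"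
    using 1(2) by (simp add: u v u' v')
  then have "(rev u1, rev v1) \<in> obj_ord (L q) \<and> (u2 @ zs', v2 @ ws') \<in> kmodel F"
    by (subst (asm) kmodel_pr_iff) (simp_all add: l' kmodel_simps)
  then have 2: "(v1, u1) \<in> obj_ord (R q)" "(u2 @ zs', v2 @ ws') \<in> kmodel F"
    using obj_ord_L_rev[of "rev u1" "rev v1" q] by simp_all
  have "(v2, u2) \<in> obj_ord (R q)" using u'(2) v'(2) 2(1) obj_ord_trans by blast
  moreover have "(u2 @ zs, u2 @ zs') \<in> obj_ord (dom F)" "(v2 @ ws', v2 @ ws) \<in> obj_ord (cod F)"
    unfolding assms obj_ord_append using u(4) v(4) l' by (intro rel_parI obj_ord_refl; simp add: u(1) v(1))+
  ultimately show ?thesis using obj_ord_left obj_ord_right 2(2) by metis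
qed

section \<open>Completeness\<close>

text \<open>Defined through the model because \<open>sem\<close> does not factor through KDA
  equivalence; on automaton diagrams both agree (\<open>lang_sem_abs\<close>).\<close>

definition lang_sem :: "'a kd \<Rightarrow> 'a lrel" where
  "lang_sem F = {(xs, ys). (map embed xs, map embed ys) \<in> kmodel F}"

lemma lang_sem_abs: "automaton_diagram d \<Longrightarrow> lang_sem (abs_kd d) = \<lbrakk>d\<rbrakk>"
  by (auto simp: lang_sem_def kmodel.abs_eq sem_iff)

text \<open>For stable elements the intermediate values of a composition can be chosen in the image of \<open>embed\<close>,
  so that \<open>lang_sem\<close> preserves composition.\<close>

definition stable :: "'a kd \<Rightarrow> bool" where
  "stable F \<longleftrightarrow> (\<forall>xs ys. (xs, ys) \<in> kmodel F \<longrightarrow> (map embed (map restrict xs), map embed (map restrict ys)) \<in> kmodel F)"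

lemma stable_automaton: "automaton_diagram d \<Longrightarrow> stable (abs_kd d)"
  unfolding stable_def kmodel.abs_eq using sem_embed sem_restrict by blast

lemma stable_one: "stable (one X)"
proof -
  have "stable (abs_kd (idn X) :: 'a kd)" by (rule stable_automaton) (rule automaton_diagram.idn)
  then show ?thesis by (simp add: one.abs_eq)
qed

lemma stable_sy: "stable (sy X Y)"
  using stable_automaton[OF automaton_diagram.symm[of X Y]] by (simp add: sy.abs_eq)

lemma stable_cu: "stable cu" and stable_ca: "stable ca"
  using stable_automaton[OF automaton_diagram.gen[of Cup]] stable_automaton[OF automaton_diagram.gen[of Cap]]
  by (simp_all add: ge.abs_eq automaton_gens_def)

lemma stable_sq: "stable f \<Longrightarrow> stable g \<Longrightarrow> cod f = dom g \<Longrightarrow> stable (f >> g)"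
  unfolding stable_def by (auto simp: kmodel_simps intro!: relcompI)

lemma stable_pr: "stable f \<Longrightarrow> stable g \<Longrightarrow> stable (f || g)"
  unfolding stable_def by (auto simp: kmodel_simps elim!: rel_parE intro!: rel_parI)

lemma stable_struct: "struct f \<Longrightarrow> stable f"
  by (induction rule: struct.induct) (auto intro: stable_one stable_sy stable_sq stable_pr)

lemma stable_ev: "stable (ev X)"
proof (induction X)
  case (Cons w X)
  have "stable (ev1 w)" by (cases w) (auto intro!: stable_sq stable_sy stable_ca)
  then show ?case by (auto intro!: stable_sq stable_pr stable_one Cons)
qed (simp add: stable_one)

lemma stable_co: "stable (co X)"
proof (induction X)
  case (Cons w X)
  have "stable (co1 w)" by (cases w) (auto intro!: stable_sq stable_sy stable_cu)
  then show ?case by (auto intro!: stable_sq stable_pr stable_one Cons)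
qed (simp add: stable_one)

lemma lang_sem_sq:
  assumes "stable f" "stable g" "cod f = dom g"
  shows "lang_sem (f >> g) = lang_sem f O lang_sem g"
proof (intro set_eqI iffI; clarify)
  fix xs zs assume "(xs, zs) \<in> lang_sem (f >> g)"
  then obtain ys where "(map embed xs, ys) \<in> kmodel f" "(ys, map embed zs) \<in> kmodel g"
    by (auto simp: lang_sem_def kmodel_simps(3)[OF assms(3)])
  then have "(map embed (map restrict (map embed xs)), map embed (map restrict ys)) \<in> kmodel f"
    "(map embed (map restrict ys), map embed (map restrict (map embed zs))) \<in> kmodel g"
    using assms unfolding stable_def by blast+
  then have "(xs, map restrict ys) \<in> lang_sem f" "(map restrict ys, zs) \<in> lang_sem g"
    by (simp_all add: lang_sem_def o_def restrict_embed)
  then show "(xs, zs) \<in> lang_sem f O lang_sem g" by blast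
next
  fix xs ys zs assume "(xs, ys) \<in> lang_sem f" "(ys, zs) \<in> lang_sem g"
  then show "(xs, zs) \<in> lang_sem (f >> g)" by (auto simp: lang_sem_def kmodel_simps(3)[OF assms(3)])
qed

lemma lang_sem_pr: "lang_sem (f || g) = rel_par (lang_sem f) (lang_sem g)"
  by (auto simp: lang_sem_def kmodel_simps rel_par_def map_eq_append_conv) (metis map_append)

lemma lang_sem_sq_mono:
  "lang_sem f \<subseteq> lang_sem f' \<Longrightarrow> lang_sem g \<subseteq> lang_sem g' \<Longrightarrow> stable f \<Longrightarrow> stable g \<Longrightarrow> stable f' \<Longrightarrow> stable g' \<Longrightarrow>
   cod f = dom g \<Longrightarrow> cod f' = dom g' \<Longrightarrow> lang_sem (f >> g) \<subseteq> lang_sem (f' >> g')"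
  by (simp add: lang_sem_sq relcomp_mono)

lemma lang_sem_pr_mono: "lang_sem f \<subseteq> lang_sem f' \<Longrightarrow> lang_sem g \<subseteq> lang_sem g' \<Longrightarrow> lang_sem (f || g) \<subseteq> lang_sem (f' || g')"
  by (simp add: lang_sem_pr rel_par_mono)

text \<open>The solution generated by the empty word at input \<open>i\<close> alone: each state
  holds exactly the words of its runs, so each output holds the language from \<open>i\<close> to
  it.\<close>

lemma lang_sem_runs:
  assumes B: "has_matrix (length as + p) (length as + n) B S" and i: "i < p"
  shows "(map (\<lambda>r. if r = i then {[]} else {}) [0..<p],
     map (\<lambda>j. {w @ [as ! m] | m w. run as S i m w \<and> S m (length as + j)} \<union>
        {w. w = [] \<and> S (length as + i) (length as + j)}) [0..<n])
     \<in> lang_sem (automaton as p n B)"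
    (is "(?zs, ?ws) \<in> _")
proof -
  let ?q = "length as"
  note [simp] = cmapD(1,2)[OF has_matrixD(1)[OF B]]
  \<comment> \<open>\<open>xs\<close> collects the words reaching each state before its letter is
    emitted, and is the value on the loop; \<open>ys\<close> collects them after the letter.\<close>
  define xs where "xs = map (\<lambda>m. embed {w. run as S i m w}) [0..<?q]"
  define ys where "ys = map (\<lambda>m. embed {w @ [as ! m] | w. run as S i m w}) [0..<?q]"
  have l [simp]: "length xs = ?q" "length ys = ?q" by (simp_all add: xs_def ys_def)
  have "(xs, ys) \<in> kmodel (letters as)"
    unfolding kmodel_letters[OF l] by (auto simp: xs_def ys_def ext_map simp del: map_append)
  then have 1: "(xs @ map embed ?zs, ys @ map embed ?zs) \<in> kmodel (letters as || one (R p))"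
    by (rule kmodel_pr) (rule kmodel_one, simp)
  have "(ys @ map embed ?zs) ! k \<subseteq> (xs @ map embed ?ws) ! m"
    if "k < ?q + p" "m < ?q + n" "S k m" for k m
  proof (cases "k < ?q")
    case True
    then show ?thesis
    proof (cases "m < ?q")
      case True
      with \<open>k < ?q\<close> \<open>S k m\<close> show ?thesis
        by (auto simp: xs_def ys_def nth_append intro!: imageI run_step simp del: map_append)
    next
      case False
      define j where "j = m - ?q"
      with False that have "m = ?q + j" "j < n" by simp_all
      with True \<open>S k m\<close> show ?thesis
        by (auto simp: ys_def nth_append intro!: imageI simp del: map_append)
    qed
  next
    case False
    define r where "r = k - ?q"
    with False that have r: "k = ?q + r" "r < p" by simp_all
    show ?thesis
    proof (cases "m < ?q")
      case True
      with r \<open>S k m\<close> show ?thesis by (auto simp: xs_def nth_append intro!: imageI run_start)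
    next
      case False
      define j where "j = m - ?q"
      with False that have "m = ?q + j" "j < n" by simp_all
      with r \<open>S k m\<close> show ?thesis by (auto simp: nth_append)
    qed
  qed
  then have 2: "(ys @ map embed ?zs, xs @ map embed ?ws) \<in> kmodel B"
    by (subst kmodel_has_matrix[OF B]) simp_all
  have "(xs @ map embed ?zs, xs @ map embed ?ws) \<in> kmodel (layer as p B)"
    by (rule kmodel_sq[OF _ 1 2]) (simp add: replicate_add)
  then show ?thesis
    unfolding lang_sem_def by (simp only: mem_Collect_eq case_prod_conv) (rule kmodel_trI[where xs =
      xs], simp_all add: replicate_add)
qed

text \<open>Every solution whose input \<open>i\<close> contains the empty word must contain all
  words produced by runs from \<open>i\<close>; this is the minimality of the solution built from
  runs.\<close>

lemma lang_sem_forced: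
  fixes B :: "'a kd"
  assumes B: "has_matrix (length as + p) (length as + n) B S" and i: "i < p" and j: "j < n"
    and mem: "(zs, ws) \<in> lang_sem (automaton as p n B)"
    and zs: "[] \<in> zs ! i"
  shows "S (length as + i) (length as + j) \<Longrightarrow> [] \<in> ws ! j"
    and "run as S i k w \<Longrightarrow> S k (length as + j) \<Longrightarrow> w @ [as ! k] \<in> ws ! j"
proof -
  let ?q = "length as"
  let ?F = "layer as p B"
  note [simp] = cmapD(1,2)[OF has_matrixD(1)[OF B]]
  have t: "dom ?F = R ?q @ R p" "cod ?F = R ?q @ R n" by (simp_all add: replicate_add)
  have mem': "(map embed zs, map embed ws) \<in> kmodel (tr (R ?q) (R p) (R n) ?F)" using mem by (simp add: lang_sem_def)
  have l [simp]: "length zs = p" "length ws = n"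
    using has_arityD[OF kmodel_arity mem'] t by simp_all
  obtain x y where xy: "(y, x) \<in> obj_ord (R ?q)" "(x @ map embed zs, y @ map embed ws) \<in> kmodel ?F"
    using kmodel_trE[OF t mem'] by blast
  then obtain u where u: "(x @ map embed zs, u) \<in> kmodel (letters as || one (R p))" "(u, y @ map embed ws) \<in> kmodel B"
    by (subst (asm) kmodel_simps(3)) (auto simp: replicate_add)
  have lx [simp]: "length x = ?q" "length y = ?q"
    using xy(1) by (auto simp: obj_ord_R list_all2_lengthD)
  have lu: "length u = ?q + p" using has_arityD[OF kmodel_arity u(1)] by simp
  define u1 u2 where "u1 = take ?q u" and "u2 = drop ?q u"
  then have u': "u = u1 @ u2" "length u1 = ?q" "length u2 = p" using lu by simp_all
  have "(x, u1) \<in> kmodel (letters as) \<and> (map embed zs, u2) \<in> kmodel (one (R p))"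
    using u(1) unfolding u'(1) by (subst (asm) kmodel_pr_iff) (simp_all add: u')
  then have 1: "ext (as ! k) ` (x ! k) \<subseteq> u1 ! k" if "k < ?q" for k
    using that kmodel_letters[of x as u1] u' by simp
  have 2: "[] \<in> u2 ! i"
    using \<open>_ \<and> _\<close> zs i unfolding kmodel_simps obj_ord_R by (auto dest!: list_all2_nthD)
  have 3: "(u1 @ u2) ! k \<subseteq> (y @ map embed ws) ! m" if "k < ?q + p" "m < ?q + n" "S k m" for k m
    using u(2) that unfolding u' by (subst (asm) kmodel_has_matrix[OF B]) (simp_all add: u')
  have 4: "y ! k \<subseteq> x ! k" if "k < ?q" for k
    using xy(1) that unfolding obj_ord_R by (auto dest: list_all2_nthD)
  \<comment> \<open>Induction along the run: the word of the predecessor passes through its letter,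
    is forced by the matrix into \<open>y ! m\<close>, and the loop returns it to
    \<open>x ! m\<close>.\<close>
  have 5: "map Some w \<in> x ! k" if "run as S i k w" for k w
    using that
  proof induction
    case (run_start m)
    then show ?case using 3[of "?q + i" m] 2 4[of m] i by (auto simp: nth_append u')
  next
    case (run_step k w m)
    have k: "k < ?q" using run_step(1) by (rule run_less)
    have "ext (as ! k) (map Some w) \<in> u1 ! k" using 1[OF k] run_step.IH by blast
    then show ?case using 3[of k m] 4[of m] k run_step.hyps by (auto simp: nth_append u' ext_map)
  qed
  show "S (?q + i) (?q + j) \<Longrightarrow> [] \<in> ws ! j"
    using 3[of "?q + i" "?q + j"] 2 i j by (auto simp: nth_append u')
  show "w @ [as ! k] \<in> ws ! j" if "run as S i k w" "S k (?q + j)"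
  proof -
    have k: "k < ?q" using that(1) by (rule run_less)
    have "map Some (w @ [as ! k]) \<in> u1 ! k" using 1[OF k] 5[OF that(1)] by (auto simp: ext_map simp del: map_append)
    then have "map Some (w @ [as ! k]) \<in> embed (ws ! j)" using 3[of k "?q + j"] k j that(2)
      by (auto simp: nth_append u')
    then show ?thesis by (simp add: inj_image_mem_iff inj_map_eq_map inj_mapI del: map_append)
  qed
qed

lemma lang_sem_lang_le:
  fixes B B' :: "'a kd"
  assumes B: "has_matrix (length as + p) (length as + n) B S"
    and B': "has_matrix (length as' + p) (length as' + n) B' S'"
    and incl: "lang_sem (automaton as p n B) \<subseteq>
      lang_sem (automaton as' p n B')"
  shows "lang_le p n as S as' S'"
  unfolding lang_le_def
proof (intro allI impI conjI; (elim conjE)?)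
  fix i j assume i: "i < p" and j: "j < n"
  \<comment> \<open>By the inclusion, the run solution of the first automaton is also a solution of
    the second, so it contains all words of the second automaton.\<close>
  note forced = lang_sem_forced[OF B' i j subsetD[OF incl lang_sem_runs[OF B i]]]
  show "S (length as + i) (length as + j)" if "S' (length as' + i) (length as' + j)"
    using forced(1)[OF _ that] i j by auto
  show "\<exists>m. run as S i m w \<and> as ! m = as' ! k \<and> S m (length as + j)"
    if "run as' S' i k w" "S' k (length as' + j)" for k w
    using forced(2)[OF _ that] i j by auto
qed

lemma nf_complete:
  assumes "nf p n D" "nf p n D'" "lang_sem D \<subseteq> lang_sem D'"
  shows "D \<le> D'"
  using assms unfolding nf_def boolean_def using nf_simulation lang_sem_lang_le by blast

section \<open>Comparing two bent diagrams of the same type\<close>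

lemma struct_count: "struct f \<Longrightarrow> count_list (dom f) w = count_list (cod f) w"
  by (induction rule: struct.induct) auto

text \<open>Counting orientations in \<open>V\<close> fixes \<open>n\<close> and \<open>p\<close>.
  The two sorting permutations then differ by an automorphism of \<open>L n @ R p\<close>, which
  \<open>struct_LR\<close> splits, and \<open>absorb_transpose\<close> moves its parts into the
  inputs and outputs of the second automaton.\<close>

lemma fwd_effect_same_struct:
  fixes \<phi> \<phi>' :: "'a kd"
  assumes "fwd_effect V \<phi>" "fwd_effect V \<phi>'"
  obtains \<pi> :: "'a kd" and n p D D' where "struct \<pi>" "dom \<pi> = V" "cod \<pi> = L n @ R p" "nf p n D" "nf p n D'"
    "\<phi> = \<pi> >> ((one (L n) || D) >> ev (R n))" "\<phi>' = \<pi> >> ((one (L n) || D') >> ev (R n))"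
proof -
  obtain \<pi> n p and D :: "'a kd" where 1: "struct \<pi>" "dom \<pi> = V" "cod \<pi> = L n @ R p" "nf p n D"
     "\<phi> = \<pi> >> ((one (L n) || D) >> ev (R n))" "dom D = R p" "cod D = R n"
    using assms(1) by (rule fwd_effectE)
  obtain \<pi>' n' p' and D' :: "'a kd" where 2: "struct \<pi>'" "dom \<pi>' = V" "cod \<pi>' = L n' @ R p'" "nf p' n' D'"
     "\<phi>' = \<pi>' >> ((one (L n') || D') >> ev (R n'))" "dom D' = R p'" "cod D' = R n'"
    using assms(2) by (rule fwd_effectE)
  have c: "count_list (replicate k a) b = (if a = b then k else 0)" for k and a b :: wire
    by (induction k) auto
  have "n' = n" "p' = p"
    using struct_count[OF 1(1), of \<triangleleft>] struct_count[OF 2(1), of \<triangleleft>]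
      struct_count[OF 1(1), of \<triangleright>] struct_count[OF 2(1), of \<triangleright>] by (simp_all add: 1 2 c)
  note 2 = 2[unfolded this]
  obtain g where g: "struct g" "cod g = V" "dom g = L n @ R p" "\<pi> >> g = one V"
    using struct_inverse[OF 1(1)] 1(2,3) by metis
  have "struct (g >> \<pi>')" using g 2 by (intro struct.sq) simp_all
  then obtain r s where r: "struct r" "struct s" "dom r = L n" "cod r = L n" "dom s = R p" "cod s = R p"
      "g >> \<pi>' = r || s"
    using struct_LR[of "g >> \<pi>'" n p] g 2 by auto
  obtain r' where r': "struct r'" "dom r' = dual (L n)" "cod r' = dual (L n)"
    "(r || one (dual (L n))) >> ev (dual (L n)) = (one (L n) || r') >> ev (dual (L n))"
    using struct_transpose[OF r(1)] r(3,4) by metis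
  have "\<pi>' = (\<pi> >> g) >> \<pi>'" using g 2 by simp
  also have "\<dots> = \<pi> >> (r || s)" unfolding r(7)[symmetric] using 1 2 g by (intro sq_assoc) simp_all
  finally have "\<phi>' = \<pi> >> ((r || s) >> ((one (L n) || D') >> ev (R n)))"
    unfolding 2(5) using 1 2 r by (simp add: sq_assoc)
  also have "(r || s) >> ((one (L n) || D') >> ev (R n)) = (one (L n) || ((s >> D') >> r')) >> ev (R n)"
    using absorb_transpose[OF r(3-6) _ _ r'(2-4), of D'] 2 by simp
  finally have "\<phi>' = \<pi> >> ((one (L n) || ((s >> D') >> r')) >> ev (R n))" .
  moreover have "nf p n ((s >> D') >> r')"
    using nf_post[OF nf_pre[OF 2(4) struct_boolean[OF r(2,5)]] struct_boolean[OF r'(1)]] r'(2) by simp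
  ultimately show ?thesis using that 1 by blast
qed

text \<open>Undo the sorting by \<open>g\<close>, then straighten the bent outputs by a zigzag. This
  reads the automaton off its effect.\<close>

lemma effect_recover:
  fixes D :: "'a kd"
  assumes D: "dom D = R p" "cod D = R n" and \<pi>: "cod \<pi> = L n @ R p"
    and g: "dom g = L n @ R p" "cod g = dom \<pi>" "g >> \<pi> = one (L n @ R p)"
  shows "(co (L n) || one (R p)) >> (one (R n) || (g >> (\<pi> >> ((one (L n) || D) >> ev (R n))))) = D"
proof -
  note [simp] = D \<pi> g(1,2)
  have "g >> (\<pi> >> ((one (L n) || D) >> ev (R n))) = (g >> \<pi>) >> ((one (L n) || D) >> ev (R n))"
    by (rule sq_assoc[symmetric]) simp_all
  also have "\<dots> = (one (L n) || D) >> ev (R n)" unfolding g(3) by simp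
  finally have "(co (L n) || one (R p)) >> (one (R n) || (g >> (\<pi> >> ((one (L n) || D) >> ev (R n))))) =
     (co (L n) || one (R p)) >> ((one (R n @ L n) || D) >> (one (R n) || ev (R n)))"
    by (simp add: one_pr_sq)
  also have "\<dots> = ((co (L n) || one (R p)) >> (one (R n @ L n) || D)) >> (one (R n) || ev (R n))"
    by (rule sq_assoc[symmetric]) simp_all
  also have "(co (L n) || one (R p)) >> (one (R n @ L n) || D) = (one [] || D) >> (co (L n) || one (R n))"
    using interchange[of "one []" "co (L n)" D "one (R n)"] by (simp add: interchange)
  also have "\<dots> >> (one (R n) || ev (R n)) = D >> ((co (L n) || one (R n)) >> (one (R n) || ev (R n)))"
    by (simp add: sq_assoc)
  also have "(co (L n) || one (R n)) >> (one (R n) || ev (R n)) = (one (R n) :: 'a kd)"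
    using snake_right[of "L n"] by simp
  finally show ?thesis by simp
qed

text \<open>Bending loses nothing: cups straighten the outputs again, by a zigzag. The context
  depends only on the type, so an inequality between bent diagrams can be unbent.\<close>

lemma eff_recover:
  fixes d :: "'a kd"
  shows "(one (dom d) || co (cod d)) >> (eff d || one (cod d)) = d"
proof -
  let ?X = "dom d" and ?Y = "cod d"
  have "(one ?X || co ?Y) >> (eff d || one ?Y) =
     ((one ?X || co ?Y) >> (d || one (dual ?Y @ ?Y))) >> (ev (dual ?Y) || one ?Y)"
    by (simp add: eff_def pr_sq_one sq_assoc)
  also have "(one ?X || co ?Y) >> (d || one (dual ?Y @ ?Y)) = (d || one []) >> (one ?Y || co ?Y)"
    using interchange[of d "one ?Y" "one []" "co ?Y"] by (simp add: interchange)
  also have "\<dots> >> (ev (dual ?Y) || one ?Y) = d >> ((one ?Y || co ?Y) >> (ev (dual ?Y) || one ?Y))"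
    by (simp add: sq_assoc)
  finally show ?thesis by (simp add: snake_left)
qed

lemma kda_complete:
  assumes d: "automaton_diagram d" and d': "automaton_diagram d'"
    and ty: "src d = src d'" "tgt d = tgt d'" and incl: "\<lbrakk>d\<rbrakk> \<subseteq> \<lbrakk>d'\<rbrakk>"
  shows "d \<le>\<^sub>K\<^sub>D\<^sub>A d'"
proof -
  define f f' where "f = abs_kd d" and "f' = abs_kd d'"
  have t: "dom f' = dom f" "cod f' = cod f" using ty by (simp_all add: f_def f'_def dom.abs_eq cod.abs_eq)
  have st: "stable f" "stable f'" unfolding f_def f'_def using d d' by (simp_all add: stable_automaton)
  have "lang_sem f \<subseteq> lang_sem f'" unfolding f_def f'_def lang_sem_abs[OF d] lang_sem_abs[OF d'] by (rule incl)
  then have le: "lang_sem (eff f) \<subseteq> lang_sem (eff f')" and st': "stable (eff f)" "stable (eff f')"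
    unfolding eff_def t
    by (intro lang_sem_sq_mono lang_sem_pr_mono stable_sq stable_pr stable_one stable_ev st order_refl; simp add: t)+
  have "fwd_effect (dom f @ dual (cod f)) (eff f)" "fwd_effect (dom f @ dual (cod f)) (eff f')"
    using fwd_rep_automaton[OF d] fwd_rep_automaton[OF d'] t unfolding fwd_rep_def f_def f'_def by simp_all
  then obtain \<pi> n p D D' where *: "struct \<pi>" "dom \<pi> = dom f @ dual (cod f)" "cod \<pi> = L n @ R p"
    "nf p n D" "nf p n D'" "eff f = \<pi> >> ((one (L n) || D) >> ev (R n))" "eff f' = \<pi> >> ((one (L n) || D') >> ev (R n))"
    by (rule fwd_effect_same_struct)
  obtain g where g: "struct g" "cod g = dom \<pi>" "dom g = L n @ R p" "g >> \<pi> = one (L n @ R p)"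
    using struct_inverse[OF *(1)] *(3) by metis
  \<comment> \<open>Both automata are recovered from their effects by the same context of stable
    parts, so the inclusion of relations passes from the effects to the automata.\<close>
  have rec: "D = (co (L n) || one (R p)) >> (one (R n) || (g >> eff f))"
    "D' = (co (L n) || one (R p)) >> (one (R n) || (g >> eff f'))"
    unfolding *(6,7) using effect_recover[OF nf_typing[OF *(4)] *(3) g(3,2,4)]
      effect_recover[OF nf_typing[OF *(5)] *(3) g(3,2,4)] by simp_all
  have "lang_sem D \<subseteq> lang_sem D'"
    unfolding rec by (intro lang_sem_sq_mono lang_sem_pr_mono stable_sq stable_pr stable_one stable_co
        stable_struct g(1) st' le order_refl; simp add: g *(2) t)
  then have "D \<le> D'" by (rule nf_complete[OF *(4,5)])
  then have "eff f \<le> eff f'" unfolding *(6,7) by (intro sq_mono pr_mono order_refl)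
  then have "f \<le> f'"
    using eff_recover[of f] eff_recover[of f'] unfolding t by (metis sq_mono pr_mono order_refl)
  then show ?thesis by (simp add: f_def f'_def less_eq_kd.abs_eq)
qed

theorem theorem3p3:
  fixes d d' :: "'a diagram"
  assumes "automaton_diagram d" and "automaton_diagram d'"
    and "src d = src d'" and "tgt d = tgt d'"
  shows "\<lbrakk>d\<rbrakk> \<subseteq> \<lbrakk>d'\<rbrakk> \<longleftrightarrow> d \<le>\<^sub>K\<^sub>D\<^sub>A d'"
proof
  show "d \<le>\<^sub>K\<^sub>D\<^sub>A d'" if "\<lbrakk>d\<rbrakk> \<subseteq> \<lbrakk>d'\<rbrakk>"
    using kda_complete[OF assms that] .
  \<comment> \<open>A derivation may pass through diagrams with white generators, so it is
    interpreted in the model; only its two ends are read back as relations on languages.\<close>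
  show "\<lbrakk>d\<rbrakk> \<subseteq> \<lbrakk>d'\<rbrakk>" if "d \<le>\<^sub>K\<^sub>D\<^sub>A d'"
    using kda_le_sound[OF that] assms(1,2) by (auto simp: sem_iff)
qed

end
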